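(* Let $a,b\ge2$. The cone $PKron_{a,b,ab}$ has at least $\binom{a+b-4}{b-2}$ strongly simplicial facets, i.e. faces of codimension one that are strongly simplicial.
   Context: Kronecker polyhedron. For a partition $\lambda$ of $n$ let $[\lambda]$ be the corresponding irreducible complex representation (Specht module) of $S_n$. For partitions of the same integer, the Kronecker coefficients $g(\lambda,\mu,\nu)$ are defined by $[\lambda]\otimes[\mu]=\bigoplus_\nu g(\lambda,\mu,\nu)[\nu]$, and $g(\lambda,\mu,\nu)=0$ unless $|\lambda|=|\mu|=|\nu|$. The length $\ell(\lambda)$ is the number of non zero parts. $Kron_{a,b,ab}$ is the semigroup of triples of partitions $(\lambda,\mu,\nu)$ with $\ell(\lambda)\le ab$, $\ell(\mu)\le a$, $\ell(\nu)\le b$ and $g(\lambda,\mu,\nu)\neq0$. $PKron_{a,b,ab}\subset\mathbb R^{ab}\times\mathbb R^{a}\times\mathbb R^{b}$ is the rational polyhedral cone it generates. Additive faces. A standard tableau $T$ of rectangular shape $a\times b$ is a bijection from the boxes $(i,j)$, $1\le i\le a$, $1\le j\le b$, to $\{1,\dots,ab\}$, increasing in $i$ and in $j$. It is additive if there are real numbers $x_1<\cdots<x_a$ and $y_1<\cdots<y_b$ such that $T(i,j)<T(k,l)\iff x_i+y_j<x_k+y_l$. For $\lambda=(\lambda_1,\dots,\lambda_{ab})$ put $a_T(\lambda)_i=\sum_{j=1}^b\lambda_{T(i,j)}$ and $b_T(\lambda)_j=\sum_{i=1}^a\lambda_{T(i,j)}$. For $T$ additive, $f_T=\{(\lambda,a_T(\lambda),b_T(\lambda)):\lambda_1\ge\cdots\ge\lambda_{ab}\ge0\}$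 is a face of $PKron_{a,b,ab}$, called an additive face. Conormal cone. Let $e_1,\dots,e_a$ and $f_1,\dots,f_b$ be the standard bases of $\mathbb Z^a$ and $\mathbb Z^b$, and for $T$ additive put $g_k=e_i+f_j\in\mathbb Z^a\oplus\mathbb Z^b$ if $T(i,j)=k$. The conormal cone $C_T$ is the cone generated by the vectors $g_\ell-g_k$ with $\ell>k$. Among these vectors, those of the form $e_p-e_q$ are called horizontal and those of the form $f_p-f_q$ vertical. Sending a face $F\supset f_T$ of $PKron_{a,b,ab}$ to the cone generated by the vectors $(\mu-a_T(\lambda),\nu-b_T(\lambda))$, $(\lambda,\mu,\nu)\in F$, is a bijection between faces of $PKron_{a,b,ab}$ containing $f_T$ and faces of $C_T$ ("the face of $C_T$ corresponding to $F$"). Strongly simplicial faces. A face $F$ of $PKron_{a,b,ab}$ is strongly simplicial if it contains an additive face $f_T$ such that the face of $C_T$ corresponding to $F$ satisfies, for some $d\ge0$: (1) it has dimension $d$ and is generated by $d$ vectors $g_{k_1+1}-g_{k_1},\dots,g_{k_d+1}-g_{k_d}$; (2) none of these vectors is horizontal (unless $b=2$) or vertical (unless $a=2$); (3) no other vector of the form $g_p-g_q$, $p>q$, belongs to it; (4) in particular the pairs $(k_1,k_1+1),\dots,(k_d,k_d+1)$ do not intersect. *)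

theory Defs
  imports
    "HOL-Analysis.Analysis"
    "HOL-Combinatorics.Permutations"
    "HOL-Library.Function_Algebras"
begin

section \<open>Partitions and Specht modules\<close>

text \<open>A partition is the infinite sequence of its parts, padded with zeros; parts are indexed from 0.\<close>

definition is_partition :: "(nat \<Rightarrow> nat) \<Rightarrow> bool" where
  "is_partition lam \<longleftrightarrow> antimono lam \<and> finite {i. lam i \<noteq> 0}"

definition psize :: "(nat \<Rightarrow> nat) \<Rightarrow> nat" where
  "psize lam = (\<Sum>i | lam i \<noteq> 0. lam i)"

definition plength :: "(nat \<Rightarrow> nat) \<Rightarrow> nat" where
  "plength lam = card {i. lam i \<noteq> 0}"

definition diagram :: "(nat \<Rightarrow> nat) \<Rightarrow> (nat \<times> nat) set" where
  "diagram lam = {(i, j). j < lam i}"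

text \<open>The group \<open>S\<^sub>n\<close> consists of the \<open>\<sigma>\<close> with \<open>\<sigma> permutes {..<n}\<close>. A numbering of shape
  \<open>lam\<close> fills the boxes bijectively with \<open>0, \<dots>, n - 1\<close>.\<close>

definition is_numbering :: "(nat \<Rightarrow> nat) \<Rightarrow> (nat \<times> nat \<Rightarrow> nat) \<Rightarrow> bool" where
  "is_numbering lam t \<longleftrightarrow> bij_betw t (diagram lam) {..<psize lam}"

text \<open>The tabloid of \<open>t\<close>, i.e. \<open>t\<close> up to reordering the entries of each row, is encoded by the map
  sending each entry to the row which contains it (and numbers that are not entries to 0).\<close>

definition tabloid :: "(nat \<Rightarrow> nat) \<Rightarrow> (nat \<times> nat \<Rightarrow> nat) \<Rightarrow> nat \<Rightarrow> nat" where
  "tabloid lam t = (\<lambda>x. if x < psize lam then fst (inv_into (diagram lam) t x) else 0)"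

definition column_stabilizer :: "(nat \<Rightarrow> nat) \<Rightarrow> (nat \<times> nat \<Rightarrow> nat) \<Rightarrow> (nat \<Rightarrow> nat) set" where
  "column_stabilizer lam t =
     {\<sigma>. \<sigma> permutes {..<psize lam} \<and>
         (\<forall>x<psize lam. snd (inv_into (diagram lam) t (\<sigma> x)) = snd (inv_into (diagram lam) t x))}"

text \<open>Formal complex combinations of tabloids are functions on row assignments; the polytabloid is
  \<open>e\<^sub>t = \<Sum>\<^sub>\<sigma> sgn(\<sigma>) {\<sigma> t}\<close>, the sum being over the column stabilizer of \<open>t\<close>.\<close>

definition polytabloid :: "(nat \<Rightarrow> nat) \<Rightarrow> (nat \<times> nat \<Rightarrow> nat) \<Rightarrow> (nat \<Rightarrow> nat) \<Rightarrow> complex" where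
  "polytabloid lam t =
     (\<lambda>w. \<Sum>\<sigma>\<in>column_stabilizer lam t. of_int (sign \<sigma>) * (if w = tabloid lam (\<sigma> \<circ> t) then 1 else 0))"

interpretation cfun: vector_space "\<lambda>(c::complex) (f::'x \<Rightarrow> complex) x. c * f x"
  by unfold_locales (auto simp: fun_eq_iff algebra_simps)

definition specht :: "(nat \<Rightarrow> nat) \<Rightarrow> ((nat \<Rightarrow> nat) \<Rightarrow> complex) set" where
  "specht lam = cfun.span {polytabloid lam t | t. is_numbering lam t}"


section \<open>Kronecker coefficients\<close>

text \<open>All representations below are spaces of functions on a set \<open>X\<close> carrying an action of \<open>S\<^sub>n\<close>.
  On row assignments \<open>\<sigma> \<cdot> w = w \<circ> \<sigma>\<^sup>-\<^sup>1\<close>, so that \<open>\<sigma> \<cdot> tabloid lam t = tabloid lam (\<sigma> \<circ> t)\<close>, and on functions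
  \<open>(\<sigma> \<cdot> f) x = f (\<sigma>\<^sup>-\<^sup>1 \<cdot> x)\<close>. The parameter \<open>\<alpha> \<sigma>\<close> below stands for the map \<open>x \<mapsto> \<sigma>\<^sup>-\<^sup>1 \<cdot> x\<close>.\<close>

definition rep_isomorphic ::
  "nat \<Rightarrow> ((nat \<Rightarrow> nat) \<Rightarrow> 'x \<Rightarrow> 'x) \<Rightarrow> ('x \<Rightarrow> complex) set \<Rightarrow>
   ((nat \<Rightarrow> nat) \<Rightarrow> 'y \<Rightarrow> 'y) \<Rightarrow> ('y \<Rightarrow> complex) set \<Rightarrow> bool" where
  "rep_isomorphic n \<alpha> V \<beta> W \<longleftrightarrow>
     (\<exists>\<phi>. bij_betw \<phi> V W \<and>
          (\<forall>f\<in>V. \<forall>g\<in>V. \<phi> (\<lambda>x. f x + g x) = (\<lambda>y. \<phi> f y + \<phi> g y)) \<and>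
          (\<forall>c. \<forall>f\<in>V. \<phi> (\<lambda>x. c * f x) = (\<lambda>y. c * \<phi> f y)) \<and>
          (\<forall>\<sigma>. \<sigma> permutes {..<n} \<longrightarrow> (\<forall>f\<in>V. \<phi> (\<lambda>x. f (\<alpha> \<sigma> x)) = (\<lambda>y. \<phi> f (\<beta> \<sigma> y)))))"

text \<open>The tensor product of two function spaces is realised inside the functions on pairs.\<close>

definition specht_tensor ::
  "(nat \<Rightarrow> nat) \<Rightarrow> (nat \<Rightarrow> nat) \<Rightarrow> ((nat \<Rightarrow> nat) \<times> (nat \<Rightarrow> nat) \<Rightarrow> complex) set" where
  "specht_tensor lam \<mu> = cfun.span {(\<lambda>(u, v). f u * g v) | f g. f \<in> specht lam \<and> g \<in> specht \<mu>}"

definition tensor_act ::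
  "(nat \<Rightarrow> nat) \<Rightarrow> (nat \<Rightarrow> nat) \<times> (nat \<Rightarrow> nat) \<Rightarrow> (nat \<Rightarrow> nat) \<times> (nat \<Rightarrow> nat)" where
  "tensor_act \<sigma> = (\<lambda>(u, v). (u \<circ> \<sigma>, v \<circ> \<sigma>))"

text \<open>The direct sum of \<open>m \<nu>\<close> copies of \<open>specht \<nu>\<close> for every partition \<open>\<nu>\<close> of \<open>n\<close>: the copies are
  indexed by the pairs \<open>(\<nu>, i)\<close> with \<open>i < m \<nu>\<close>, and \<open>h (\<nu>, i, _)\<close> is the component of \<open>h\<close> in that copy.
  The sum is finite, as there are finitely many partitions of \<open>n\<close>.\<close>

definition specht_sum ::
  "nat \<Rightarrow> ((nat \<Rightarrow> nat) \<Rightarrow> nat) \<Rightarrow> ((nat \<Rightarrow> nat) \<times> nat \<times> (nat \<Rightarrow> nat) \<Rightarrow> complex) set" where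
  "specht_sum n m =
     {h. \<forall>\<nu> i. (\<lambda>w. h (\<nu>, i, w)) \<in>
            (if is_partition \<nu> \<and> psize \<nu> = n \<and> i < m \<nu> then specht \<nu> else {\<lambda>w. 0})}"

definition sum_act ::
  "(nat \<Rightarrow> nat) \<Rightarrow> (nat \<Rightarrow> nat) \<times> nat \<times> (nat \<Rightarrow> nat) \<Rightarrow> (nat \<Rightarrow> nat) \<times> nat \<times> (nat \<Rightarrow> nat)" where
  "sum_act \<sigma> = (\<lambda>(\<nu>, i, w). (\<nu>, i, w \<circ> \<sigma>))"

text \<open>The multiplicities in the decomposition of \<open>specht lam \<otimes> specht \<mu>\<close> are unique, by Krull--Schmidt, once they
  are required to vanish away from the partitions of \<open>n\<close>.\<close>

definition kronecker ::
  "(nat \<Rightarrow> nat) \<Rightarrow> (nat \<Rightarrow> nat) \<Rightarrow> (nat \<Rightarrow> nat) \<Rightarrow> nat" where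
  "kronecker lam \<mu> \<nu> =
     (if psize lam = psize \<mu> \<and> psize \<mu> = psize \<nu>
      then (THE m. (\<forall>\<rho>. \<not> (is_partition \<rho> \<and> psize \<rho> = psize lam) \<longrightarrow> m \<rho> = 0) \<and>
                   rep_isomorphic (psize lam) tensor_act (specht_tensor lam \<mu>)
                     sum_act (specht_sum (psize lam) m)) \<nu>
      else 0)"


section \<open>The Kronecker polyhedron\<close>

text \<open>The finite linearly ordered types \<open>'a\<close>, \<open>'b\<close>, \<open>'m\<close> play the role of \<open>{1..a}\<close>, \<open>{1..b}\<close> and
  \<open>{1..ab}\<close>: here \<open>a = CARD('a)\<close>, \<open>b = CARD('b)\<close>, and \<open>CARD('m) = ab\<close> is assumed wherever it matters.
  The first component of a triple, of dimension \<open>ab\<close>, is the one written \<open>lam\<close>.\<close>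

definition part_vec :: "(nat \<Rightarrow> nat) \<Rightarrow> real ^ ('i::{finite,linorder})" where
  "part_vec lam = (\<chi> i. real (lam (card {j. j < i})))"

definition PKron ::
  "((real, 'm::{finite,linorder}) vec \<times> (real, 'a::{finite,linorder}) vec \<times> (real, 'b::{finite,linorder}) vec) set" where
  "PKron = convex_cone hull
     {(part_vec lam, part_vec \<mu>, part_vec \<nu>) | lam \<mu> \<nu>.
        is_partition lam \<and> is_partition \<mu> \<and> is_partition \<nu> \<and>
        plength lam \<le> CARD('m) \<and> plength \<mu> \<le> CARD('a) \<and> plength \<nu> \<le> CARD('b) \<and>
        kronecker lam \<mu> \<nu> \<noteq> 0}"


section \<open>Additive faces\<close>

definition standard_tableau ::
  "('a::{finite,linorder} \<times> 'b::{finite,linorder} \<Rightarrow> 'm::{finite,linorder}) \<Rightarrow> bool" where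
  "standard_tableau T \<longleftrightarrow>
     bij T \<and> (\<forall>j. strict_mono (\<lambda>i. T (i, j))) \<and> (\<forall>i. strict_mono (\<lambda>j. T (i, j)))"

definition additive_tableau ::
  "('a::{finite,linorder} \<times> 'b::{finite,linorder} \<Rightarrow> 'm::{finite,linorder}) \<Rightarrow> bool" where
  "additive_tableau T \<longleftrightarrow> standard_tableau T \<and>
     (\<exists>(x::'a \<Rightarrow> real) (y::'b \<Rightarrow> real). strict_mono x \<and> strict_mono y \<and>
        (\<forall>i j k l. T (i, j) < T (k, l) \<longleftrightarrow> x i + y j < x k + y l))"

definition row_sums :: "('a::finite \<times> 'b::finite \<Rightarrow> 'm::finite) \<Rightarrow> real ^ 'm \<Rightarrow> real ^ 'a" where
  "row_sums T lam = (\<chi> i. \<Sum>j\<in>UNIV. lam $ T (i, j))"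

definition col_sums :: "('a::finite \<times> 'b::finite \<Rightarrow> 'm::finite) \<Rightarrow> real ^ 'm \<Rightarrow> real ^ 'b" where
  "col_sums T lam = (\<chi> j. \<Sum>i\<in>UNIV. lam $ T (i, j))"

definition additive_face ::
  "('a::{finite,linorder} \<times> 'b::{finite,linorder} \<Rightarrow> 'm::{finite,linorder}) \<Rightarrow>
   ((real, 'm) vec \<times> (real, 'a) vec \<times> (real, 'b) vec) set" where
  "additive_face T =
     {(lam, row_sums T lam, col_sums T lam) | lam. antimono (\<lambda>k. lam $ k) \<and> (\<forall>k. 0 \<le> lam $ k)}"


section \<open>Strongly simplicial faces\<close>

text \<open>\<open>g\<^sub>k = e\<^sub>i + f\<^sub>j\<close> where \<open>T (i, j) = k\<close>.\<close>

definition gvec ::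
  "('a::finite \<times> 'b::finite \<Rightarrow> 'm::finite) \<Rightarrow> 'm \<Rightarrow> (real, 'a) vec \<times> (real, 'b) vec" where
  "gvec T k = (case inv T k of (i, j) \<Rightarrow> (axis i 1, axis j 1))"

definition horizontal :: "(real, 'a::finite) vec \<times> (real, 'b::finite) vec \<Rightarrow> bool" where
  "horizontal v \<longleftrightarrow> (\<exists>p q. v = (axis p 1 - axis q 1, 0))"

definition vertical :: "(real, 'a::finite) vec \<times> (real, 'b::finite) vec \<Rightarrow> bool" where
  "vertical v \<longleftrightarrow> (\<exists>p q. v = (0, axis p 1 - axis q 1))"

text \<open>For a face \<open>F\<close> of \<open>PKron\<close> containing \<open>additive_face T\<close>, this is the corresponding face of the
  conormal cone, the latter being generated by the vectors \<open>gvec T l - gvec T k\<close> with \<open>k < l\<close>.\<close>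

definition conormal_face ::
  "('a::{finite,linorder} \<times> 'b::{finite,linorder} \<Rightarrow> 'm::{finite,linorder}) \<Rightarrow>
   ((real, 'm) vec \<times> (real, 'a) vec \<times> (real, 'b) vec) set \<Rightarrow> ((real, 'a) vec \<times> (real, 'b) vec) set" where
  "conormal_face T F =
     convex_cone hull {(\<mu> - row_sums T lam, \<nu> - col_sums T lam) | lam \<mu> \<nu>. (lam, \<mu>, \<nu>) \<in> F}"

text \<open>\<open>consecutive k l\<close> means \<open>l = k + 1\<close> in the linear order.\<close>

definition consecutive :: "'m::linorder \<Rightarrow> 'm \<Rightarrow> bool" where
  "consecutive k l \<longleftrightarrow> k < l \<and> {k<..<l} = {}"

text \<open>\<open>P\<close> is the set of the \<open>d\<close> pairs \<open>(k\<^sub>i, k\<^sub>i + 1)\<close>. In the third condition, vectors are compared, not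
  the pairs \<open>(p, q)\<close> they come from: \<open>e\<^sub>i - e\<^sub>j\<close> is always a difference \<open>gvec T p - gvec T q\<close> in several ways.\<close>

definition strongly_simplicial ::
  "((real, 'm::{finite,linorder}) vec \<times> (real, 'a::{finite,linorder}) vec \<times> (real, 'b::{finite,linorder}) vec) set
   \<Rightarrow> bool" where
  "strongly_simplicial F \<longleftrightarrow> F face_of PKron \<and>
     (\<exists>(T :: 'a \<times> 'b \<Rightarrow> 'm) (d :: nat) P.
        additive_tableau T \<and> additive_face T \<subseteq> F \<and>
        card P = d \<and> (\<forall>(k, l)\<in>P. consecutive k l) \<and>
        aff_dim (conormal_face T F) = int d \<and>
        conormal_face T F = convex_cone hull {gvec T l - gvec T k | k l. (k, l) \<in> P} \<and>
        (\<forall>(k, l)\<in>P. (CARD('b) \<noteq> 2 \<longrightarrow> \<not> horizontal (gvec T l - gvec T k)) \<and>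
                     (CARD('a) \<noteq> 2 \<longrightarrow> \<not> vertical (gvec T l - gvec T k))) \<and>
        (\<forall>p q. q < p \<and> gvec T p - gvec T q \<in> conormal_face T F \<longrightarrow>
                (\<exists>(k, l)\<in>P. gvec T p - gvec T q = gvec T l - gvec T k)) \<and>
        (\<forall>(k, l)\<in>P. \<forall>(k', l')\<in>P. (k, l) \<noteq> (k', l') \<longrightarrow> {k, l} \<inter> {k', l'} = {}))"

end

theory Submission
  imports Defs "HOL-Combinatorics.Cycles"
begin

text \<open>The facets are found by letting a linear form single them out. Choose integers
\<open>x\<^sub>1 < \<dots> < x\<^sub>a\<close> and \<open>y\<^sub>1 < \<dots> < y\<^sub>b\<close>, give the box \<open>(i, j)\<close> the weight
\<open>x\<^sub>i + y\<^sub>j\<close> and let \<open>s\<^sub>1 \<le> s\<^sub>2 \<le> \<dots>\<close> be the sorted weights. The form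
\<open>x \<bullet> \<mu> + y \<bullet> \<nu> - s \<bullet> \<lambda>\<close> is nonnegative on the Kronecker cone, and it vanishes on \<open>f\<^sub>T\<close> for every
tableau \<open>T\<close> that numbers the boxes by increasing weight. If equal weights occur only in pairs, the face where
the form vanishes corresponds to the cone spanned by the vectors \<open>g\<^sub>k\<^sub>+\<^sub>1 - g\<^sub>k\<close> for which the
\<open>k\<close>-th and \<open>(k+1)\<close>-st weights tie. It is a facet as soon as the ties determine \<open>(x, y)\<close> up to
translations and a common factor, and it is strongly simplicial if there are moreover only \<open>a + b - 3\<close> ties
(\<open>tie_face_facet\<close>, \<open>tie_face_strongly_simplicial\<close>).

Such weights grow from \<open>x = (0, 1)\<close>, \<open>y = (0, 1)\<close>: append to \<open>x\<close> or to \<open>y\<close> the sum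
of the two largest entries. The only new tie is between the formerly largest box and the smallest new one, and it
fixes the new entry (\<open>tight_step\<close>). There are \<open>a - 2\<close> steps of the first and \<open>b - 2\<close> of the
second kind, in any order, which gives the binomial coefficient. Different orders give different facets, because
the ratio of the largest entries determines the last step: undoing the steps is Euclid's subtractive algorithm
(\<open>top_weights_inj\<close>).

Near the additive faces the Kronecker cone is known well enough from two facts. If
\<open>g(\<lambda>, \<mu>, \<nu>) \<noteq> 0\<close>, then every column of \<open>\<lambda>\<close>, of height \<open>h\<close> say, selects a set of
\<open>h\<close> boxes in the \<open>a \<times> b\<close> rectangle, in such a way that \<open>\<mu>\<close> and \<open>\<nu>\<close> count the
selected boxes by rows and by columns; so the cone lies in the one generated by all sets of boxes
(\<open>PKron_subset_column_cone\<close>), on which minimizing the form means taking boxes of least weight. Conversely the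
sets of boxes that are Young diagrams give points of the cone (\<open>young_set_in_PKron\<close>), since
\<open>g(1\<^sup>n, \<mu>, \<mu>') \<noteq> 0\<close>. One more triple, \<open>((2), (1, 1), (1, 1))\<close>, shows that the form does not vanish
identically.

Both facts need a workable description of the Kronecker coefficients. For a numbering of shape \<open>\<nu>\<close> let
\<open>c\<^sub>\<nu>\<close> be the Young symmetrizer. It annihilates the Specht modules of other shapes and has rank one on that of
shape \<open>\<nu>\<close>, so the multiplicity of \<open>[\<nu>]\<close> in \<open>W\<close> can only be the rank of \<open>c\<^sub>\<nu>\<close> on
\<open>W\<close>. That these multiplicities really occur is a completeness statement: the sums of the conjugates of the
\<open>c\<^sub>\<nu>\<close> are nonzero pairwise orthogonal class functions, as many as there are conjugacy classes, hence the unit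
of the group algebra is a combination of them and every representation is generated by the images of the
\<open>c\<^sub>\<nu>\<close> (\<open>young_resolution\<close>, \<open>specht_decomposition\<close>, \<open>kronecker_nonzero_iff\<close>).\<close>

section \<open>Symmetric groups and stabilizers\<close>

definition Sn :: "nat \<Rightarrow> (nat \<Rightarrow> nat) set" where
  "Sn n = {\<sigma>. \<sigma> permutes {..<n}}"

text \<open>Row groups and column groups both arise in this way: a numbering enters only through the function \<open>w\<close>
that sends each entry to its row, or to its column.\<close>

definition stab :: "nat \<Rightarrow> (nat \<Rightarrow> nat) \<Rightarrow> (nat \<Rightarrow> nat) set" where
  "stab n w = {\<sigma> \<in> Sn n. w \<circ> \<sigma> = w}"

lemma Sn_permutes: "\<sigma> \<in> Sn n \<Longrightarrow> \<sigma> permutes {..<n}"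
  by (simp add: Sn_def)

lemma finite_Sn [simp]: "finite (Sn n)"
  by (simp add: Sn_def finite_permutations)

lemma id_Sn [simp]: "id \<in> Sn n" by (simp add: Sn_def)

lemma comp_Sn [simp]: "\<sigma> \<in> Sn n \<Longrightarrow> \<tau> \<in> Sn n \<Longrightarrow> \<sigma> \<circ> \<tau> \<in> Sn n"
  by (simp add: Sn_def permutes_compose)

lemma inv_Sn [simp]: "\<sigma> \<in> Sn n \<Longrightarrow> inv \<sigma> \<in> Sn n"
  by (simp add: Sn_def permutes_inv)

lemma inv_comp_Sn [simp]: "\<sigma> \<in> Sn n \<Longrightarrow> inv \<sigma> \<circ> \<sigma> = id" "\<sigma> \<in> Sn n \<Longrightarrow> \<sigma> \<circ> inv \<sigma> = id"
  by (auto simp: Sn_def permutes_inv_o)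

lemma inv_comp_Sn_left [simp]:
  "\<sigma> \<in> Sn n \<Longrightarrow> inv \<sigma> \<circ> (\<sigma> \<circ> h) = h" "\<sigma> \<in> Sn n \<Longrightarrow> \<sigma> \<circ> (inv \<sigma> \<circ> h) = h"
  by (simp_all flip: comp_assoc)

lemma inv_inv_Sn [simp]: "\<sigma> \<in> Sn n \<Longrightarrow> inv (inv \<sigma>) = \<sigma>"
  by (auto simp: Sn_def permutes_inv_inv)

lemma inv_mult_Sn: "\<sigma> \<in> Sn n \<Longrightarrow> \<tau> \<in> Sn n \<Longrightarrow> inv (\<sigma> \<circ> \<tau>) = inv \<tau> \<circ> inv \<sigma>"
  by (auto simp: Sn_def intro: o_inv_distrib permutes_bij)

lemma comp_eq_id_Sn: "\<sigma> \<in> Sn n \<Longrightarrow> \<tau> \<in> Sn n \<Longrightarrow> \<sigma> \<circ> \<tau> = id \<longleftrightarrow> \<tau> = inv \<sigma>"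
  by (metis inv_comp_Sn(2) inv_comp_Sn_left(1) comp_id)

lemma stab_Sn: "\<sigma> \<in> stab n w \<Longrightarrow> \<sigma> \<in> Sn n"
  by (simp add: stab_def)

lemma finite_stab [simp]: "finite (stab n w)"
  by (rule finite_subset[of _ "Sn n"]) (auto simp: stab_def)

lemma id_stab [simp]: "id \<in> stab n w" by (simp add: stab_def)

lemma comp_stab: "\<sigma> \<in> stab n w \<Longrightarrow> \<tau> \<in> stab n w \<Longrightarrow> \<sigma> \<circ> \<tau> \<in> stab n w"
  by (simp add: stab_def flip: comp_assoc)

lemma inv_stab: "\<sigma> \<in> stab n w \<Longrightarrow> inv \<sigma> \<in> stab n w"
  by (auto simp: stab_def) (metis comp_assoc comp_id inv_comp_Sn(2))

lemma Sn_eq_stab: "Sn n = stab n (\<lambda>_. 0)"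
  by (auto simp: stab_def)

lemma sum_stab_left: "\<tau> \<in> stab n w \<Longrightarrow> (\<Sum>\<sigma>\<in>stab n w. F (\<tau> \<circ> \<sigma>)) = (\<Sum>\<sigma>\<in>stab n w. F \<sigma>)"
  by (rule sum.reindex_bij_witness[where i = "\<lambda>\<sigma>. inv \<tau> \<circ> \<sigma>" and j = "\<lambda>\<sigma>. \<tau> \<circ> \<sigma>"])
     (auto intro: comp_stab inv_stab simp: inv_comp_Sn_left[OF stab_Sn])

lemma sum_stab_right: "\<tau> \<in> stab n w \<Longrightarrow> (\<Sum>\<sigma>\<in>stab n w. F (\<sigma> \<circ> \<tau>)) = (\<Sum>\<sigma>\<in>stab n w. F \<sigma>)"
proof (rule sum.reindex_bij_witness[where i = "\<lambda>\<sigma>. \<sigma> \<circ> inv \<tau>" and j = "\<lambda>\<sigma>. \<sigma> \<circ> \<tau>"])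
qed (auto intro: comp_stab inv_stab simp: comp_assoc stab_Sn inv_comp_Sn[OF stab_Sn])

lemma sum_stab_inv: "(\<Sum>\<sigma>\<in>stab n w. F (inv \<sigma>)) = (\<Sum>\<sigma>\<in>stab n w. F \<sigma>)"
proof (rule sum.reindex_bij_witness[where i = inv and j = inv])
qed (auto intro: inv_stab simp: inv_inv_Sn[OF stab_Sn])

lemmas sum_Sn_left = sum_stab_left[where w = "\<lambda>_. 0", folded Sn_eq_stab]
lemmas sum_Sn_right = sum_stab_right[where w = "\<lambda>_. 0", folded Sn_eq_stab]

lemma stab_conj:
  assumes "g \<in> Sn n"
  shows "stab n (w \<circ> inv g) = (\<lambda>\<sigma>. g \<circ> \<sigma> \<circ> inv g) ` stab n w"
proof
  show "(\<lambda>\<sigma>. g \<circ> \<sigma> \<circ> inv g) ` stab n w \<subseteq> stab n (w \<circ> inv g)"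
    using assms by (auto simp: stab_def) (metis (no_types) comp_assoc inv_comp_Sn_left(1))
  show "stab n (w \<circ> inv g) \<subseteq> (\<lambda>\<sigma>. g \<circ> \<sigma> \<circ> inv g) ` stab n w"
  proof
    fix \<sigma> assume s: "\<sigma> \<in> stab n (w \<circ> inv g)"
    have "w \<circ> (inv g \<circ> \<sigma> \<circ> g) = w"
    proof -
      have "(w \<circ> inv g \<circ> \<sigma>) \<circ> g = w \<circ> inv g \<circ> g" using s by (simp add: stab_def)
      thus ?thesis using assms by (simp add: comp_assoc)
    qed
    hence "inv g \<circ> \<sigma> \<circ> g \<in> stab n w" using s assms by (simp add: stab_def)
    moreover have "\<sigma> = g \<circ> (inv g \<circ> \<sigma> \<circ> g) \<circ> inv g" using assms by (simp add: comp_assoc)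
    ultimately show "\<sigma> \<in> (\<lambda>\<sigma>. g \<circ> \<sigma> \<circ> inv g) ` stab n w" by blast
  qed
qed

lemma inj_conj: "g \<in> Sn n \<Longrightarrow> inj_on (\<lambda>\<sigma>. g \<circ> \<sigma> \<circ> inv g) A"
proof (rule inj_onI)
  fix x y assume g: "g \<in> Sn n" and "g \<circ> x \<circ> inv g = g \<circ> y \<circ> inv g"
  hence "inv g \<circ> (g \<circ> x \<circ> inv g) \<circ> g = inv g \<circ> (g \<circ> y \<circ> inv g) \<circ> g" by simp
  thus "x = y" using g by (simp add: comp_assoc)
qed

section \<open>Signed sums over stabilizers\<close>

abbreviation wact :: "(nat \<Rightarrow> nat) \<Rightarrow> (nat \<Rightarrow> nat) \<Rightarrow> (nat \<Rightarrow> nat)" where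
  "wact \<equiv> \<lambda>\<sigma> w. w \<circ> \<sigma>"

text \<open>As for the parameter of \<open>rep_isomorphic\<close>, \<open>\<alpha> \<sigma>\<close> is the action of the inverse of
\<open>\<sigma>\<close> on points, whence the reversed order.\<close>

definition is_action :: "((nat \<Rightarrow> nat) \<Rightarrow> 'x \<Rightarrow> 'x) \<Rightarrow> bool" where
  "is_action \<alpha> \<longleftrightarrow> (\<forall>x. \<alpha> id x = x) \<and> (\<forall>\<sigma> \<tau> x. \<alpha> (\<sigma> \<circ> \<tau>) x = \<alpha> \<tau> (\<alpha> \<sigma> x))"

definition act :: "((nat \<Rightarrow> nat) \<Rightarrow> 'x \<Rightarrow> 'x) \<Rightarrow> (nat \<Rightarrow> nat) \<Rightarrow> ('x \<Rightarrow> complex) \<Rightarrow> 'x \<Rightarrow> complex" where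
  "act \<alpha> \<sigma> f = (\<lambda>x. f (\<alpha> \<sigma> x))"

text \<open>The action of the group algebra element \<open>\<Sum>\<sigma>\<in>A. \<eta> \<sigma> \<sigma>\<close>.\<close>

definition group_sum :: "((nat \<Rightarrow> nat) \<Rightarrow> 'x \<Rightarrow> 'x) \<Rightarrow> (nat \<Rightarrow> nat) set \<Rightarrow> ((nat \<Rightarrow> nat) \<Rightarrow> complex)
    \<Rightarrow> ('x \<Rightarrow> complex) \<Rightarrow> 'x \<Rightarrow> complex" where
  "group_sum \<alpha> A \<eta> f = (\<lambda>x. \<Sum>\<sigma>\<in>A. \<eta> \<sigma> * f (\<alpha> \<sigma> x))"

definition csgn :: "(nat \<Rightarrow> nat) \<Rightarrow> complex" where "csgn \<sigma> = of_int (sign \<sigma>)"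

text \<open>The second condition makes the values \<open>\<plusminus>1\<close>; only the trivial character and the sign occur.\<close>

definition linear_char :: "nat \<Rightarrow> ((nat \<Rightarrow> nat) \<Rightarrow> complex) \<Rightarrow> bool" where
  "linear_char n \<eta> \<longleftrightarrow> (\<forall>\<sigma>\<in>Sn n. \<forall>\<tau>\<in>Sn n. \<eta> (\<sigma> \<circ> \<tau>) = \<eta> \<sigma> * \<eta> \<tau>) \<and> (\<forall>\<sigma>\<in>Sn n. \<eta> \<sigma> * \<eta> \<sigma> = 1)"

lemma permutation_Sn: "\<sigma> \<in> Sn n \<Longrightarrow> permutation \<sigma>"
  by (auto simp: Sn_def permutation_permutes)

lemma csgn_mult: "\<sigma> \<in> Sn n \<Longrightarrow> \<tau> \<in> Sn n \<Longrightarrow> csgn (\<sigma> \<circ> \<tau>) = csgn \<sigma> * csgn \<tau>"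
  using permutation_Sn by (auto simp: csgn_def sign_compose)

lemma csgn_sq [simp]: "csgn \<sigma> * csgn \<sigma> = 1"
  by (simp add: csgn_def flip: of_int_mult)

lemma csgn_sq_left [simp]: "csgn \<sigma> * (csgn \<sigma> * x) = x"
  by (simp flip: mult.assoc)

lemma csgn_id [simp]: "csgn id = 1" by (simp add: csgn_def)

lemma csgn_inv [simp]: "\<sigma> \<in> Sn n \<Longrightarrow> csgn (inv \<sigma>) = csgn \<sigma>"
  using permutation_Sn by (auto simp: csgn_def sign_inverse)

lemma linear_char_csgn [simp]: "linear_char n csgn"
  by (auto simp: linear_char_def csgn_mult)

lemma linear_char_1 [simp]: "linear_char n (\<lambda>_. 1)"
  by (auto simp: linear_char_def)

lemma char_conj:
  assumes "linear_char n \<eta>" "g \<in> Sn n" "\<sigma> \<in> Sn n"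
  shows "\<eta> (g \<circ> \<sigma> \<circ> inv g) = \<eta> \<sigma>"
proof -
  have h: "\<eta> (a \<circ> b) = \<eta> a * \<eta> b" "\<eta> a * \<eta> a = 1" if "a \<in> Sn n" "b \<in> Sn n" for a b
    using assms(1) that by (auto simp: linear_char_def)
  have "\<eta> g * \<eta> (inv g) = \<eta> (id \<circ> id)"
    using assms(2) by (metis comp_id h(1) inv_Sn inv_comp_Sn(2))
  also have "\<dots> = 1" using h[of id id] by simp
  finally have "\<eta> g * \<eta> (inv g) = 1" .
  moreover have "\<eta> (g \<circ> \<sigma> \<circ> inv g) = \<eta> g * \<eta> (inv g) * \<eta> \<sigma>"
    using assms(2,3) by (simp add: h)
  ultimately show ?thesis by simp
qed

lemma act_group_sum:
  assumes \<alpha>: "is_action \<alpha>" and \<eta>: "linear_char n \<eta>" and t: "\<tau> \<in> stab n w"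
  shows "act \<alpha> \<tau> (group_sum \<alpha> (stab n w) \<eta> f) = (\<lambda>x. \<eta> \<tau> * group_sum \<alpha> (stab n w) \<eta> f x)"
proof
  fix x
  have "act \<alpha> \<tau> (group_sum \<alpha> (stab n w) \<eta> f) x = (\<Sum>\<sigma>\<in>stab n w. \<eta> \<sigma> * f (\<alpha> (\<tau> \<circ> \<sigma>) x))"
    using \<alpha> by (simp add: act_def group_sum_def is_action_def)
  also have "\<dots> = (\<Sum>\<sigma>\<in>stab n w. \<eta> \<tau> * (\<eta> (\<tau> \<circ> \<sigma>) * f (\<alpha> (\<tau> \<circ> \<sigma>) x)))"
    using \<eta> t by (intro sum.cong refl) (simp add: linear_char_def stab_Sn flip: mult.assoc)
  also have "\<dots> = \<eta> \<tau> * group_sum \<alpha> (stab n w) \<eta> f x"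
    unfolding group_sum_def sum_distrib_left by (rule sum_stab_left[OF t])
  finally show "act \<alpha> \<tau> (group_sum \<alpha> (stab n w) \<eta> f) x = \<eta> \<tau> * group_sum \<alpha> (stab n w) \<eta> f x" .
qed

lemma group_sum_act:
  assumes \<alpha>: "is_action \<alpha>" and \<eta>: "linear_char n \<eta>" and t: "\<tau> \<in> stab n w"
  shows "group_sum \<alpha> (stab n w) \<eta> (act \<alpha> \<tau> f) = (\<lambda>x. \<eta> \<tau> * group_sum \<alpha> (stab n w) \<eta> f x)"
proof
  fix x
  have "group_sum \<alpha> (stab n w) \<eta> (act \<alpha> \<tau> f) x = (\<Sum>\<sigma>\<in>stab n w. \<eta> \<sigma> * f (\<alpha> (\<sigma> \<circ> \<tau>) x))"
    using \<alpha> by (simp add: act_def group_sum_def is_action_def)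
  also have "\<dots> = (\<Sum>\<sigma>\<in>stab n w. \<eta> \<tau> * (\<eta> (\<sigma> \<circ> \<tau>) * f (\<alpha> (\<sigma> \<circ> \<tau>) x)))"
  proof (intro sum.cong refl)
    fix \<sigma> assume s: "\<sigma> \<in> stab n w"
    have "\<eta> \<tau> * \<eta> (\<sigma> \<circ> \<tau>) = \<eta> \<sigma> * (\<eta> \<tau> * \<eta> \<tau>)"
      using \<eta> t s by (simp add: linear_char_def stab_Sn)
    also have "\<dots> = \<eta> \<sigma>" using \<eta> t by (simp add: linear_char_def stab_Sn)
    finally show "\<eta> \<sigma> * f (\<alpha> (\<sigma> \<circ> \<tau>) x) = \<eta> \<tau> * (\<eta> (\<sigma> \<circ> \<tau>) * f (\<alpha> (\<sigma> \<circ> \<tau>) x))"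
      by (simp flip: mult.assoc)
  qed
  also have "\<dots> = \<eta> \<tau> * group_sum \<alpha> (stab n w) \<eta> f x"
    unfolding group_sum_def sum_distrib_left by (rule sum_stab_right[OF t])
  finally show "group_sum \<alpha> (stab n w) \<eta> (act \<alpha> \<tau> f) x = \<eta> \<tau> * group_sum \<alpha> (stab n w) \<eta> f x" .
qed

text \<open>Conjugating a group sum amounts to moving the function whose stabilizer is summed over. This is what
lets statements about one numbering be transported to all numberings of its shape.\<close>

lemma act_group_sum_conj:
  assumes \<alpha>: "is_action \<alpha>" and \<eta>: "linear_char n \<eta>" and g: "g \<in> Sn n"
  shows "act \<alpha> g (group_sum \<alpha> (stab n w) \<eta> f) = group_sum \<alpha> (stab n (w \<circ> inv g)) \<eta> (act \<alpha> g f)"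
proof
  fix x
  have "group_sum \<alpha> (stab n (w \<circ> inv g)) \<eta> (act \<alpha> g f) x
     = (\<Sum>\<sigma>\<in>stab n w. \<eta> (g \<circ> \<sigma> \<circ> inv g) * f (\<alpha> g (\<alpha> (g \<circ> \<sigma> \<circ> inv g) x)))"
    by (simp add: group_sum_def act_def stab_conj[OF g] sum.reindex[OF inj_conj[OF g]])
  also have "\<dots> = (\<Sum>\<sigma>\<in>stab n w. \<eta> \<sigma> * f (\<alpha> \<sigma> (\<alpha> g x)))"
  proof (intro sum.cong refl)
    fix \<sigma> assume s: "\<sigma> \<in> stab n w"
    have "\<alpha> g (\<alpha> (g \<circ> \<sigma> \<circ> inv g) x) = \<alpha> ((g \<circ> \<sigma> \<circ> inv g) \<circ> g) x"
      using \<alpha> by (simp only: is_action_def)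
    also have "(g \<circ> \<sigma> \<circ> inv g) \<circ> g = g \<circ> \<sigma>" using g by (simp add: comp_assoc)
    also have "\<alpha> (g \<circ> \<sigma>) x = \<alpha> \<sigma> (\<alpha> g x)" using \<alpha> by (simp only: is_action_def)
    finally have e: "\<alpha> g (\<alpha> (g \<circ> \<sigma> \<circ> inv g) x) = \<alpha> \<sigma> (\<alpha> g x)" .
    show "\<eta> (g \<circ> \<sigma> \<circ> inv g) * f (\<alpha> g (\<alpha> (g \<circ> \<sigma> \<circ> inv g) x)) = \<eta> \<sigma> * f (\<alpha> \<sigma> (\<alpha> g x))"
      unfolding e char_conj[OF \<eta> g stab_Sn[OF s]] ..
  qed
  finally show "act \<alpha> g (group_sum \<alpha> (stab n w) \<eta> f) x = group_sum \<alpha> (stab n (w \<circ> inv g)) \<eta> (act \<alpha> g f) x"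
    by (simp add: act_def group_sum_def)
qed

lemma act_act: "is_action \<alpha> \<Longrightarrow> act \<alpha> \<sigma> (act \<alpha> \<tau> f) = act \<alpha> (\<sigma> \<circ> \<tau>) f"
  by (simp add: act_def is_action_def)

lemma act_id [simp]: "is_action \<alpha> \<Longrightarrow> act \<alpha> id f = f"
  by (simp add: act_def is_action_def)

lemma group_sum_zero [simp]: "group_sum \<alpha> A \<eta> (\<lambda>_. 0) = (\<lambda>_. 0)"
  by (simp add: group_sum_def)

lemma group_sum_scale: "group_sum \<alpha> A \<eta> (\<lambda>x. k * f x) = (\<lambda>x. k * group_sum \<alpha> A \<eta> f x)"
  by (simp add: group_sum_def sum_distrib_left mult_ac)

lemma group_sum_add: "group_sum \<alpha> A \<eta> (\<lambda>x. f x + g x) = (\<lambda>x. group_sum \<alpha> A \<eta> f x + group_sum \<alpha> A \<eta> g x)"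
  by (simp add: group_sum_def sum.distrib algebra_simps)

lemma group_sum_sum: "group_sum \<alpha> A \<eta> (\<lambda>x. \<Sum>i\<in>I. F i x) = (\<lambda>x. \<Sum>i\<in>I. group_sum \<alpha> A \<eta> (F i) x)"
proof
  fix x
  have "group_sum \<alpha> A \<eta> (\<lambda>x. \<Sum>i\<in>I. F i x) x = (\<Sum>\<sigma>\<in>A. \<Sum>i\<in>I. \<eta> \<sigma> * F i (\<alpha> \<sigma> x))"
    by (simp add: group_sum_def sum_distrib_left)
  also have "\<dots> = (\<Sum>i\<in>I. \<Sum>\<sigma>\<in>A. \<eta> \<sigma> * F i (\<alpha> \<sigma> x))" by (rule sum.swap)
  finally show "group_sum \<alpha> A \<eta> (\<lambda>x. \<Sum>i\<in>I. F i x) x = (\<Sum>i\<in>I. group_sum \<alpha> A \<eta> (F i) x)"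
    by (simp add: group_sum_def)
qed

abbreviation "symm n \<alpha> r \<equiv> group_sum \<alpha> (stab n r) (\<lambda>_. 1)"
abbreviation "antisymm n \<alpha> c \<equiv> group_sum \<alpha> (stab n c) csgn"

definition young :: "nat \<Rightarrow> ((nat \<Rightarrow> nat) \<Rightarrow> 'x \<Rightarrow> 'x) \<Rightarrow> (nat \<Rightarrow> nat) \<Rightarrow> (nat \<Rightarrow> nat) \<Rightarrow>
    ('x \<Rightarrow> complex) \<Rightarrow> 'x \<Rightarrow> complex" where
  "young n \<alpha> r c f = antisymm n \<alpha> c (symm n \<alpha> r f)"

lemma transpose_stab:
  assumes "a < n" "b < n" "w a = w b"
  shows "Transposition.transpose a b \<in> stab n w"
proof -
  have "w \<circ> Transposition.transpose a b = w"
    using assms by (auto simp: fun_eq_iff Transposition.transpose_def)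
  thus ?thesis using assms by (simp add: stab_def Sn_def permutes_swap_id)
qed

text \<open>The transposition of two entries that share a row of one numbering and a column of the other is
absorbed with sign \<open>+1\<close> by the row sum and with sign \<open>-1\<close> by the column sum.\<close>

lemma symm_antisymm_zero:
  assumes \<alpha>: "is_action \<alpha>" and ab: "a < n" "b < n" "a \<noteq> b" and rc: "r a = r b" "c a = c b"
  shows "symm n \<alpha> r (antisymm n \<alpha> c f) = (\<lambda>_. 0)" "antisymm n \<alpha> c (symm n \<alpha> r f) = (\<lambda>_. 0)"
proof -
  let ?t = "Transposition.transpose a b"
  have t: "?t \<in> stab n r" "?t \<in> stab n c" using transpose_stab ab rc by auto
  have s: "csgn ?t = -1" using ab by (simp add: csgn_def sign_swap_id)
  \<comment> \<open>The transposition is evaluated in two ways: absorbed by the outer sum and by the inner one.\<close>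
  have "symm n \<alpha> r (act \<alpha> ?t (antisymm n \<alpha> c f)) = symm n \<alpha> r (antisymm n \<alpha> c f)"
    using group_sum_act[OF \<alpha> linear_char_1 t(1)] by simp
  moreover have "symm n \<alpha> r (act \<alpha> ?t (antisymm n \<alpha> c f)) = (\<lambda>x. (-1) * symm n \<alpha> r (antisymm n \<alpha> c f) x)"
    using act_group_sum[OF \<alpha> linear_char_csgn t(2)] s by (simp only: group_sum_scale)
  ultimately have "(\<lambda>x. (-1) * symm n \<alpha> r (antisymm n \<alpha> c f) x) = symm n \<alpha> r (antisymm n \<alpha> c f)" by simp
  thus "symm n \<alpha> r (antisymm n \<alpha> c f) = (\<lambda>_. 0)"
    by (auto simp: fun_eq_iff neg_eq_iff_add_eq_0)
  have "antisymm n \<alpha> c (act \<alpha> ?t (symm n \<alpha> r f)) = (\<lambda>x. (-1) * antisymm n \<alpha> c (symm n \<alpha> r f) x)"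
    using group_sum_act[OF \<alpha> linear_char_csgn t(2)] s by simp
  moreover have "antisymm n \<alpha> c (act \<alpha> ?t (symm n \<alpha> r f)) = antisymm n \<alpha> c (symm n \<alpha> r f)"
    using act_group_sum[OF \<alpha> linear_char_1 t(1)] by simp
  ultimately have "(\<lambda>x. (-1) * antisymm n \<alpha> c (symm n \<alpha> r f) x) = antisymm n \<alpha> c (symm n \<alpha> r f)" by simp
  thus "antisymm n \<alpha> c (symm n \<alpha> r f) = (\<lambda>_. 0)"
    by (auto simp: fun_eq_iff neg_eq_iff_add_eq_0)
qed

section \<open>Specht modules in terms of row and column functions\<close>

text \<open>A numbering, recorded by the row and the column of each entry. The value 0 off the entries makes the
record unique, so that the row function is exactly the tabloid.\<close>

definition placement :: "(nat \<Rightarrow> nat) \<Rightarrow> (nat \<Rightarrow> nat) \<Rightarrow> (nat \<Rightarrow> nat) \<Rightarrow> bool" where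
  "placement lam r c \<longleftrightarrow> bij_betw (\<lambda>x. (r x, c x)) {..<psize lam} (diagram lam) \<and>
     (\<forall>x\<ge>psize lam. r x = 0 \<and> c x = 0)"

lemma placement_comp:
  assumes "placement lam r c" "g \<in> Sn (psize lam)"
  shows "placement lam (r \<circ> g) (c \<circ> g)"
proof -
  have g: "bij_betw g {..<psize lam} {..<psize lam}" 
    using assms(2) by (simp add: Sn_def permutes_imp_bij)
  have "bij_betw ((\<lambda>x. (r x, c x)) \<circ> g) {..<psize lam} (diagram lam)"
    using assms(1) by (intro bij_betw_trans[OF g]) (simp add: placement_def)
  moreover have "g x = x" if "x \<ge> psize lam" for x
    using assms(2) that by (auto simp: Sn_def intro: permutes_not_in)
  ultimately show ?thesis using assms(1) by (simp add: placement_def o_def)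
qed

lemma placement_conj:
  assumes p: "placement lam r c" and q: "placement lam r' c'"
  shows "\<exists>g\<in>Sn (psize lam). r' = r \<circ> g \<and> c' = c \<circ> g"
proof -
  let ?n = "psize lam"
  let ?p = "\<lambda>x. (r x, c x)" and ?q = "\<lambda>x. (r' x, c' x)"
  have bp: "bij_betw ?p {..<?n} (diagram lam)" and bq: "bij_betw ?q {..<?n} (diagram lam)"
    using p q by (auto simp: placement_def)
  define g where "g = (\<lambda>x. if x < ?n then inv_into {..<?n} ?p (?q x) else x)"
  have "bij_betw (inv_into {..<?n} ?p \<circ> ?q) {..<?n} {..<?n}"
    using bij_betw_trans[OF bq bij_betw_inv_into[OF bp]] .
  hence "bij_betw g {..<?n} {..<?n}"
    by (rule bij_betw_cong[THEN iffD1, rotated]) (auto simp: g_def)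
  hence g: "g \<in> Sn ?n" unfolding Sn_def mem_Collect_eq by (rule bij_imp_permutes) (simp add: g_def)
  have "?p (g x) = ?q x" if "x < ?n" for x
  proof -
    have "?q x \<in> ?p ` {..<?n}" using bp bq that by (auto simp: bij_betw_def)
    thus ?thesis using that f_inv_into_f[of "?q x" ?p "{..<?n}"] by (simp add: g_def)
  qed
  moreover have "?p (g x) = ?q x" if "x \<ge> ?n" for x
    using p q that by (simp add: g_def placement_def)
  ultimately have "?p (g x) = ?q x" for x by (meson not_le)
  thus ?thesis using g by (intro bexI[of _ g]) (auto simp: fun_eq_iff)
qed

definition colmap :: "(nat \<Rightarrow> nat) \<Rightarrow> (nat \<times> nat \<Rightarrow> nat) \<Rightarrow> nat \<Rightarrow> nat" where
  "colmap lam t = (\<lambda>x. if x < psize lam then snd (inv_into (diagram lam) t x) else 0)"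

lemma placement_numbering:
  assumes "is_numbering lam t"
  shows "placement lam (tabloid lam t) (colmap lam t)"
proof -
  have "bij_betw (inv_into (diagram lam) t) {..<psize lam} (diagram lam)"
    using assms by (simp add: is_numbering_def bij_betw_inv_into)
  hence "bij_betw (\<lambda>x. (tabloid lam t x, colmap lam t x)) {..<psize lam} (diagram lam)"
    by (rule bij_betw_cong[THEN iffD1, rotated]) (auto simp: tabloid_def colmap_def)
  thus ?thesis by (simp add: placement_def tabloid_def colmap_def)
qed

lemma numbering_placement:
  assumes "placement lam r c"
  obtains t where "is_numbering lam t" "tabloid lam t = r" "colmap lam t = c"
proof -
  let ?p = "\<lambda>x. (r x, c x)"
  define t where "t = inv_into {..<psize lam} ?p"
  have b: "bij_betw ?p {..<psize lam} (diagram lam)" using assms by (simp add: placement_def)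
  have t: "is_numbering lam t" unfolding is_numbering_def t_def by (rule bij_betw_inv_into[OF b])
  have "inv_into (diagram lam) t x = ?p x" if "x < psize lam" for x
  proof (rule inv_into_f_eq)
    show "inj_on t (diagram lam)" using t by (simp add: is_numbering_def bij_betw_def)
    show "?p x \<in> diagram lam" using b that by (auto simp: bij_betw_def)
    show "t (?p x) = x" unfolding t_def
      using inv_into_f_f[of ?p "{..<psize lam}" x] b that by (simp add: bij_betw_def)
  qed
  hence "tabloid lam t = r" "colmap lam t = c"
    using assms by (auto simp: tabloid_def colmap_def fun_eq_iff placement_def not_less)
  thus ?thesis using t that by blast
qed

lemma is_action_wact [simp]: "is_action wact"
  by (auto simp: is_action_def)

definition ket :: "'x \<Rightarrow> 'x \<Rightarrow> complex" where "ket r = (\<lambda>w. if w = r then 1 else 0)"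

text \<open>The polytabloid as a signed column sum of a point mass.\<close>

definition polytab :: "nat \<Rightarrow> (nat \<Rightarrow> nat) \<Rightarrow> (nat \<Rightarrow> nat) \<Rightarrow> (nat \<Rightarrow> nat) \<Rightarrow> complex" where
  "polytab n r c = antisymm n wact c (ket r)"

lemma inv_into_perm_numbering:
  assumes t: "is_numbering lam t" and s: "\<sigma> \<in> Sn (psize lam)" and x: "x < psize lam"
  shows "inv_into (diagram lam) (\<sigma> \<circ> t) x = inv_into (diagram lam) t (inv \<sigma> x)"
proof (rule inv_into_f_eq)
  have b: "bij_betw \<sigma> {..<psize lam} {..<psize lam}" using s by (simp add: Sn_def permutes_imp_bij)
  show "inj_on (\<sigma> \<circ> t) (diagram lam)"
    using t s by (auto simp: is_numbering_def bij_betw_def Sn_def intro!: comp_inj_on permutes_inj_on)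
  have i: "inv \<sigma> x < psize lam"
    using s x by (metis Sn_permutes inv_Sn lessThan_iff permutes_in_image)
  hence "inv \<sigma> x \<in> t ` diagram lam" using t by (auto simp: is_numbering_def bij_betw_def)
  thus "inv_into (diagram lam) t (inv \<sigma> x) \<in> diagram lam"
    "(\<sigma> \<circ> t) (inv_into (diagram lam) t (inv \<sigma> x)) = x"
    using s by (auto simp: inv_into_into f_inv_into_f Sn_def permutes_inverses)
qed

lemma tabloid_perm:
  assumes t: "is_numbering lam t" and s: "\<sigma> \<in> Sn (psize lam)"
  shows "tabloid lam (\<sigma> \<circ> t) = tabloid lam t \<circ> inv \<sigma>"
proof
  fix x
  show "tabloid lam (\<sigma> \<circ> t) x = (tabloid lam t \<circ> inv \<sigma>) x"
  proof (cases "x < psize lam")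
    case True
    hence "inv \<sigma> x < psize lam" using s by (metis Sn_permutes inv_Sn lessThan_iff permutes_in_image)
    thus ?thesis using True inv_into_perm_numbering[OF t s] by (simp add: tabloid_def)
  next
    case False
    hence "inv \<sigma> x = x" using s by (metis Sn_permutes inv_Sn lessThan_iff permutes_not_in)
    thus ?thesis using False by (simp add: tabloid_def)
  qed
qed

lemma column_stabilizer_eq: "column_stabilizer lam t = stab (psize lam) (colmap lam t)"
proof -
  have "(\<forall>x<psize lam. snd (inv_into (diagram lam) t (\<sigma> x)) = snd (inv_into (diagram lam) t x))
      \<longleftrightarrow> colmap lam t \<circ> \<sigma> = colmap lam t" if "\<sigma> permutes {..<psize lam}" for \<sigma>
  proof -
    have "\<sigma> x < psize lam \<longleftrightarrow> x < psize lam" for x using permutes_in_image[OF that] by auto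
    thus ?thesis by (auto simp: fun_eq_iff colmap_def)
  qed
  thus ?thesis by (auto simp: column_stabilizer_def stab_def Sn_def)
qed

lemma polytabloid_eq:
  assumes t: "is_numbering lam t"
  shows "polytabloid lam t = polytab (psize lam) (tabloid lam t) (colmap lam t)"
proof
  fix w
  have "polytabloid lam t w = (\<Sum>\<sigma>\<in>stab (psize lam) (colmap lam t).
      csgn \<sigma> * (if w = tabloid lam t \<circ> inv \<sigma> then 1 else 0))"
    unfolding polytabloid_def column_stabilizer_eq csgn_def
    by (intro sum.cong refl) (simp add: tabloid_perm[OF t stab_Sn])
  also have "\<dots> = (\<Sum>\<sigma>\<in>stab (psize lam) (colmap lam t).
      csgn \<sigma> * (if w \<circ> \<sigma> = tabloid lam t then 1 else 0))"
  proof (intro sum.cong refl arg_cong2[where f = "(*)"] if_cong)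
    fix \<sigma> assume "\<sigma> \<in> stab (psize lam) (colmap lam t)"
    hence "\<sigma> \<in> Sn (psize lam)" by (rule stab_Sn)
    thus "(w = tabloid lam t \<circ> inv \<sigma>) = (w \<circ> \<sigma> = tabloid lam t)"
      by (metis comp_assoc comp_id inv_comp_Sn)
  qed
  finally show "polytabloid lam t w = polytab (psize lam) (tabloid lam t) (colmap lam t) w"
    by (simp add: polytab_def group_sum_def ket_def)
qed

lemma specht_eq: "specht lam = cfun.span {polytab (psize lam) r c | r c. placement lam r c}"
proof -
  have "{polytabloid lam t | t. is_numbering lam t} = {polytab (psize lam) r c | r c. placement lam r c}"
  proof (intro equalityI subsetI)
    fix f assume "f \<in> {polytabloid lam t | t. is_numbering lam t}"
    thus "f \<in> {polytab (psize lam) r c | r c. placement lam r c}"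
      using polytabloid_eq placement_numbering by blast
  next
    fix f assume "f \<in> {polytab (psize lam) r c | r c. placement lam r c}"
    then obtain r c where f: "f = polytab (psize lam) r c" and "placement lam r c" by blast
    then obtain t where "is_numbering lam t" "tabloid lam t = r" "colmap lam t = c"
      using numbering_placement by blast
    moreover from this have "f = polytabloid lam t" using f by (simp add: polytabloid_eq)
    ultimately show "f \<in> {polytabloid lam t | t. is_numbering lam t}" by blast
  qed
  thus ?thesis by (simp add: specht_def)
qed

lemma diagram_Sigma: "diagram lam = Sigma {i. lam i \<noteq> 0} (\<lambda>i. {..<lam i})"
  by (auto simp: diagram_def)

lemma finite_diagram: "is_partition lam \<Longrightarrow> finite (diagram lam)"
  by (simp add: diagram_Sigma is_partition_def)

lemma card_diagram: "is_partition lam \<Longrightarrow> card (diagram lam) = psize lam"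
  by (simp add: diagram_Sigma is_partition_def psize_def card_SigmaI)

lemma placement_exists:
  assumes "is_partition lam"
  shows "\<exists>r c. placement lam r c"
proof -
  obtain t where t: "bij_betw t (diagram lam) {0..<card (diagram lam)}"
    using ex_bij_betw_finite_nat[OF finite_diagram[OF assms]] by blast
  hence "is_numbering lam t" by (simp add: is_numbering_def card_diagram[OF assms] atLeast0LessThan)
  thus ?thesis using placement_numbering by blast
qed

section \<open>Comparing shapes column by column\<close>

text \<open>The \<open>k\<close> smallest natural numbers minimize the sum of a monotone function over \<open>k\<close>-element
sets.\<close>

lemma sum_lessThan_card_le:
  fixes S :: "nat \<Rightarrow> real"
  assumes "finite A" "mono S"
  shows "(\<Sum>i<card A. S i) \<le> (\<Sum>i\<in>A. S i)"
  using assms(1)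
proof (induction "card A" arbitrary: A)
  case 0
  thus ?case by simp
next
  case (Suc k)
  let ?m = "Max A"
  have ne: "A \<noteq> {}" using Suc.hyps(2) by auto
  have m: "?m \<in> A" using Suc.prems ne by simp
  have "A \<subseteq> {..?m}" using Suc.prems by auto
  hence "card A \<le> Suc ?m" using card_mono[of "{..?m}" A] by simp
  hence "S k \<le> S ?m" using assms(2) Suc.hyps(2) by (auto simp: mono_def)
  moreover have "card (A - {?m}) = k" using m Suc.hyps(2) Suc.prems by simp
  hence "(\<Sum>i<k. S i) \<le> (\<Sum>i\<in>A - {?m}. S i)" using Suc.hyps(1)[of "A - {?m}"] Suc.prems by simp
  ultimately show ?case
    using Suc.hyps(2)[symmetric] sum.remove[OF Suc.prems m, of S] by simp
qed

lemma sum_eq_lessThan_card: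
  fixes A :: "nat set"
  assumes A: "finite A" and eq: "(\<Sum>i\<in>A. real i) = (\<Sum>i<card A. real i)"
  shows "A = {..<card A}"
proof (cases "A = {}")
  case False
  let ?m = "Max A"
  have m: "?m \<in> A" using A False by simp
  obtain k where k: "card A = Suc k" using A False by (cases "card A") auto
  have "card (A - {?m}) = k" using k A m by simp
  hence "(\<Sum>i<k. real i) \<le> (\<Sum>i\<in>A - {?m}. real i)"
    using sum_lessThan_card_le[of "A - {?m}" real] A by (auto simp: mono_def)
  hence "real ?m \<le> real k" using eq sum.remove[OF A m, of real] k by simp
  hence "A \<subseteq> {..<card A}" using k Max_ge[OF A] by (fastforce simp: less_Suc_eq_le)
  thus ?thesis by (intro card_subset_eq) auto
qed simp

lemma down_set_eq_lessThan:
  fixes A :: "nat set"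
  assumes "finite A" "\<And>i j. i \<in> A \<Longrightarrow> j \<le> i \<Longrightarrow> j \<in> A"
  shows "A = {..<card A}"
proof (cases "A = {}")
  case False
  have m: "Max A \<in> A" using assms(1) False by simp
  have "A = {..Max A}"
    using assms(2)[OF m] Max_ge[OF assms(1)] by blast
  thus ?thesis by (metis card_lessThan lessThan_Suc_atMost)
qed simp

definition row_weight :: "(nat \<Rightarrow> nat) \<Rightarrow> (nat \<Rightarrow> real) \<Rightarrow> real" where
  "row_weight lam S = (\<Sum>p\<in>diagram lam. S (fst p))"

lemma row_weight_placement:
  assumes "placement lam r c"
  shows "(\<Sum>x<psize lam. S (r x)) = row_weight lam S"
  using sum.reindex_bij_betw[of "\<lambda>x. (r x, c x)" "{..<psize lam}" "diagram lam" "S \<circ> fst"] assms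
  by (simp add: row_weight_def placement_def)

lemma column_rows:
  assumes lam: "is_partition lam" and p: "placement lam r c"
  defines "X \<equiv> \<lambda>j. {x. x < psize lam \<and> c x = j}"
  shows "inj_on r (X j)" "r ` X j = {..<card (X j)}" "r ` X j = {i. j < lam i}"
proof -
  have inj: "inj_on (\<lambda>x. (r x, c x)) {..<psize lam}"
    and im: "(\<lambda>x. (r x, c x)) ` {..<psize lam} = diagram lam"
    using p by (auto simp: placement_def bij_betw_def)
  show 1: "inj_on r (X j)" using inj by (auto simp: X_def inj_on_def)
  show 2: "r ` X j = {i. j < lam i}"
  proof
    show "r ` X j \<subseteq> {i. j < lam i}" using im by (auto simp: X_def diagram_def)
    show "{i. j < lam i} \<subseteq> r ` X j"
    proof
      fix i assume "i \<in> {i. j < lam i}"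
      hence "(i, j) \<in> (\<lambda>x. (r x, c x)) ` {..<psize lam}" by (simp add: im diagram_def)
      thus "i \<in> r ` X j" by (auto simp: X_def)
    qed
  qed
  have "{i. j < lam i} = {..<card {i. j < lam i}}"
  proof (rule down_set_eq_lessThan)
    show "finite {i. j < lam i}"
      by (rule finite_subset[of _ "{i. lam i \<noteq> 0}"]) (use lam in \<open>auto simp: is_partition_def\<close>)
    show "\<And>i k. i \<in> {i. j < lam i} \<Longrightarrow> k \<le> i \<Longrightarrow> k \<in> {i. j < lam i}"
    proof -
      fix i k :: nat assume "i \<in> {i. j < lam i}" "k \<le> i"
      moreover from this have "lam i \<le> lam k" using lam by (simp add: is_partition_def antimono_def)
      ultimately show "k \<in> {i. j < lam i}" by simp
    qed
  qed
  thus "r ` X j = {..<card (X j)}" using 2 card_image[OF 1] by simp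
qed

lemma sum_by_columns:
  "(\<Sum>x<n. F x) = (\<Sum>j\<in>c ` {..<n::nat}. \<Sum>x | x < n \<and> c x = j. (F x :: 'b :: comm_monoid_add))"
  using sum.image_gen[of "{..<n}" F c] by simp

text \<open>A labelling that is injective on every column of the shape weighs at least as much as the row numbers,
since a column of height \<open>h\<close> carries \<open>h\<close> distinct labels and its rows are the \<open>h\<close> smallest ones. Applied
to step functions this is the dominance inequality.\<close>

lemma row_weight_le:
  assumes lam: "is_partition lam" and p: "placement lam r c" and S: "mono S"
    and inj: "\<And>x y. x < psize lam \<Longrightarrow> y < psize lam \<Longrightarrow> x \<noteq> y \<Longrightarrow> c x = c y \<Longrightarrow> \<rho> x \<noteq> (\<rho> y :: nat)"
  shows "row_weight lam S \<le> (\<Sum>x<psize lam. S (\<rho> x))"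
proof -
  let ?X = "\<lambda>j. {x. x < psize lam \<and> c x = j}"
  have "row_weight lam S = (\<Sum>j\<in>c ` {..<psize lam}. \<Sum>x\<in>?X j. S (r x))"
    unfolding row_weight_placement[OF p, symmetric] by (rule sum_by_columns)
  also have "\<dots> \<le> (\<Sum>j\<in>c ` {..<psize lam}. \<Sum>x\<in>?X j. S (\<rho> x))"
  proof (rule sum_mono)
    fix j
    have i: "inj_on \<rho> (?X j)" by (rule inj_onI) (metis (mono_tags, lifting) inj mem_Collect_eq)
    have "(\<Sum>x\<in>?X j. S (r x)) = (\<Sum>i<card (?X j). S i)"
      using sum.reindex[OF column_rows(1)[OF lam p], of S j] column_rows(2)[OF lam p, of j] by simp
    also have "\<dots> \<le> (\<Sum>i\<in>\<rho> ` ?X j. S i)"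
      using sum_lessThan_card_le[of "\<rho> ` ?X j" S] S by (simp add: card_image[OF i])
    also have "\<dots> = (\<Sum>x\<in>?X j. S (\<rho> x))" by (simp add: sum.reindex[OF i])
    finally show "(\<Sum>x\<in>?X j. S (r x)) \<le> (\<Sum>x\<in>?X j. S (\<rho> x))" .
  qed
  also have "\<dots> = (\<Sum>x<psize lam. S (\<rho> x))" by (rule sum_by_columns[symmetric])
  finally show ?thesis .
qed

text \<open>Equality in the column-wise comparison. Both row functions have the same total, so in every column
the rows taken from the second numbering are the same initial segment as in the first; hence they can be
paired with the columns of the first.\<close>

lemma placement_of_minimal:
  assumes lam: "is_partition lam" and p: "placement lam r c" and q: "placement lam r' c'"
    and inj: "\<And>x y. x < psize lam \<Longrightarrow> y < psize lam \<Longrightarrow> x \<noteq> y \<Longrightarrow> c x = c y \<Longrightarrow> r' x \<noteq> r' y"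
  shows "placement lam r' c"
proof -
  let ?n = "psize lam"
  let ?X = "\<lambda>j. {x. x < ?n \<and> c x = j}"
  have i: "inj_on r' (?X j)" for j by (rule inj_onI) (metis (mono_tags, lifting) inj mem_Collect_eq)
  have le: "(\<Sum>x\<in>?X j. real (r x)) \<le> (\<Sum>x\<in>?X j. real (r' x))" for j
  proof -
    have "(\<Sum>x\<in>?X j. real (r x)) = (\<Sum>i<card (?X j). real i)"
      using sum.reindex[OF column_rows(1)[OF lam p], of real j] column_rows(2)[OF lam p, of j] by simp
    also have "\<dots> \<le> (\<Sum>i\<in>r' ` ?X j. real i)"
      using sum_lessThan_card_le[of "r' ` ?X j" real] by (auto simp: card_image[OF i] mono_def)
    also have "\<dots> = (\<Sum>x\<in>?X j. real (r' x))" by (simp add: sum.reindex[OF i])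
    finally show ?thesis .
  qed
  have tot: "(\<Sum>j\<in>c ` {..<?n}. \<Sum>x\<in>?X j. real (r x)) = (\<Sum>j\<in>c ` {..<?n}. \<Sum>x\<in>?X j. real (r' x))"
    using row_weight_placement[OF p, of real] row_weight_placement[OF q, of real]
      sum_by_columns[of "\<lambda>x. real (r x)" ?n c] sum_by_columns[of "\<lambda>x. real (r' x)" ?n c] by simp
  have im: "r' ` ?X j = r ` ?X j" if j: "j \<in> c ` {..<?n}" for j
  proof -
    have "(\<Sum>x\<in>?X j. real (r x)) = (\<Sum>x\<in>?X j. real (r' x))"
    proof (rule ccontr)
      assume "(\<Sum>x\<in>?X j. real (r x)) \<noteq> (\<Sum>x\<in>?X j. real (r' x))"
      hence "(\<Sum>x\<in>?X j. real (r x)) < (\<Sum>x\<in>?X j. real (r' x))" using le[of j] by simp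
      hence "(\<Sum>j\<in>c ` {..<?n}. \<Sum>x\<in>?X j. real (r x)) < (\<Sum>j\<in>c ` {..<?n}. \<Sum>x\<in>?X j. real (r' x))"
        using j le by (intro sum_strict_mono_ex1) auto
      thus False using tot by simp
    qed
    hence "(\<Sum>i\<in>r' ` ?X j. real i) = (\<Sum>i<card (r' ` ?X j). real i)"
      using sum.reindex[OF column_rows(1)[OF lam p], of real j] column_rows(2)[OF lam p, of j]
      by (simp add: sum.reindex[OF i] card_image[OF i])
    hence "r' ` ?X j = {..<card (r' ` ?X j)}" by (intro sum_eq_lessThan_card) auto
    thus ?thesis using column_rows(2)[OF lam p, of j] by (simp add: card_image[OF i])
  qed
  have "(\<lambda>x. (r' x, c x)) ` {..<?n} \<subseteq> diagram lam"
  proof clarify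
    fix x assume x: "x < ?n"
    hence "r' x \<in> r ` ?X (c x)" using im[of "c x"] by blast
    hence "c x < lam (r' x)" unfolding column_rows(3)[OF lam p] by simp
    thus "(r' x, c x) \<in> diagram lam" by (simp add: diagram_def)
  qed
  moreover have i2: "inj_on (\<lambda>x. (r' x, c x)) {..<?n}" using inj by (auto simp: inj_on_def)
  ultimately have "(\<lambda>x. (r' x, c x)) ` {..<?n} = diagram lam"
    by (intro card_subset_eq) (auto simp: finite_diagram[OF lam] card_image card_diagram[OF lam])
  hence "bij_betw (\<lambda>x. (r' x, c x)) {..<?n} (diagram lam)" using i2 unfolding bij_betw_def by blast
  moreover have "\<forall>x\<ge>?n. r' x = 0 \<and> c x = 0" using p q unfolding placement_def by blast
  ultimately show ?thesis unfolding placement_def by blast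
qed

text \<open>A step function with its jump at \<open>k\<close> counts the boxes in the rows from \<open>k\<close> on, and two
consecutive counts differ by the \<open>k\<close>-th part.\<close>

lemma partition_eq_of_row_weight:
  assumes lam: "is_partition lam" and nu: "is_partition \<nu>"
    and eq: "\<And>S. mono S \<Longrightarrow> row_weight lam S = row_weight \<nu> S"
  shows "lam = \<nu>"
proof
  fix k
  have part: "row_weight \<kappa> (\<lambda>i. if k \<le> i then 1 else 0) - row_weight \<kappa> (\<lambda>i. if Suc k \<le> i then 1 else 0) = real (\<kappa> k)"
    if "is_partition \<kappa>" for \<kappa>
  proof -
    have "row_weight \<kappa> (\<lambda>i. if k \<le> i then 1 else 0) - row_weight \<kappa> (\<lambda>i. if Suc k \<le> i then 1 else 0)
        = (\<Sum>p\<in>diagram \<kappa>. if fst p = k then 1 else 0)"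
      unfolding row_weight_def sum_subtractf[symmetric] by (intro sum.cong) auto
    also have "\<dots> = real (card {p \<in> diagram \<kappa>. fst p = k})"
      using finite_diagram[OF that] by (simp add: sum.If_cases Int_def)
    also have "{p \<in> diagram \<kappa>. fst p = k} = Pair k ` {..<\<kappa> k}" by (auto simp: diagram_def)
    finally show ?thesis by (simp add: card_image inj_on_def)
  qed
  have "mono (\<lambda>i::nat. if m \<le> i then 1 else 0 :: real)" for m by (auto simp: mono_def)
  hence "real (lam k) = real (\<nu> k)" using part[OF lam] part[OF nu] eq by metis
  thus "lam k = \<nu> k" by simp
qed

section \<open>Young symmetrizers on a Specht module\<close>

lemma act_ket: "g \<in> Sn n \<Longrightarrow> act wact g (ket r) = ket (r \<circ> inv g)"
proof
  fix w assume g: "g \<in> Sn n"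
  have "w \<circ> g = r \<longleftrightarrow> w = r \<circ> inv g" using g by (metis comp_assoc comp_id inv_comp_Sn)
  thus "act wact g (ket r) w = ket (r \<circ> inv g) w" by (simp add: act_def ket_def)
qed

lemma stab_row_col:
  assumes p: "placement lam r c" and s: "\<sigma> \<in> stab (psize lam) r" "\<sigma> \<in> stab (psize lam) c"
  shows "\<sigma> = id"
proof
  fix x
  have P: "\<sigma> permutes {..<psize lam}" using s by (simp add: stab_Sn Sn_permutes)
  show "\<sigma> x = id x"
  proof (cases "x < psize lam")
    case True
    have "r (\<sigma> x) = r x" "c (\<sigma> x) = c x" using s by (auto simp: stab_def fun_eq_iff)
    moreover have "\<sigma> x < psize lam" using True permutes_in_image[OF P] by auto
    ultimately show ?thesis
      using p True unfolding placement_def bij_betw_def inj_on_def by auto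
  next
    case False
    thus ?thesis using permutes_not_in[OF P] by auto
  qed
qed

lemma polytab_diag:
  assumes p: "placement lam r c"
  shows "polytab (psize lam) r c r = 1"
proof -
  have "polytab (psize lam) r c r = (\<Sum>\<sigma>\<in>stab (psize lam) c. if \<sigma> = id then 1 else 0)"
    unfolding polytab_def group_sum_def ket_def
  proof (intro sum.cong refl)
    fix \<sigma> assume s: "\<sigma> \<in> stab (psize lam) c"
    have "r \<circ> \<sigma> = r \<longleftrightarrow> \<sigma> = id" 
      using stab_row_col[OF p _ s] s by (auto simp: stab_def)
    thus "csgn \<sigma> * (if r \<circ> \<sigma> = r then 1 else 0) = (if \<sigma> = id then 1 else 0)" by simp
  qed
  thus ?thesis by (simp add: sum.delta)
qed

text \<open>Row functions of all numberings of the given shape, that is, its tabloids.\<close>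

definition tabloids :: "(nat \<Rightarrow> nat) \<Rightarrow> (nat \<Rightarrow> nat) set" where
  "tabloids lam = {r. \<exists>c. placement lam r c}"

lemma tabloids_eq:
  assumes p: "placement lam r c"
  shows "tabloids lam = (\<lambda>g. r \<circ> g) ` Sn (psize lam)"
proof (intro equalityI subsetI)
  fix w assume "w \<in> tabloids lam"
  then obtain c' where "placement lam w c'" by (auto simp: tabloids_def)
  thus "w \<in> (\<lambda>g. r \<circ> g) ` Sn (psize lam)" using placement_conj[OF p] by blast
next
  fix w assume "w \<in> (\<lambda>g. r \<circ> g) ` Sn (psize lam)"
  thus "w \<in> tabloids lam" using placement_comp[OF p] unfolding tabloids_def by blast
qed

lemma finite_tabloids [simp]: "finite (tabloids lam)"
proof (cases "\<exists>r c. placement lam r c")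
  case True
  then obtain r c where "placement lam r c" by blast
  thus ?thesis by (simp add: tabloids_eq)
qed (simp add: tabloids_def)

lemma tabloids_comp_iff:
  assumes "g \<in> Sn (psize lam)"
  shows "w \<circ> g \<in> tabloids lam \<longleftrightarrow> w \<in> tabloids lam"
proof
  assume "w \<circ> g \<in> tabloids lam"
  then obtain c where "placement lam (w \<circ> g) c" by (auto simp: tabloids_def)
  from placement_comp[OF this inv_Sn[OF assms]] have "placement lam w (c \<circ> inv g)"
    using assms by (simp add: comp_assoc)
  thus "w \<in> tabloids lam" by (auto simp: tabloids_def)
next
  assume "w \<in> tabloids lam"
  thus "w \<circ> g \<in> tabloids lam" using placement_comp[OF _ assms] by (auto simp: tabloids_def)
qed

text \<open>Either two entries share a row of \<open>w\<close> and a column of \<open>c\<close>, and the signed sum vanishes, or the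
rows of \<open>w\<close> fit onto the columns \<open>c\<close>, and then \<open>w\<close> arises from \<open>r\<close> by a column permutation.\<close>

lemma antisymm_ket:
  assumes lam: "is_partition lam" and p: "placement lam r c" and w: "w \<in> tabloids lam"
  shows "\<exists>k. antisymm (psize lam) wact c (ket w) = (\<lambda>v. k * polytab (psize lam) r c v)"
proof -
  let ?n = "psize lam" and ?\<alpha> = wact
  obtain c' where q: "placement lam w c'" using w by (auto simp: tabloids_def)
  show ?thesis
  proof (cases "\<exists>a b. a < ?n \<and> b < ?n \<and> a \<noteq> b \<and> c a = c b \<and> w a = w b")
    case True
    then obtain a b where ab: "a < ?n" "b < ?n" "a \<noteq> b" "c a = c b" "w a = w b" by blast
    let ?t = "Transposition.transpose a b"
    have tc: "?t \<in> stab ?n c" and tw: "?t \<in> stab ?n w" using ab transpose_stab by auto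
    have "w \<circ> inv ?t = w" using inv_stab[OF tw] by (simp add: stab_def)
    hence "act ?\<alpha> ?t (ket w) = ket w" using act_ket[OF stab_Sn[OF tw], of w] by simp
    hence "antisymm ?n ?\<alpha> c (ket w) = (\<lambda>x. csgn ?t * antisymm ?n ?\<alpha> c (ket w) x)"
      using group_sum_act[OF is_action_wact linear_char_csgn tc, of "ket w"] by simp
    moreover have "csgn ?t = -1" using ab by (simp add: csgn_def sign_swap_id)
    ultimately have "antisymm ?n ?\<alpha> c (ket w) v = - antisymm ?n ?\<alpha> c (ket w) v" for v
      by (metis mult_minus1)
    hence "antisymm ?n ?\<alpha> c (ket w) = (\<lambda>v. 0 * polytab ?n r c v)"
      by (auto simp: fun_eq_iff eq_neg_iff_add_eq_0)
    thus ?thesis by blast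
  next
    case False
    hence "placement lam w c" by (intro placement_of_minimal[OF lam p q]) blast
    then obtain g where g: "g \<in> Sn ?n" "w = r \<circ> g" "c = c \<circ> g"
      using placement_conj[OF p] by blast
    hence gs: "g \<in> stab ?n c" by (simp add: stab_def)
    have "ket w = act ?\<alpha> (inv g) (ket r)" using g act_ket[OF inv_Sn[OF g(1)], of r] by simp
    hence "antisymm ?n ?\<alpha> c (ket w) = (\<lambda>v. csgn (inv g) * polytab ?n r c v)"
      using group_sum_act[OF is_action_wact linear_char_csgn inv_stab[OF gs], of "ket r"]
      by (simp add: polytab_def)
    thus ?thesis by blast
  qed
qed

text \<open>The signed column sum has rank at most one on functions on tabloids; evaluating at \<open>r\<close>, where the
polytabloid is 1, finds the coefficient.\<close>

lemma antisymm_supported: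
  assumes lam: "is_partition lam" and p: "placement lam r c" and f: "\<And>w. w \<notin> tabloids lam \<Longrightarrow> f w = 0"
  shows "antisymm (psize lam) wact c f
     = (\<lambda>v. antisymm (psize lam) wact c f r * polytab (psize lam) r c v)"
proof -
  let ?n = "psize lam" and ?\<alpha> = wact
  obtain k where k: "\<And>w. w \<in> tabloids lam \<Longrightarrow> antisymm ?n ?\<alpha> c (ket w) = (\<lambda>v. k w * polytab ?n r c v)"
    using antisymm_ket[OF lam p] by metis
  have fe: "f = (\<lambda>v. \<Sum>w\<in>tabloids lam. f w * ket w v)"
  proof
    fix v
    have "(\<Sum>w\<in>tabloids lam. f w * ket w v) = (\<Sum>w\<in>tabloids lam. if w = v then f v else 0)"
      by (intro sum.cong) (auto simp: ket_def)
    also have "\<dots> = f v" using f[of v] by (simp add: sum.delta)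
    finally show "f v = (\<Sum>w\<in>tabloids lam. f w * ket w v)" ..
  qed
  have e: "antisymm ?n ?\<alpha> c f v = (\<Sum>w\<in>tabloids lam. f w * k w) * polytab ?n r c v" for v
  proof -
    have "antisymm ?n ?\<alpha> c f = antisymm ?n ?\<alpha> c (\<lambda>v. \<Sum>w\<in>tabloids lam. f w * ket w v)"
      using fe by (rule arg_cong)
    hence "antisymm ?n ?\<alpha> c f v = (\<Sum>w\<in>tabloids lam. f w * antisymm ?n ?\<alpha> c (ket w) v)"
      by (simp only: group_sum_sum group_sum_scale)
    thus ?thesis by (simp add: k sum_distrib_right mult.assoc)
  qed
  have "antisymm ?n ?\<alpha> c f r = (\<Sum>w\<in>tabloids lam. f w * k w)"
    by (simp only: e polytab_diag[OF p] mult_1_right)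
  thus ?thesis by (intro ext) (simp only: e)
qed

lemma specht_supported:
  assumes "f \<in> specht lam" "w \<notin> tabloids lam"
  shows "f w = 0"
proof -
  have "f \<in> cfun.span {f. \<forall>w. w \<notin> tabloids lam \<longrightarrow> f w = 0}"
  proof (rule subsetD[OF cfun.span_mono])
    show "f \<in> cfun.span {polytab (psize lam) r c | r c. placement lam r c}"
      using assms by (simp add: specht_eq)
    show "{polytab (psize lam) r c | r c. placement lam r c} \<subseteq> {f. \<forall>w. w \<notin> tabloids lam \<longrightarrow> f w = 0}"
    proof clarify
      fix r c w assume p: "placement lam r c" and w: "w \<notin> tabloids lam"
      have "w \<circ> \<sigma> \<noteq> r" if "\<sigma> \<in> stab (psize lam) c" for \<sigma>
        using tabloids_comp_iff[OF stab_Sn[OF that]] w p by (auto simp: tabloids_def)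
      thus "polytab (psize lam) r c w = 0" by (simp add: polytab_def group_sum_def ket_def)
    qed
  qed
  also have "cfun.span {f. \<forall>w. w \<notin> tabloids lam \<longrightarrow> f w = 0} = {f. \<forall>w. w \<notin> tabloids lam \<longrightarrow> f w = (0::complex)}"
    by (intro cfun.span_eq_iff[THEN iffD2] cfun.subspaceI) auto
  finally show ?thesis using assms(2) by simp
qed

lemma polytab_comp_stab_row:
  assumes p: "placement lam r c"
  shows "polytab (psize lam) r c (r \<circ> g) = (\<Sum>\<sigma>\<in>stab (psize lam) c. csgn \<sigma> * (if r \<circ> (g \<circ> \<sigma>) = r then 1 else 0))"
  by (simp add: polytab_def group_sum_def ket_def comp_assoc)

text \<open>Positivity: with \<open>e\<close> the polytabloid and \<open>f\<close> its row sum, the value in question is, up to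
positive factors, the sum of the squares of the real numbers \<open>f (r \<circ> g)\<close>, and \<open>f r\<close> is the order of the row group.\<close>

lemma antisymm_symm_polytab_nonzero:
  assumes p: "placement lam r c"
  shows "antisymm (psize lam) wact c (symm (psize lam) wact r (polytab (psize lam) r c)) r \<noteq> 0"
proof -
  let ?n = "psize lam" and ?\<alpha> = wact
  let ?R = "stab ?n r" and ?C = "stab ?n c"
  define e where "e = polytab ?n r c"
  define f where "f = symm ?n ?\<alpha> r e"
  have f_alt: "f w = (\<Sum>\<tau>\<in>?R. e (w \<circ> \<tau>))" for w by (simp add: f_def group_sum_def)
  have f_inv: "f (w \<circ> \<tau>) = f w" if "\<tau> \<in> ?R" for w \<tau>
    using act_group_sum[OF is_action_wact linear_char_1 that, of e] by (simp add: f_def act_def fun_eq_iff)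
  have R0: "card ?R \<noteq> 0" using id_stab[of ?n r] by (metis card_0_eq empty_iff finite_stab)
  have er: "e (r \<circ> \<tau>) = 1" if "\<tau> \<in> ?R" for \<tau>
    using that polytab_diag[OF p] by (simp add: e_def stab_def)
  have fr: "f r = of_nat (card ?R)" by (simp add: f_alt er)
  \<comment> \<open>The sum over \<open>g\<close> is a scalar product of \<open>e\<close> and \<open>f\<close> in which every tabloid is counted once for each
    element of the row group.\<close>
  have 1: "(\<Sum>g\<in>Sn ?n. e (r \<circ> g) * f (r \<circ> g)) = of_nat (card ?R) * antisymm ?n ?\<alpha> c f r"
  proof -
    have "(\<Sum>g\<in>Sn ?n. e (r \<circ> g) * f (r \<circ> g))
        = (\<Sum>g\<in>Sn ?n. \<Sum>\<sigma>\<in>?C. csgn \<sigma> * (if r \<circ> (g \<circ> \<sigma>) = r then f (r \<circ> g) else 0))"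
      unfolding e_def polytab_comp_stab_row[OF p] sum_distrib_right
      by (intro sum.cong) auto
    also have "\<dots> = (\<Sum>\<sigma>\<in>?C. \<Sum>g\<in>Sn ?n. csgn \<sigma> * (if r \<circ> (g \<circ> \<sigma>) = r then f (r \<circ> g) else 0))"
      by (rule sum.swap)
    also have "\<dots> = (\<Sum>\<sigma>\<in>?C. of_nat (card ?R) * (csgn (inv \<sigma>) * f (r \<circ> inv \<sigma>)))"
    proof (intro sum.cong refl)
      fix \<sigma> assume "\<sigma> \<in> ?C"
      hence s: "\<sigma> \<in> Sn ?n" by (rule stab_Sn)
      have "(\<Sum>g\<in>Sn ?n. csgn \<sigma> * (if r \<circ> (g \<circ> \<sigma>) = r then f (r \<circ> g) else 0))
         = (\<Sum>g\<in>Sn ?n. csgn \<sigma> * (if r \<circ> ((g \<circ> inv \<sigma>) \<circ> \<sigma>) = r then f (r \<circ> (g \<circ> inv \<sigma>)) else 0))"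
        by (rule sum_Sn_right[OF inv_Sn[OF s], symmetric])
      also have "\<dots> = (\<Sum>g\<in>Sn ?n. if g \<in> ?R then csgn \<sigma> * f (r \<circ> inv \<sigma>) else 0)"
      proof (intro sum.cong refl)
        fix g assume g: "g \<in> Sn ?n"
        have "r \<circ> ((g \<circ> inv \<sigma>) \<circ> \<sigma>) = r \<circ> g" using s by (simp add: comp_assoc)
        moreover have "r \<circ> g = r \<longleftrightarrow> g \<in> ?R" using g by (simp add: stab_def)
        moreover have "r \<circ> (g \<circ> inv \<sigma>) = (r \<circ> g) \<circ> inv \<sigma>" by (simp add: comp_assoc)
        ultimately show "csgn \<sigma> * (if r \<circ> ((g \<circ> inv \<sigma>) \<circ> \<sigma>) = r then f (r \<circ> (g \<circ> inv \<sigma>)) else 0)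
          = (if g \<in> ?R then csgn \<sigma> * f (r \<circ> inv \<sigma>) else 0)" by auto
      qed
      also have "\<dots> = (\<Sum>g\<in>?R. csgn \<sigma> * f (r \<circ> inv \<sigma>))"
        by (rule sum.mono_neutral_cong_right) (auto simp: stab_Sn)
      finally show "(\<Sum>g\<in>Sn ?n. csgn \<sigma> * (if r \<circ> (g \<circ> \<sigma>) = r then f (r \<circ> g) else 0))
          = of_nat (card ?R) * (csgn (inv \<sigma>) * f (r \<circ> inv \<sigma>))"
        using s by simp
    qed
    also have "\<dots> = of_nat (card ?R) * (\<Sum>\<sigma>\<in>?C. csgn \<sigma> * f (r \<circ> \<sigma>))"
      unfolding sum_distrib_left[symmetric]
      by (rule arg_cong[OF sum_stab_inv])
    finally show ?thesis by (simp add: group_sum_def)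
  qed
  have 2: "of_nat (card ?R) * (\<Sum>g\<in>Sn ?n. e (r \<circ> g) * f (r \<circ> g)) = (\<Sum>g\<in>Sn ?n. f (r \<circ> g) * f (r \<circ> g))"
  proof -
    have "of_nat (card ?R) * (\<Sum>g\<in>Sn ?n. e (r \<circ> g) * f (r \<circ> g))
        = (\<Sum>\<tau>\<in>?R. \<Sum>g\<in>Sn ?n. e (r \<circ> (g \<circ> \<tau>)) * f (r \<circ> (g \<circ> \<tau>)))"
      using sum_Sn_right[OF stab_Sn, of _ ?n r "\<lambda>g. e (r \<circ> g) * f (r \<circ> g)"] by simp
    also have "\<dots> = (\<Sum>\<tau>\<in>?R. \<Sum>g\<in>Sn ?n. e (r \<circ> g \<circ> \<tau>) * f (r \<circ> g))"
      by (intro sum.cong refl) (simp add: f_inv flip: comp_assoc)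
    also have "\<dots> = (\<Sum>g\<in>Sn ?n. \<Sum>\<tau>\<in>?R. e (r \<circ> g \<circ> \<tau>) * f (r \<circ> g))" by (rule sum.swap)
    finally show ?thesis by (simp add: f_alt sum_distrib_right)
  qed
  have "e w \<in> \<real>" for w
    unfolding e_def polytab_def group_sum_def ket_def csgn_def by (intro sum_in_Reals Reals_mult) auto
  hence real: "f w \<in> \<real>" for w by (auto simp: f_alt intro: sum_in_Reals)
  hence sq: "f w * f w = of_real ((Re (f w))\<^sup>2)" for w
    by (metis Reals_cases Re_complex_of_real of_real_power power2_eq_square)
  have "(\<Sum>g\<in>Sn ?n. (Re (f (r \<circ> g)))\<^sup>2) > 0"
  proof (rule sum_pos2[where i = id])
    show "0 < (Re (f (r \<circ> id)))\<^sup>2" using R0 fr by simp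
  qed auto
  hence "(\<Sum>g\<in>Sn ?n. f (r \<circ> g) * f (r \<circ> g)) \<noteq> 0"
    unfolding sq of_real_sum[symmetric] of_real_eq_0_iff by linarith
  hence "antisymm ?n ?\<alpha> c f r \<noteq> 0" using 1 2 by auto
  thus ?thesis by (simp add: f_def e_def)
qed

section \<open>Young symmetrizers of different shapes\<close>

text \<open>If no two entries share a row of one numbering and a column of the other, the shape that contributes the
rows weighs at least as much as the one that contributes the columns: the row numbers are a labelling that is
injective on columns.\<close>

lemma obstruction_le:
  assumes lam: "is_partition lam" and p: "placement lam r c"
    and q: "placement \<nu> r' c'" and n: "psize \<nu> = psize lam" and S: "mono S"
    and no: "\<not> (\<exists>a b. a < psize lam \<and> b < psize lam \<and> a \<noteq> b \<and> r' a = r' b \<and> c a = c b)"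
  shows "row_weight lam S \<le> row_weight \<nu> S"
  using row_weight_le[OF lam p S, of r'] row_weight_placement[OF q, of S] no n by metis

lemma group_sum_act_alt: "group_sum \<alpha> A \<eta> f = (\<lambda>x. \<Sum>\<sigma>\<in>A. \<eta> \<sigma> * act \<alpha> \<sigma> f x)"
  by (simp add: group_sum_def act_def)

lemma act_young:
  assumes "is_action \<alpha>" "g \<in> Sn n"
  shows "act \<alpha> g (young n \<alpha> r c f) = young n \<alpha> (r \<circ> inv g) (c \<circ> inv g) (act \<alpha> g f)"
  using assms by (simp add: young_def act_group_sum_conj)

text \<open>For distinct shapes one of the two obstructions always occurs. Either the inner pair, row sum of the
first against column sum of the second, vanishes; or the outer pair, column sum of the first against row sum
of the second, vanishes after any group element has been inserted between them.\<close>

lemma young_young_zero: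
  assumes \<alpha>: "is_action \<alpha>"
    and lam: "is_partition lam" and nu: "is_partition \<nu>" and n: "psize lam = n" "psize \<nu> = n"
    and ne: "lam \<noteq> \<nu>" and p: "placement lam r c" and q: "placement \<nu> r' c'"
  shows "young n \<alpha> r c (young n \<alpha> r' c' f) = (\<lambda>_. 0)"
proof (cases "\<exists>r1 c1 r2 c2. placement lam r1 c1 \<and> placement \<nu> r2 c2 \<and>
      \<not> (\<exists>a b. a < n \<and> b < n \<and> a \<noteq> b \<and> r1 a = r1 b \<and> c2 a = c2 b)")
  case False
  hence "\<exists>a b. a < n \<and> b < n \<and> a \<noteq> b \<and> r a = r b \<and> c' a = c' b" using p q by blast
  then obtain a b where "a < n" "b < n" "a \<noteq> b" "r a = r b" "c' a = c' b" by blast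
  from symm_antisymm_zero(1)[where r = r and c = c', OF \<alpha> this] show ?thesis by (simp add: young_def)
next
  case True
  hence le: "row_weight \<nu> S \<le> row_weight lam S" if "mono S" for S
    using obstruction_le[OF nu _ _ _ that] n by metis
  \<comment> \<open>The other obstruction must be present for all numberings of \<open>\<nu>\<close>, otherwise the shapes would agree.\<close>
  have ob: "\<exists>a b. a < n \<and> b < n \<and> a \<noteq> b \<and> r2 a = r2 b \<and> c a = c b" if q2: "placement \<nu> r2 c2" for r2 c2
  proof (rule ccontr)
    assume "\<nexists>a b. a < n \<and> b < n \<and> a \<noteq> b \<and> r2 a = r2 b \<and> c a = c b"
    hence "row_weight lam S \<le> row_weight \<nu> S" if "mono S" for S
      using obstruction_le[OF lam p q2 _ that] n by simp
    with le have "lam = \<nu>" by (intro partition_eq_of_row_weight[OF lam nu]) (auto intro: antisym)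
    thus False using ne by simp
  qed
  define k where "k = symm n \<alpha> r' f"
  have z: "antisymm n \<alpha> c (act \<alpha> \<tau> (act \<alpha> \<sigma> k)) = (\<lambda>_. 0)" if "\<tau> \<in> Sn n" "\<sigma> \<in> Sn n" for \<tau> \<sigma>
  proof -
    let ?g = "\<tau> \<circ> \<sigma>"
    have g: "?g \<in> Sn n" using that by simp
    have "act \<alpha> \<tau> (act \<alpha> \<sigma> k) = symm n \<alpha> (r' \<circ> inv ?g) (act \<alpha> ?g f)"
      unfolding k_def act_act[OF \<alpha>] by (rule act_group_sum_conj[OF \<alpha> linear_char_1 g])
    moreover obtain a b where "a < n" "b < n" "a \<noteq> b" "(r' \<circ> inv ?g) a = (r' \<circ> inv ?g) b" "c a = c b"
    proof -
      have "placement \<nu> (r' \<circ> inv ?g) (c' \<circ> inv ?g)"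
        using placement_comp[OF q, of "inv ?g"] inv_Sn[OF g] n by simp
      from ob[OF this] show ?thesis using that by blast
    qed
    ultimately show ?thesis using symm_antisymm_zero(2)[OF \<alpha>] by metis
  qed
  have "symm n \<alpha> r (antisymm n \<alpha> c' k)
      = (\<lambda>x. \<Sum>\<tau>\<in>stab n r. \<Sum>\<sigma>\<in>stab n c'. csgn \<sigma> * act \<alpha> \<tau> (act \<alpha> \<sigma> k) x)"
    by (simp add: group_sum_def act_def)
  hence "antisymm n \<alpha> c (symm n \<alpha> r (antisymm n \<alpha> c' k))
      = (\<lambda>x. \<Sum>\<tau>\<in>stab n r. \<Sum>\<sigma>\<in>stab n c'. csgn \<sigma> * antisymm n \<alpha> c (act \<alpha> \<tau> (act \<alpha> \<sigma> k)) x)"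
    by (simp only: group_sum_sum group_sum_scale)
  thus ?thesis by (simp add: young_def k_def[symmetric] z stab_Sn)
qed

lemma young_scale: "young n \<alpha> r c (\<lambda>x. k * f x) = (\<lambda>x. k * young n \<alpha> r c f x)"
  by (simp add: young_def group_sum_scale)

lemma young_add: "young n \<alpha> r c (\<lambda>x. f x + g x) = (\<lambda>x. young n \<alpha> r c f x + young n \<alpha> r c g x)"
  by (simp add: young_def group_sum_add)

lemma young_zero [simp]: "young n \<alpha> r c (\<lambda>x. 0) = (\<lambda>x. 0)"
  by (simp add: young_def)

lemma young_ket:
  "young n wact r c (ket r) = (\<lambda>x. of_nat (card (stab n r)) * polytab n r c x)"
proof -
  have "symm n wact r (ket r) = (\<lambda>x. of_nat (card (stab n r)) * ket r x)"
  proof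
    fix x
    have "x \<circ> \<sigma> = r \<longleftrightarrow> x = r" if "\<sigma> \<in> stab n r" for \<sigma>
      using that by (auto simp: stab_def) (metis comp_assoc comp_id inv_comp_Sn(2))
    thus "symm n wact r (ket r) x = of_nat (card (stab n r)) * ket r x"
      by (simp add: group_sum_def ket_def)
  qed
  thus ?thesis by (simp add: young_def group_sum_scale polytab_def)
qed

lemma card_stab_nonzero [simp]: "card (stab n r) \<noteq> 0"
  by (metis card_0_eq empty_iff finite_stab id_stab)

text \<open>A polytabloid is a multiple of the image of a point mass under the Young symmetrizer of its own
numbering.\<close>

lemma young_specht_other:
  assumes lam: "is_partition lam" and nu: "is_partition \<nu>" and n: "psize lam = n" "psize \<nu> = n"
    and ne: "lam \<noteq> \<nu>" and p: "placement lam r c" and f: "f \<in> specht \<nu>"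
  shows "young n wact r c f = (\<lambda>_. 0)"
proof -
  let ?Z = "{f. young n wact r c f = (\<lambda>_. 0)}"
  have "cfun.subspace ?Z"
    by (intro cfun.subspaceI) (auto simp: young_scale plus_fun_def young_add zero_fun_def)
  moreover have "{polytab (psize \<nu>) r c | r c. placement \<nu> r c} \<subseteq> ?Z"
  proof clarify
    fix r' c' assume q: "placement \<nu> r' c'"
    let ?k = "of_nat (card (stab n r')) :: complex"
    have "polytab n r' c' = (\<lambda>x. inverse ?k * young n wact r' c' (ket r') x)"
      by (simp add: young_ket)
    hence "young n wact r c (polytab n r' c') = (\<lambda>_. 0)"
      using young_young_zero[OF is_action_wact lam nu n ne p q, of "ket r'"] by (simp add: young_scale)
    thus "young n wact r c (polytab (psize \<nu>) r' c') = (\<lambda>_. 0)" using n by simp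
  qed
  ultimately have "specht \<nu> \<subseteq> ?Z" unfolding specht_eq by (intro cfun.span_minimal)
  thus ?thesis using f by blast
qed

lemma polytab_specht: "placement lam r c \<Longrightarrow> polytab (psize lam) r c \<in> specht lam"
  unfolding specht_eq by (intro cfun.span_base) blast

lemma young_specht_self:
  assumes lam: "is_partition lam" and p: "placement lam r c" and f: "f \<in> specht lam"
  shows "young (psize lam) wact r c f
    = (\<lambda>v. young (psize lam) wact r c f r * polytab (psize lam) r c v)"
  unfolding young_def
proof (rule antisymm_supported[OF lam p])
  fix w assume "w \<notin> tabloids lam"
  hence "w \<circ> \<sigma> \<notin> tabloids lam" if "\<sigma> \<in> stab (psize lam) r" for \<sigma>
    using tabloids_comp_iff[OF stab_Sn[OF that]] by simp
  thus "symm (psize lam) wact r f w = 0"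
    using specht_supported[OF f] by (simp add: group_sum_def)
qed

lemma young_polytab_nonzero:
  "placement lam r c \<Longrightarrow> young (psize lam) wact r c (polytab (psize lam) r c) r \<noteq> 0"
  unfolding young_def by (rule antisymm_symm_polytab_nonzero)

section \<open>Invariant subspaces and homomorphisms out of Specht modules\<close>

lemma csub_add: "cfun.subspace W \<Longrightarrow> f \<in> W \<Longrightarrow> g \<in> W \<Longrightarrow> (\<lambda>x. f x + g x) \<in> W"
  using cfun.subspace_add[of W f g] by (simp add: plus_fun_def)

lemma csub_scale: "cfun.subspace W \<Longrightarrow> f \<in> W \<Longrightarrow> (\<lambda>x. k * f x) \<in> W"
  by (rule cfun.subspace_scale)

lemma csub_0: "cfun.subspace W \<Longrightarrow> (\<lambda>x. 0) \<in> W"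
  using cfun.subspace_0 by (simp add: zero_fun_def)

lemma csub_sum: "cfun.subspace W \<Longrightarrow> (\<And>i. i \<in> I \<Longrightarrow> F i \<in> W) \<Longrightarrow> (\<lambda>x. \<Sum>i\<in>I. F i x) \<in> W"
  by (induction I rule: infinite_finite_induct) (auto simp: csub_0 csub_add)

definition invariant :: "nat \<Rightarrow> ((nat \<Rightarrow> nat) \<Rightarrow> 'x \<Rightarrow> 'x) \<Rightarrow> ('x \<Rightarrow> complex) set \<Rightarrow> bool" where
  "invariant n \<alpha> W \<longleftrightarrow> cfun.subspace W \<and> (\<forall>\<sigma>\<in>Sn n. \<forall>f\<in>W. act \<alpha> \<sigma> f \<in> W)"

lemma invariant_group_sum:
  assumes "invariant n \<alpha> W" "A \<subseteq> Sn n" "f \<in> W"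
  shows "group_sum \<alpha> A \<eta> f \<in> W"
  unfolding group_sum_act_alt using assms by (intro csub_sum csub_scale) (auto simp: invariant_def)

lemma stab_subset_Sn: "stab n w \<subseteq> Sn n" by (auto simp: stab_Sn)

lemma invariant_young: "invariant n \<alpha> W \<Longrightarrow> f \<in> W \<Longrightarrow> young n \<alpha> r c f \<in> W"
  unfolding young_def by (intro invariant_group_sum) (auto simp: stab_Sn)

lemma act_polytab:
  "g \<in> Sn n \<Longrightarrow> act wact g (polytab n r c) = polytab n (r \<circ> inv g) (c \<circ> inv g)"
  by (simp add: polytab_def act_group_sum_conj act_ket)

lemma invariant_specht:
  "invariant (psize lam) wact (specht lam)"
proof -
  let ?\<alpha> = wact
  have "act ?\<alpha> \<sigma> f \<in> specht lam" if s: "\<sigma> \<in> Sn (psize lam)" and "f \<in> specht lam" for \<sigma> f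
  proof -
    let ?Z = "{f. act ?\<alpha> \<sigma> f \<in> specht lam}"
    have "cfun.subspace ?Z"
      by (intro cfun.subspaceI)
        (auto simp: act_def plus_fun_def zero_fun_def specht_def intro!: csub_add csub_scale csub_0)
    moreover have "{polytab (psize lam) r c | r c. placement lam r c} \<subseteq> ?Z"
      using s by (auto simp: act_polytab intro!: polytab_specht placement_comp)
    ultimately have "specht lam \<subseteq> ?Z" by (subst specht_eq) (rule cfun.span_minimal)
    thus ?thesis using that by blast
  qed
  thus ?thesis by (simp add: invariant_def specht_def)
qed

text \<open>The homomorphism from functions on tabloids that sends the point mass at the tabloid \<open>r\<close>
to the row symmetrization of \<open>w\<close>.\<close>

definition orbit_hom :: "nat \<Rightarrow> ((nat \<Rightarrow> nat) \<Rightarrow> 'x \<Rightarrow> 'x) \<Rightarrow> (nat \<Rightarrow> nat) \<Rightarrow> ('x \<Rightarrow> complex) \<Rightarrow>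
    ((nat \<Rightarrow> nat) \<Rightarrow> complex) \<Rightarrow> 'x \<Rightarrow> complex" where
  "orbit_hom n \<alpha> r w f = (\<lambda>x. \<Sum>g\<in>Sn n. f (r \<circ> inv g) * act \<alpha> g w x)"

lemma orbit_hom_add: "orbit_hom n \<alpha> r w (\<lambda>u. f u + g u) = (\<lambda>x. orbit_hom n \<alpha> r w f x + orbit_hom n \<alpha> r w g x)"
  by (simp add: orbit_hom_def distrib_right sum.distrib)

lemma orbit_hom_scale: "orbit_hom n \<alpha> r w (\<lambda>u. k * f u) = (\<lambda>x. k * orbit_hom n \<alpha> r w f x)"
  by (simp add: orbit_hom_def sum_distrib_left mult.assoc)

lemma orbit_hom_zero [simp]: "orbit_hom n \<alpha> r w (\<lambda>u. 0) = (\<lambda>x. 0)"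
  by (simp add: orbit_hom_def)

lemma orbit_hom_in: "invariant n \<alpha> W \<Longrightarrow> w \<in> W \<Longrightarrow> orbit_hom n \<alpha> r w f \<in> W"
  unfolding orbit_hom_def by (intro csub_sum csub_scale) (auto simp: invariant_def)

lemma orbit_hom_act:
  assumes \<alpha>: "is_action \<alpha>" and h: "h \<in> Sn n"
  shows "orbit_hom n \<alpha> r w (\<lambda>u. f (u \<circ> h)) = act \<alpha> h (orbit_hom n \<alpha> r w f)"
proof
  fix x
  have "orbit_hom n \<alpha> r w (\<lambda>u. f (u \<circ> h)) x = (\<Sum>g\<in>Sn n. f (r \<circ> inv (h \<circ> g) \<circ> h) * act \<alpha> (h \<circ> g) w x)"
    unfolding orbit_hom_def by (rule sum_Sn_left[OF h, symmetric])
  also have "\<dots> = (\<Sum>g\<in>Sn n. f (r \<circ> inv g) * act \<alpha> h (act \<alpha> g w) x)"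
    using h by (intro sum.cong refl) (simp add: act_act[OF \<alpha>] inv_mult_Sn comp_assoc)
  finally show "orbit_hom n \<alpha> r w (\<lambda>u. f (u \<circ> h)) x = act \<alpha> h (orbit_hom n \<alpha> r w f) x"
    by (simp add: orbit_hom_def act_def)
qed

text \<open>The polytabloid is the column antisymmetrization of a tabloid, so its image is the column
antisymmetrization of the row symmetrization of \<open>w\<close>. Every vector in the image of the Young symmetrizer thus
receives a homomorphism from the Specht module.\<close>

lemma orbit_hom_polytab:
  assumes \<alpha>: "is_action \<alpha>"
  shows "orbit_hom n \<alpha> r w (polytab n r c) = young n \<alpha> r c w"
proof
  fix x
  have "orbit_hom n \<alpha> r w (polytab n r c) x
     = (\<Sum>g\<in>Sn n. \<Sum>\<sigma>\<in>stab n c. csgn \<sigma> * (if r \<circ> inv g \<circ> \<sigma> = r then act \<alpha> g w x else 0))"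
    by (auto simp: orbit_hom_def polytab_def group_sum_def ket_def sum_distrib_right intro!: sum.cong)
  also have "\<dots> = (\<Sum>\<sigma>\<in>stab n c. \<Sum>g\<in>Sn n. csgn \<sigma> * (if r \<circ> inv g \<circ> \<sigma> = r then act \<alpha> g w x else 0))"
    by (rule sum.swap)
  also have "\<dots> = (\<Sum>\<sigma>\<in>stab n c. csgn \<sigma> * (\<Sum>\<tau>\<in>stab n r. act \<alpha> (\<sigma> \<circ> \<tau>) w x))"
  proof (intro sum.cong refl)
    fix \<sigma> assume "\<sigma> \<in> stab n c"
    hence s: "\<sigma> \<in> Sn n" by (rule stab_Sn)
    have "(\<Sum>g\<in>Sn n. if r \<circ> inv g \<circ> \<sigma> = r then act \<alpha> g w x else 0)
        = (\<Sum>g\<in>Sn n. if r \<circ> inv (\<sigma> \<circ> g) \<circ> \<sigma> = r then act \<alpha> (\<sigma> \<circ> g) w x else 0)"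
      by (rule sum_Sn_left[OF s, symmetric])
    also have "\<dots> = (\<Sum>g\<in>Sn n. if g \<in> stab n r then act \<alpha> (\<sigma> \<circ> g) w x else 0)"
    proof (intro sum.cong if_cong refl)
      fix g assume g: "g \<in> Sn n"
      have "r \<circ> inv (\<sigma> \<circ> g) \<circ> \<sigma> = r \<circ> inv g" using g s by (simp add: inv_mult_Sn comp_assoc)
      moreover have "r \<circ> inv g = r \<longleftrightarrow> g \<in> stab n r"
        using inv_stab[of g n r] inv_stab[of "inv g" n r] g by (auto simp: stab_def)
      ultimately show "(r \<circ> inv (\<sigma> \<circ> g) \<circ> \<sigma> = r) = (g \<in> stab n r)" by simp
    qed
    also have "\<dots> = (\<Sum>\<tau>\<in>stab n r. act \<alpha> (\<sigma> \<circ> \<tau>) w x)"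
      by (rule sum.mono_neutral_cong_right) (auto simp: stab_Sn)
    finally show "(\<Sum>g\<in>Sn n. csgn \<sigma> * (if r \<circ> inv g \<circ> \<sigma> = r then act \<alpha> g w x else 0))
        = csgn \<sigma> * (\<Sum>\<tau>\<in>stab n r. act \<alpha> (\<sigma> \<circ> \<tau>) w x)"
      by (simp flip: sum_distrib_left)
  qed
  also have "\<dots> = young n \<alpha> r c w x"
    using \<alpha> by (simp add: young_def group_sum_def act_def is_action_def)
  finally show "orbit_hom n \<alpha> r w (polytab n r c) x = young n \<alpha> r c w x" .
qed

section \<open>Cycle types\<close>

definition Parts :: "nat \<Rightarrow> (nat \<Rightarrow> nat) set" where
  "Parts n = {\<nu>. is_partition \<nu> \<and> psize \<nu> = n}"

text \<open>A partition of \<open>n\<close> has parts at most \<open>n\<close>, and all parts from the \<open>n\<close>-th on vanish.\<close>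

lemma finite_Parts [simp]: "finite (Parts n)"
proof (rule finite_subset)
  have b: "\<nu> i \<le> n \<and> (i \<ge> n \<longrightarrow> \<nu> i = 0)" if "\<nu> \<in> Parts n" for \<nu> i
  proof -
    have P: "is_partition \<nu>" "psize \<nu> = n" using that by (auto simp: Parts_def)
    hence fin: "finite {i. \<nu> i \<noteq> 0}" and am: "antimono \<nu>" by (auto simp: is_partition_def)
    have le: "sum \<nu> I \<le> n" if "finite I" for I
    proof -
      have "sum \<nu> I = sum \<nu> (I \<inter> {i. \<nu> i \<noteq> 0})" using that by (intro sum.mono_neutral_right) auto
      also have "\<dots> \<le> sum \<nu> {i. \<nu> i \<noteq> 0}" using fin by (intro sum_mono2) auto
      finally show ?thesis using P by (simp add: psize_def)
    qed
    have "\<nu> i \<le> n" using le[of "{i}"] by simp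
    moreover have "\<nu> i = 0" if "i \<ge> n"
    proof (rule ccontr)
      assume "\<nu> i \<noteq> 0"
      hence "1 \<le> \<nu> j" if "j \<le> i" for j using am that by (metis antimonoD le_zero_eq less_one not_le)
      hence "(\<Sum>j\<le>i. 1) \<le> sum \<nu> {..i}" by (intro sum_mono) auto
      thus False using le[of "{..i}"] \<open>i \<ge> n\<close> by simp
    qed
    ultimately show ?thesis by blast
  qed
  show "Parts n \<subseteq> {\<nu>. \<forall>i. (i \<in> {..<n} \<longrightarrow> \<nu> i \<in> {..n}) \<and> (i \<notin> {..<n} \<longrightarrow> \<nu> i = 0)}"
    using b by auto
  show "finite {\<nu>. \<forall>i. (i \<in> {..<n} \<longrightarrow> \<nu> i \<in> {..n}) \<and> (i \<notin> {..<n} \<longrightarrow> \<nu> i = 0)}"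
    by (intro finite_set_of_finite_funs) auto
qed

text \<open>One numbering is fixed for each shape.\<close>

definition std_row :: "(nat \<Rightarrow> nat) \<Rightarrow> nat \<Rightarrow> nat" where
  "std_row \<nu> = fst (SOME p. placement \<nu> (fst p) (snd p))"
definition std_col :: "(nat \<Rightarrow> nat) \<Rightarrow> nat \<Rightarrow> nat" where
  "std_col \<nu> = snd (SOME p. placement \<nu> (fst p) (snd p))"

lemma placement_pick:
  assumes "is_partition \<nu>"
  shows "placement \<nu> (std_row \<nu>) (std_col \<nu>)"
proof -
  obtain r c where "placement \<nu> r c" using placement_exists[OF assms] by blast
  hence "\<exists>p. placement \<nu> (fst p) (snd p)" by (intro exI[of _ "(r, c)"]) simp
  from someI_ex[OF this] show ?thesis by (simp add: std_row_def std_col_def)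
qed

abbreviation "young_std n \<alpha> \<nu> \<equiv> young n \<alpha> (std_row \<nu>) (std_col \<nu>)"

text \<open>The rows of the numbering are the cycles of \<open>g\<close>.\<close>

definition cycle_type :: "nat \<Rightarrow> (nat \<Rightarrow> nat) \<Rightarrow> (nat \<Rightarrow> nat) \<Rightarrow> bool" where
  "cycle_type n \<nu> g \<longleftrightarrow> (\<exists>r c. placement \<nu> r c \<and>
     (\<forall>x<n. r (g x) = r x \<and> c (g x) = (c x + 1) mod \<nu> (r x)))"

lemma funpow_Sn: "g \<in> Sn n \<Longrightarrow> x < n \<Longrightarrow> (g ^^ i) x < n"
  using permutes_in_image[OF permutes_funpow[of g "{..<n}" i], of x] by (simp add: Sn_def)

text \<open>Sort the orbits by decreasing size and number each of them by iterating \<open>g\<close>.\<close>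

lemma cycle_type_exists:
  assumes g: "g \<in> Sn n"
  shows "\<exists>\<nu>\<in>Parts n. cycle_type n \<nu> g"
proof -
  have P: "permutation g" using permutation_Sn[OF g] .
  define Or where "Or = (\<lambda>x. set (support g x)) ` {..<n}"
  have self: "x \<in> set (support g x)" for x
    using least_power_of_permutation(2)[OF P, of x] by force
  have finO: "finite Or" by (simp add: Or_def)
  obtain xs where xs: "set xs = Or" "distinct xs" using finite_distinct_list[OF finO] by blast
  define os where "os = rev (sort_key card xs)"
  have os: "set os = Or" "distinct os" using xs by (auto simp: os_def)
  have srt: "sorted (rev (map card os))" by (simp add: os_def rev_map)
  define L where "L = length os"
  define \<nu> where "\<nu> = (\<lambda>i. if i < L then card (os ! i) else 0)"
  define rep where "rep = (\<lambda>i. SOME x. x < n \<and> os ! i = set (support g x))"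
  have rep: "rep i < n" "os ! i = set (support g (rep i))" if "i < L" for i
  proof -
    have "os ! i \<in> Or" using that os nth_mem by (auto simp: L_def)
    hence "\<exists>x. x < n \<and> os ! i = set (support g x)" by (auto simp: Or_def)
    from someI_ex[OF this] show "rep i < n" "os ! i = set (support g (rep i))" 
      by (simp_all only: rep_def)
  qed
  have dist: "distinct (support g x)" for x using cycle_of_permutation[OF P] .
  have nu: "\<nu> i = least_power g (rep i)" if "i < L" for i
    using distinct_card[OF dist, of "rep i"] rep[OF that] that by (simp add: \<nu>_def)
  have anti: "\<nu> j \<le> \<nu> i" if "i \<le> j" for i j
  proof (cases "j < L")
    case True
    hence "map card os ! j \<le> map card os ! i"
      using sorted_rev_nth_mono[OF srt that] by (simp add: L_def)
    thus ?thesis using True that by (simp add: \<nu>_def L_def)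
  qed (simp add: \<nu>_def)
  have part: "is_partition \<nu>" unfolding is_partition_def
  proof
    show "antimono \<nu>" using anti by (auto simp: antimono_def)
    show "finite {i. \<nu> i \<noteq> 0}" by (rule finite_subset[of _ "{..<L}"]) (auto simp: \<nu>_def)
  qed
  define t where "t = (\<lambda>(i, j). (g ^^ j) (rep i))"
  have diag: "(i, j) \<in> diagram \<nu> \<longleftrightarrow> i < L \<and> j < least_power g (rep i)" for i j
    using nu[of i] by (cases "i < L") (auto simp: diagram_def \<nu>_def)
  have tin: "t (i, j) \<in> os ! i" if "(i, j) \<in> diagram \<nu>" for i j
    using that rep(2)[of i] diag by (auto simp: t_def)
  have disj: "A = B" if "A \<in> Or" "B \<in> Or" "A \<inter> B \<noteq> {}" for A B
    using disjoint_support[OF P] that unfolding Or_def disjoint_def by blast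
  have bij: "bij_betw t (diagram \<nu>) {..<n}"
    unfolding bij_betw_def
  proof
    show "inj_on t (diagram \<nu>)"
    proof (rule inj_onI, clarify)
      fix i j i' j' assume a: "(i, j) \<in> diagram \<nu>" "(i', j') \<in> diagram \<nu>" and e: "t (i, j) = t (i', j')"
      have iL: "i < L" "i' < L" using a diag by auto
      have "os ! i = os ! i'"
        using tin[OF a(1)] tin[OF a(2)] e iL os by (intro disj) (auto simp: L_def)
      hence ii: "i = i'" using os iL by (simp add: nth_eq_iff_index_eq L_def)
      have "support g (rep i) ! j = support g (rep i) ! j'" 
        using e ii a diag by (auto simp: t_def)
      hence "j = j'" using nth_eq_iff_index_eq[OF dist, of j "rep i" j'] a ii diag by auto
      thus "i = i' \<and> j = j'" using ii by simp
    qed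
    show "t ` diagram \<nu> = {..<n}"
    proof
      show "t ` diagram \<nu> \<subseteq> {..<n}"
        using diag rep(1) funpow_Sn[OF g] by (auto simp: t_def)
      show "{..<n} \<subseteq> t ` diagram \<nu>"
      proof
        fix x assume x: "x \<in> {..<n}"
        hence "set (support g x) \<in> set os" using os by (auto simp: Or_def)
        then obtain i where i: "i < L" "os ! i = set (support g x)" by (auto simp: in_set_conv_nth L_def)
        have "x \<in> set (support g (rep i))" using self[of x] i rep(2)[of i] by simp
        then obtain j where "j < least_power g (rep i)" "x = (g ^^ j) (rep i)" by auto
        hence "(i, j) \<in> diagram \<nu>" "x = t (i, j)" using i diag by (auto simp: t_def)
        thus "x \<in> t ` diagram \<nu>" by blast
      qed
    qed
  qed
  have "psize \<nu> = n" using bij_betw_same_card[OF bij] card_diagram[OF part] by simp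
  hence num: "is_numbering \<nu> t" and pn: "\<nu> \<in> Parts n"
    using bij part by (auto simp: is_numbering_def Parts_def)
  let ?r = "tabloid \<nu> t" and ?c = "colmap \<nu> t"
  have val: "?r (t (i, j)) = i \<and> ?c (t (i, j)) = j" if "(i, j) \<in> diagram \<nu>" for i j
  proof -
    have "t (i, j) < n" using bij that by (auto simp: bij_betw_def)
    moreover have "inv_into (diagram \<nu>) t (t (i, j)) = (i, j)"
      using bij that by (simp add: bij_betw_def)
    ultimately show ?thesis using \<open>psize \<nu> = n\<close> by (simp add: tabloid_def colmap_def)
  qed
  have "?r (g x) = ?r x \<and> ?c (g x) = (?c x + 1) mod \<nu> (?r x)" if "x < n" for x
  proof -
    have "x \<in> t ` diagram \<nu>" using bij that by (auto simp: bij_betw_def)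
    then obtain i j where ij: "(i, j) \<in> diagram \<nu>" "x = t (i, j)" by auto
    let ?l = "least_power g (rep i)"
    have l: "i < L" "j < ?l" using ij diag by auto
    have "g x = (g ^^ Suc j) (rep i)" using ij by (simp add: t_def)
    also have "\<dots> = t (i, Suc j mod ?l)"
    proof (cases "Suc j < ?l")
      case False
      hence "Suc j = ?l" using l by simp
      thus ?thesis using least_power_of_permutation(1)[OF P, of "rep i"] by (simp add: t_def)
    qed (simp add: t_def)
    finally have gx: "g x = t (i, Suc j mod ?l)" .
    have "(i, Suc j mod ?l) \<in> diagram \<nu>" using l diag by simp
    thus ?thesis using val gx ij nu[OF l(1)] by simp
  qed
  hence "cycle_type n \<nu> g" unfolding cycle_type_def using placement_numbering[OF num] by blast
  thus ?thesis using pn by blast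
qed

definition conj_class :: "nat \<Rightarrow> (nat \<Rightarrow> nat) \<Rightarrow> (nat \<Rightarrow> nat) set" where
  "conj_class n g = {k \<circ> g \<circ> inv k | k. k \<in> Sn n}"

lemma conj_class_eqI:
  assumes g: "g \<in> Sn n" and k: "k \<in> Sn n" and g': "g' = inv k \<circ> g \<circ> k"
  shows "conj_class n g' = conj_class n g"
proof
  show "conj_class n g' \<subseteq> conj_class n g"
  proof
    fix h assume "h \<in> conj_class n g'"
    then obtain l where l: "l \<in> Sn n" "h = l \<circ> g' \<circ> inv l" unfolding conj_class_def by blast
    hence "h = (l \<circ> inv k) \<circ> g \<circ> inv (l \<circ> inv k)" using k g' by (simp add: inv_mult_Sn comp_assoc)
    moreover have "l \<circ> inv k \<in> Sn n" using l k by simp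
    ultimately show "h \<in> conj_class n g" unfolding conj_class_def by blast
  qed
  show "conj_class n g \<subseteq> conj_class n g'"
  proof
    fix h assume "h \<in> conj_class n g"
    then obtain l where l: "l \<in> Sn n" "h = l \<circ> g \<circ> inv l" unfolding conj_class_def by blast
    have "(l \<circ> k) \<circ> g' \<circ> inv (l \<circ> k) = l \<circ> g \<circ> inv l"
    proof -
      have "g' \<circ> inv k = inv k \<circ> g" unfolding g' using k by (simp add: comp_assoc)
      hence "k \<circ> (g' \<circ> inv k) = g" using k by simp
      hence "l \<circ> (k \<circ> (g' \<circ> inv k)) \<circ> inv l = l \<circ> g \<circ> inv l" by (simp only:)
      thus ?thesis unfolding inv_mult_Sn[OF l(1) k] by (simp only: comp_assoc)
    qed
    hence "h = (l \<circ> k) \<circ> g' \<circ> inv (l \<circ> k)" using l by simp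
    moreover have "l \<circ> k \<in> Sn n" using l k by simp
    ultimately show "h \<in> conj_class n g'" unfolding conj_class_def by blast
  qed
qed

text \<open>A permutation that matches the two numberings conjugates one cycle structure into the other.\<close>

lemma cycle_type_conj:
  assumes g: "g \<in> Sn n" and g': "g' \<in> Sn n" and nu: "\<nu> \<in> Parts n"
    and "cycle_type n \<nu> g" "cycle_type n \<nu> g'"
  shows "conj_class n g' = conj_class n g"
proof -
  obtain r c where p: "placement \<nu> r c" and
    rc: "\<And>x. x < n \<Longrightarrow> r (g x) = r x \<and> c (g x) = (c x + 1) mod \<nu> (r x)"
    using assms(4) unfolding cycle_type_def by blast
  obtain r' c' where p': "placement \<nu> r' c'" and
    rc': "\<And>x. x < n \<Longrightarrow> r' (g' x) = r' x \<and> c' (g' x) = (c' x + 1) mod \<nu> (r' x)"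
    using assms(5) unfolding cycle_type_def by blast
  have n: "psize \<nu> = n" using nu by (simp add: Parts_def)
  obtain k where k: "k \<in> Sn n" "r' = r \<circ> k" "c' = c \<circ> k"
    using placement_conj[OF p p'] n by auto
  have lt: "h x < n \<longleftrightarrow> x < n" if "h \<in> Sn n" for h x
    using permutes_in_image[OF Sn_permutes[OF that], of x] by simp
  have inj: "inj_on (\<lambda>x. (r x, c x)) {..<n}" using p n by (simp add: placement_def bij_betw_def)
  have "k (g' x) = g (k x)" for x
  proof (cases "x < n")
    case True
    have "r (k (g' x)) = r (g (k x)) \<and> c (k (g' x)) = c (g (k x))"
      using rc'[OF True] rc[of "k x"] True lt[OF k(1)] by (simp add: k)
    thus ?thesis using inj True lt[OF k(1)] lt[OF g] lt[OF g'] by (auto simp: inj_on_def)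
  next
    case False
    have "h x = x" if "h \<in> Sn n" for h using permutes_not_in[OF Sn_permutes[OF that], of x] False by simp
    from this[OF k(1)] this[OF g] this[OF g'] show ?thesis by simp
  qed
  hence "k \<circ> g' = g \<circ> k" by auto
  hence "inv k \<circ> (k \<circ> g') = inv k \<circ> (g \<circ> k)" by simp
  hence "g' = inv k \<circ> g \<circ> k" using k by (simp add: comp_assoc)
  thus ?thesis by (rule conj_class_eqI[OF g k(1)])
qed

definition classes :: "nat \<Rightarrow> (nat \<Rightarrow> nat) set set" where
  "classes n = conj_class n ` Sn n"

lemma card_classes: "finite (classes n)" "card (classes n) \<le> card (Parts n)"
proof -
  show "finite (classes n)" by (simp add: classes_def)
  define pk where "pk = (\<lambda>\<nu>. SOME g. g \<in> Sn n \<and> cycle_type n \<nu> g)"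
  have "classes n \<subseteq> (\<lambda>\<nu>. conj_class n (pk \<nu>)) ` Parts n"
  proof
    fix C assume "C \<in> classes n"
    then obtain g where g: "g \<in> Sn n" "C = conj_class n g" by (auto simp: classes_def)
    then obtain \<nu> where nu: "\<nu> \<in> Parts n" "cycle_type n \<nu> g" using cycle_type_exists by blast
    have "pk \<nu> \<in> Sn n \<and> cycle_type n \<nu> (pk \<nu>)" unfolding pk_def
      by (rule someI[of "\<lambda>g. g \<in> Sn n \<and> cycle_type n \<nu> g" g]) (use g nu in blast)
    hence "conj_class n g = conj_class n (pk \<nu>)" using cycle_type_conj nu g by blast
    thus "C \<in> (\<lambda>\<nu>. conj_class n (pk \<nu>)) ` Parts n" using nu g by blast
  qed
  thus "card (classes n) \<le> card (Parts n)" by (rule surj_card_le[rotated]) simp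
qed

section \<open>Completeness of the Young symmetrizers\<close>

text \<open>Indexes the terms \<open>h \<sigma> \<tau> h\<^sup>-\<^sup>1\<close> of the sum of all conjugates of the Young symmetrizer.\<close>

definition conj_triples :: "nat \<Rightarrow> (nat \<Rightarrow> nat) \<Rightarrow> ((nat \<Rightarrow> nat) \<times> (nat \<Rightarrow> nat) \<times> (nat \<Rightarrow> nat)) set" where
  "conj_triples n \<nu> = Sn n \<times> stab n (std_col \<nu>) \<times> stab n (std_row \<nu>)"

text \<open>The coefficient of \<open>g\<close> in the sum of all conjugates of the Young symmetrizer of shape \<open>\<nu>\<close>.\<close>

definition central_coeff :: "nat \<Rightarrow> (nat \<Rightarrow> nat) \<Rightarrow> (nat \<Rightarrow> nat) \<Rightarrow> complex" where
  "central_coeff n \<nu> g = (\<Sum>(h, \<sigma>, \<tau>)\<in>conj_triples n \<nu>. csgn \<sigma> * (if h \<circ> \<sigma> \<circ> \<tau> \<circ> inv h = g then 1 else 0))"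

lemma finite_conj_triples [simp]: "finite (conj_triples n \<nu>)" by (simp add: conj_triples_def)

lemma conj_triplesD:
  assumes "(h, \<sigma>, \<tau>) \<in> conj_triples n \<nu>"
  shows "h \<in> Sn n" "\<sigma> \<in> Sn n" "\<tau> \<in> Sn n" "\<sigma> \<in> stab n (std_col \<nu>)" "\<tau> \<in> stab n (std_row \<nu>)"
    "h \<circ> \<sigma> \<circ> \<tau> \<circ> inv h \<in> Sn n"
  using assms by (auto simp: conj_triples_def stab_Sn)

lemma central_coeff_eq_0: "g \<notin> Sn n \<Longrightarrow> central_coeff n \<nu> g = 0"
  unfolding central_coeff_def by (rule sum.neutral) (auto dest: conj_triplesD(6))

lemma sum_central_coeff:
  "(\<Sum>g\<in>Sn n. central_coeff n \<nu> g * F g) = (\<Sum>(h, \<sigma>, \<tau>)\<in>conj_triples n \<nu>. csgn \<sigma> * F (h \<circ> \<sigma> \<circ> \<tau> \<circ> inv h))"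
proof -
  have "(\<Sum>g\<in>Sn n. central_coeff n \<nu> g * F g)
    = (\<Sum>g\<in>Sn n. \<Sum>(h, \<sigma>, \<tau>)\<in>conj_triples n \<nu>. if h \<circ> \<sigma> \<circ> \<tau> \<circ> inv h = g then csgn \<sigma> * F g else 0)"
    unfolding central_coeff_def sum_distrib_right by (intro sum.cong) auto
  also have "\<dots> = (\<Sum>p\<in>conj_triples n \<nu>. \<Sum>g\<in>Sn n. case p of (h, \<sigma>, \<tau>) \<Rightarrow>
      if h \<circ> \<sigma> \<circ> \<tau> \<circ> inv h = g then csgn \<sigma> * F g else 0)"
    by (rule sum.swap)
  also have "\<dots> = (\<Sum>(h, \<sigma>, \<tau>)\<in>conj_triples n \<nu>. csgn \<sigma> * F (h \<circ> \<sigma> \<circ> \<tau> \<circ> inv h))"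
  proof (intro sum.cong refl)
    fix p assume "p \<in> conj_triples n \<nu>"
    moreover obtain h \<sigma> \<tau> where p: "p = (h, \<sigma>, \<tau>)" by (cases p)
    ultimately have "h \<circ> \<sigma> \<circ> \<tau> \<circ> inv h \<in> Sn n" using conj_triplesD(6) by blast
    thus "(\<Sum>g\<in>Sn n. case p of (h, \<sigma>, \<tau>) \<Rightarrow> if h \<circ> \<sigma> \<circ> \<tau> \<circ> inv h = g then csgn \<sigma> * F g else 0)
       = (case p of (h, \<sigma>, \<tau>) \<Rightarrow> csgn \<sigma> * F (h \<circ> \<sigma> \<circ> \<tau> \<circ> inv h))"
      by (simp add: p sum.delta)
  qed
  finally show ?thesis .
qed

text \<open>The class function acts as the sum of the conjugates of the Young symmetrizer.\<close>

lemma central_coeff_operator: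
  assumes \<alpha>: "is_action \<alpha>"
  shows "(\<Sum>g\<in>Sn n. central_coeff n \<nu> g * act \<alpha> g f x)
       = (\<Sum>h\<in>Sn n. act \<alpha> h (young_std n \<alpha> \<nu> (act \<alpha> (inv h) f)) x)"
proof -
  have "(\<Sum>h\<in>Sn n. act \<alpha> h (young_std n \<alpha> \<nu> (act \<alpha> (inv h) f)) x)
      = (\<Sum>h\<in>Sn n. \<Sum>\<sigma>\<in>stab n (std_col \<nu>). \<Sum>\<tau>\<in>stab n (std_row \<nu>). csgn \<sigma> * act \<alpha> (h \<circ> \<sigma> \<circ> \<tau> \<circ> inv h) f x)"
    using \<alpha> by (simp add: young_def group_sum_def act_def is_action_def sum_distrib_left)
  thus ?thesis by (simp add: sum_central_coeff conj_triples_def sum.cartesian_product)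
qed

lemma central_coeff_conj:
  assumes k: "k \<in> Sn n"
  shows "central_coeff n \<nu> (k \<circ> g \<circ> inv k) = central_coeff n \<nu> g"
  unfolding central_coeff_def
proof (rule sum.reindex_bij_witness[where i = "\<lambda>(h, \<sigma>, \<tau>). (k \<circ> h, \<sigma>, \<tau>)" and j = "\<lambda>(h, \<sigma>, \<tau>). (inv k \<circ> h, \<sigma>, \<tau>)"])
  fix p assume "p \<in> conj_triples n \<nu>"
  moreover obtain h \<sigma> \<tau> where p: "p = (h, \<sigma>, \<tau>)" by (cases p)
  ultimately have h: "h \<in> Sn n" using conj_triplesD(1) by blast
  have "h \<circ> \<sigma> \<circ> \<tau> \<circ> inv h = k \<circ> g \<circ> inv k \<longleftrightarrow> (inv k \<circ> h) \<circ> \<sigma> \<circ> \<tau> \<circ> inv (inv k \<circ> h) = g"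
  proof
    assume a: "h \<circ> \<sigma> \<circ> \<tau> \<circ> inv h = k \<circ> g \<circ> inv k"
    have "(inv k \<circ> h) \<circ> \<sigma> \<circ> \<tau> \<circ> inv (inv k \<circ> h) = inv k \<circ> (h \<circ> \<sigma> \<circ> \<tau> \<circ> inv h) \<circ> k"
      using k h by (simp add: inv_mult_Sn[OF inv_Sn[OF k] h] comp_assoc)
    also have "\<dots> = g" unfolding a using k by (simp add: comp_assoc)
    finally show "(inv k \<circ> h) \<circ> \<sigma> \<circ> \<tau> \<circ> inv (inv k \<circ> h) = g" .
  next
    assume a: "(inv k \<circ> h) \<circ> \<sigma> \<circ> \<tau> \<circ> inv (inv k \<circ> h) = g"
    show "h \<circ> \<sigma> \<circ> \<tau> \<circ> inv h = k \<circ> g \<circ> inv k"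
      unfolding a[symmetric] using k h by (simp add: inv_mult_Sn[OF inv_Sn[OF k] h] comp_assoc)
  qed
  thus "(case (case p of (h, \<sigma>, \<tau>) \<Rightarrow> (inv k \<circ> h, \<sigma>, \<tau>)) of (h, \<sigma>, \<tau>) \<Rightarrow>
          csgn \<sigma> * (if h \<circ> \<sigma> \<circ> \<tau> \<circ> inv h = g then 1 else 0)) =
        (case p of (h, \<sigma>, \<tau>) \<Rightarrow> csgn \<sigma> * (if h \<circ> \<sigma> \<circ> \<tau> \<circ> inv h = k \<circ> g \<circ> inv k then 1 else 0))"
    by (simp only: p prod.case)
qed (use k in \<open>auto simp: conj_triples_def\<close>)

text \<open>Inverting \<open>h \<sigma> \<tau> h\<^sup>-\<^sup>1\<close> reverses the order of the row and the column permutation; conjugating by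
\<open>h \<sigma>\<close> instead of \<open>h\<close> restores it.\<close>

lemma central_coeff_inv:
  assumes g: "g \<in> Sn n"
  shows "central_coeff n \<nu> (inv g) = central_coeff n \<nu> g"
  unfolding central_coeff_def
proof (rule sum.reindex_bij_witness[where i = "\<lambda>(h, \<sigma>, \<tau>). (h \<circ> \<sigma>, inv \<sigma>, inv \<tau>)"
      and j = "\<lambda>(h, \<sigma>, \<tau>). (h \<circ> \<sigma>, inv \<sigma>, inv \<tau>)"])
  fix p assume p0: "p \<in> conj_triples n \<nu>"
  obtain h \<sigma> \<tau> where p: "p = (h, \<sigma>, \<tau>)" by (cases p)
  note hst = conj_triplesD[OF p0[unfolded p]]
  have e: "(h \<circ> \<sigma>) \<circ> inv \<sigma> \<circ> inv \<tau> \<circ> inv (h \<circ> \<sigma>) = inv (h \<circ> \<sigma> \<circ> \<tau> \<circ> inv h)"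
  proof -
    have "inv (h \<circ> \<sigma> \<circ> \<tau> \<circ> inv h) = inv (inv h) \<circ> (inv \<tau> \<circ> (inv \<sigma> \<circ> inv h))"
      using hst(1-3) by (metis comp_Sn inv_Sn inv_mult_Sn)
    thus ?thesis using hst(1-3) by (simp add: inv_mult_Sn[OF hst(1,2)] comp_assoc)
  qed
  have "h \<circ> \<sigma> \<circ> \<tau> \<circ> inv h = inv g \<longleftrightarrow> inv (h \<circ> \<sigma> \<circ> \<tau> \<circ> inv h) = g"
    using inv_inv_Sn[OF hst(6)] inv_inv_Sn[OF g] by metis
  hence "h \<circ> \<sigma> \<circ> \<tau> \<circ> inv h = inv g \<longleftrightarrow> (h \<circ> \<sigma>) \<circ> inv \<sigma> \<circ> inv \<tau> \<circ> inv (h \<circ> \<sigma>) = g"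
    by (simp only: e)
  thus "(case (case p of (h, \<sigma>, \<tau>) \<Rightarrow> (h \<circ> \<sigma>, inv \<sigma>, inv \<tau>)) of (h, \<sigma>, \<tau>) \<Rightarrow>
          csgn \<sigma> * (if h \<circ> \<sigma> \<circ> \<tau> \<circ> inv h = g then 1 else 0)) =
        (case p of (h, \<sigma>, \<tau>) \<Rightarrow> csgn \<sigma> * (if h \<circ> \<sigma> \<circ> \<tau> \<circ> inv h = inv g then 1 else 0))"
    by (simp only: p prod.case csgn_inv[OF hst(2)])
  show "(case (case p of (h, \<sigma>, \<tau>) \<Rightarrow> (h \<circ> \<sigma>, inv \<sigma>, inv \<tau>)) of (h, \<sigma>, \<tau>) \<Rightarrow> (h \<circ> \<sigma>, inv \<sigma>, inv \<tau>)) = p"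
    using hst by (simp add: p comp_assoc)
  show "(case p of (h, \<sigma>, \<tau>) \<Rightarrow> (h \<circ> \<sigma>, inv \<sigma>, inv \<tau>)) \<in> conj_triples n \<nu>"
    using hst by (simp add: p conj_triples_def inv_stab)
next
  fix p assume p0: "p \<in> conj_triples n \<nu>"
  obtain h \<sigma> \<tau> where p: "p = (h, \<sigma>, \<tau>)" by (cases p)
  note hst = conj_triplesD[OF p0[unfolded p]]
  show "(case (case p of (h, \<sigma>, \<tau>) \<Rightarrow> (h \<circ> \<sigma>, inv \<sigma>, inv \<tau>)) of (h, \<sigma>, \<tau>) \<Rightarrow> (h \<circ> \<sigma>, inv \<sigma>, inv \<tau>)) = p"
    using hst by (simp add: p comp_assoc)
  show "(case p of (h, \<sigma>, \<tau>) \<Rightarrow> (h \<circ> \<sigma>, inv \<sigma>, inv \<tau>)) \<in> conj_triples n \<nu>"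
    using hst by (simp add: p conj_triples_def inv_stab)
qed

lemma young_act_young_zero:
  assumes \<alpha>: "is_action \<alpha>" and nu: "\<nu> \<in> Parts n" "\<mu> \<in> Parts n" "\<nu> \<noteq> \<mu>" and k: "k \<in> Sn n"
  shows "young_std n \<alpha> \<nu> (act \<alpha> k (young_std n \<alpha> \<mu> f)) = (\<lambda>_. 0)"
proof -
  have P: "is_partition \<nu>" "psize \<nu> = n" "is_partition \<mu>" "psize \<mu> = n" using nu by (auto simp: Parts_def)
  have "placement \<mu> (std_row \<mu> \<circ> inv k) (std_col \<mu> \<circ> inv k)"
    using placement_comp[OF placement_pick[OF P(3)], of "inv k"] k P by simp
  thus ?thesis unfolding act_young[OF \<alpha> k]
    by (rule young_young_zero[OF \<alpha> P(1,3,2,4) nu(3) placement_pick[OF P(1)]])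
qed

lemma young_sum: "young n \<alpha> r c (\<lambda>x. \<Sum>i\<in>I. F i x) = (\<lambda>x. \<Sum>i\<in>I. young n \<alpha> r c (F i) x)"
  by (simp add: young_def group_sum_sum)

lemma act_sum: "act \<alpha> g (\<lambda>x. \<Sum>i\<in>I. F i x) = (\<lambda>x. \<Sum>i\<in>I. act \<alpha> g (F i) x)"
  by (simp add: act_def)

text \<open>Because the coefficients are invariant under inversion, the inner product is the coefficient of the
identity in the product of the two central elements. That product is zero, being a sum of products of Young
symmetrizers of different shapes with group elements in between.\<close>

lemma central_coeff_orthogonal:
  assumes nu: "\<nu> \<in> Parts n" "\<mu> \<in> Parts n" "\<nu> \<noteq> \<mu>"
  shows "(\<Sum>g\<in>Sn n. central_coeff n \<nu> g * central_coeff n \<mu> g) = 0"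
proof -
  let ?\<alpha> = wact
  have \<alpha>: "is_action ?\<alpha>" by simp
  define P where "P = (\<lambda>\<nu> f x. \<Sum>g\<in>Sn n. central_coeff n \<nu> g * act ?\<alpha> g f x)"
  have "P \<nu> (P \<mu> (ket id)) id = 0"
  proof -
    have "P \<mu> (ket id) = (\<lambda>x. \<Sum>h\<in>Sn n. act ?\<alpha> h (young_std n ?\<alpha> \<mu> (act ?\<alpha> (inv h) (ket id))) x)"
      by (simp only: P_def central_coeff_operator[OF \<alpha>])
    moreover have "P \<nu> f id = (\<Sum>h\<in>Sn n. act ?\<alpha> h (young_std n ?\<alpha> \<nu> (act ?\<alpha> (inv h) f)) id)" for f
      by (simp only: P_def central_coeff_operator[OF \<alpha>])
    ultimately have "P \<nu> (P \<mu> (ket id)) id = (\<Sum>h\<in>Sn n. act ?\<alpha> h (\<lambda>x. \<Sum>l\<in>Sn n.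
        young_std n ?\<alpha> \<nu> (act ?\<alpha> (inv h) (act ?\<alpha> l (young_std n ?\<alpha> \<mu> (act ?\<alpha> (inv l) (ket id))))) x) id)"
      by (simp only: act_sum young_sum)
    also have "\<dots> = (\<Sum>h\<in>Sn n. act ?\<alpha> h (\<lambda>x. 0) id)"
      by (intro sum.cong refl arg_cong[where f = "\<lambda>f. act ?\<alpha> _ f id"] ext sum.neutral ballI)
        (simp add: act_act[OF \<alpha>] young_act_young_zero[OF \<alpha> nu])
    finally show ?thesis by (simp add: act_def)
  qed
  moreover have "P \<nu> (P \<mu> (ket id)) id
     = (\<Sum>g\<in>Sn n. central_coeff n \<nu> g * (\<Sum>h\<in>Sn n. central_coeff n \<mu> h * (if h = inv g then 1 else 0)))"
    unfolding P_def
  proof (intro sum.cong refl arg_cong2[where f = "(*)"])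
    fix g assume g: "g \<in> Sn n"
    show "act ?\<alpha> g (\<lambda>x. \<Sum>h\<in>Sn n. central_coeff n \<mu> h * act ?\<alpha> h (ket id) x) id
        = (\<Sum>h\<in>Sn n. central_coeff n \<mu> h * (if h = inv g then 1 else 0))"
      unfolding act_def ket_def
      by (intro sum.cong refl arg_cong2[where f = "(*)"]) (simp add: comp_eq_id_Sn[OF g])
  qed
  moreover have "(\<Sum>g\<in>Sn n. central_coeff n \<nu> g * (\<Sum>h\<in>Sn n. central_coeff n \<mu> h * (if h = inv g then 1 else 0)))
     = (\<Sum>g\<in>Sn n. central_coeff n \<nu> g * central_coeff n \<mu> g)"
  proof (intro sum.cong refl arg_cong2[where f = "(*)"])
    fix g assume g: "g \<in> Sn n"
    have "(\<Sum>h\<in>Sn n. central_coeff n \<mu> h * (if h = inv g then 1 else 0)) = central_coeff n \<mu> (inv g)"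
    proof -
      have "(\<Sum>h\<in>Sn n. central_coeff n \<mu> h * (if h = inv g then 1 else 0))
          = (\<Sum>h\<in>Sn n. if h = inv g then central_coeff n \<mu> (inv g) else 0)"
        by (intro sum.cong) auto
      thus ?thesis using inv_Sn[OF g] by (simp only: sum.delta finite_Sn if_True)
    qed
    thus "(\<Sum>h\<in>Sn n. central_coeff n \<mu> h * (if h = inv g then 1 else 0)) = central_coeff n \<mu> g"
      using central_coeff_inv[OF g] by simp
  qed
  ultimately show ?thesis by simp
qed

lemma central_coeff_real: "central_coeff n \<nu> g \<in> \<real>"
  unfolding central_coeff_def csgn_def by (intro sum_in_Reals) (auto intro!: Reals_mult)

text \<open>A row permutation and a column permutation are inverse to each other only if both are trivial, so
no cancellation occurs in the coefficient of the identity.\<close>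

lemma central_coeff_id:
  assumes nu: "\<nu> \<in> Parts n"
  shows "central_coeff n \<nu> id \<noteq> 0"
proof -
  have P: "is_partition \<nu>" "psize \<nu> = n" using nu by (auto simp: Parts_def)
  have "central_coeff n \<nu> id = (\<Sum>(h, \<sigma>, \<tau>)\<in>conj_triples n \<nu>. if \<sigma> = id \<and> \<tau> = id then 1 else 0)"
    unfolding central_coeff_def
  proof (intro sum.cong refl, clarify)
    fix h \<sigma> \<tau> assume "(h, \<sigma>, \<tau>) \<in> conj_triples n \<nu>"
    note hst = conj_triplesD[OF this]
    have "h \<circ> \<sigma> \<circ> \<tau> \<circ> inv h = id \<longleftrightarrow> \<sigma> = id \<and> \<tau> = id"
    proof
      assume a: "h \<circ> \<sigma> \<circ> \<tau> \<circ> inv h = id"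
      have "inv h \<circ> (h \<circ> \<sigma> \<circ> \<tau> \<circ> inv h) \<circ> h = \<sigma> \<circ> \<tau>" using hst by (simp add: comp_assoc)
      hence "\<sigma> \<circ> \<tau> = id" unfolding a using hst by simp
      hence t: "\<tau> = inv \<sigma>" using comp_eq_id_Sn[OF hst(2,3)] by simp
      hence "\<tau> \<in> stab n (std_col \<nu>)" using inv_stab[OF hst(4)] by simp
      hence "\<tau> = id" using stab_row_col[OF placement_pick[OF P(1)]] hst P by simp
      moreover have "\<sigma> = inv \<tau>" using t hst by simp
      ultimately show "\<sigma> = id \<and> \<tau> = id" by (simp add: inv_id)
    qed (use hst in simp)
    thus "csgn \<sigma> * (if h \<circ> \<sigma> \<circ> \<tau> \<circ> inv h = id then 1 else 0) = (if \<sigma> = id \<and> \<tau> = id then 1 else 0)"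
      by auto
  qed
  also have "\<dots> = (\<Sum>p\<in>conj_triples n \<nu> \<inter> {p. snd p = (id, id)}. 1)"
    by (intro sum.mono_neutral_cong_right) (auto simp: case_prod_unfold prod_eq_iff)
  also have "\<dots> = of_nat (card (conj_triples n \<nu> \<inter> {p. snd p = (id, id)}))" by simp
  also have "\<dots> \<noteq> 0"
  proof -
    have "(id, id, id) \<in> conj_triples n \<nu> \<inter> {p. snd p = (id, id)}" by (simp add: conj_triples_def)
    hence "card (conj_triples n \<nu> \<inter> {p. snd p = (id, id)}) > 0"
      unfolding card_gt_0_iff by (intro conjI) (blast, simp)
    thus ?thesis unfolding of_nat_eq_0_iff by linarith
  qed
  finally show ?thesis .
qed

lemma central_coeff_norm:
  assumes nu: "\<nu> \<in> Parts n"
  shows "(\<Sum>g\<in>Sn n. central_coeff n \<nu> g * central_coeff n \<nu> g) \<noteq> 0"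
proof -
  have e: "central_coeff n \<nu> g * central_coeff n \<nu> g = of_real ((Re (central_coeff n \<nu> g))\<^sup>2)" for g
    using central_coeff_real[of n \<nu> g] by (metis Reals_cases Re_complex_of_real of_real_power power2_eq_square)
  have "Re (central_coeff n \<nu> id) \<noteq> 0"
    using central_coeff_id[OF nu] central_coeff_real[of n \<nu> id] by (metis Reals_cases Re_complex_of_real of_real_0)
  hence "(\<Sum>g\<in>Sn n. (Re (central_coeff n \<nu> g))\<^sup>2) > 0"
    by (intro sum_pos2[where i = id]) auto
  thus ?thesis unfolding e of_real_sum[symmetric] of_real_eq_0_iff by linarith
qed

lemma conj_class_self: "g \<in> Sn n \<Longrightarrow> g \<in> conj_class n g"
  unfolding conj_class_def mem_Collect_eq by (rule exI[of _ id]) (simp add: inv_id)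

lemma conj_class_mem:
  assumes "g \<in> Sn n" "h \<in> conj_class n g"
  shows "h \<in> Sn n" "conj_class n h = conj_class n g"
proof -
  obtain k where k: "k \<in> Sn n" "h = k \<circ> g \<circ> inv k" using assms(2) unfolding conj_class_def by blast
  thus "h \<in> Sn n" using assms(1) by simp
  have "h = inv (inv k) \<circ> g \<circ> inv k" using k by simp
  thus "conj_class n h = conj_class n g" by (rule conj_class_eqI[OF assms(1) inv_Sn[OF k(1)]])
qed

lemma sum_fun_apply: "(\<Sum>i\<in>I. F i) x = (\<Sum>i\<in>I. F i (x::'x) :: complex)"
  by (induction I rule: infinite_finite_induct) auto

text \<open>Nonzero orthogonal vectors are independent, and there are as many of them as there are partitions,
which is at least the number of conjugacy classes. Hence they span the class functions, among them the point
mass at the identity.\<close>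

theorem identity_decomposition:
  "\<exists>a. \<forall>g. ket id g = (\<Sum>\<nu>\<in>Parts n. a \<nu> * central_coeff n \<nu> g)"
proof -
  define B where "B = central_coeff n ` Parts n"
  define ind where "ind = (\<lambda>C (g :: nat \<Rightarrow> nat). if g \<in> C then 1 else 0 :: complex)"
  define T where "T = ind ` classes n"
  have inj: "inj_on (central_coeff n) (Parts n)"
    using central_coeff_orthogonal central_coeff_norm by (intro inj_onI) metis
  have finB: "finite B" by (simp add: B_def)
  have finT: "finite T" "card T \<le> card B"
    using card_classes[of n] order_trans[OF card_image_le[of "classes n" ind] card_classes(2)[of n]]
    by (simp_all add: T_def B_def card_image[OF inj])
  have indep: "cfun.independent B"
  proof (rule cfun.independent_if_scalars_zero[OF finB])
    fix f v assume s: "(\<Sum>v\<in>B. (\<lambda>x. f v * v x)) = 0" and "v \<in> B"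
    then obtain \<mu> where mu: "\<mu> \<in> Parts n" "v = central_coeff n \<mu>" by (auto simp: B_def)
    have "(\<Sum>\<nu>\<in>Parts n. f (central_coeff n \<nu>) * central_coeff n \<nu> g) = 0" for g
    proof -
      have "(\<Sum>v\<in>B. (\<lambda>x. f v * v x)) g = 0" using s by (simp only: zero_fun_apply)
      thus ?thesis by (simp add: sum_fun_apply B_def sum.reindex[OF inj])
    qed
    hence "0 = (\<Sum>g\<in>Sn n. (\<Sum>\<nu>\<in>Parts n. f (central_coeff n \<nu>) * central_coeff n \<nu> g) * central_coeff n \<mu> g)" by simp
    also have "\<dots> = (\<Sum>g\<in>Sn n. \<Sum>\<nu>\<in>Parts n. f (central_coeff n \<nu>) * (central_coeff n \<nu> g * central_coeff n \<mu> g))"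
      by (simp add: sum_distrib_right mult.assoc)
    also have "\<dots> = (\<Sum>\<nu>\<in>Parts n. f (central_coeff n \<nu>) * (\<Sum>g\<in>Sn n. central_coeff n \<nu> g * central_coeff n \<mu> g))"
      unfolding sum_distrib_left by (rule sum.swap)
    also have "\<dots> = (\<Sum>\<nu>\<in>Parts n. if \<nu> = \<mu> then f (central_coeff n \<mu>) * (\<Sum>g\<in>Sn n. central_coeff n \<mu> g * central_coeff n \<mu> g) else 0)"
      using central_coeff_orthogonal mu by (intro sum.cong) auto
    also have "\<dots> = f (central_coeff n \<mu>) * (\<Sum>g\<in>Sn n. central_coeff n \<mu> g * central_coeff n \<mu> g)" using mu by simp
    finally show "f v = 0" using central_coeff_norm[OF mu(1)] mu(2) by simp
  qed
  have BT: "B \<subseteq> cfun.span T"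
  proof
    fix f assume "f \<in> B"
    then obtain \<nu> where f: "f = central_coeff n \<nu>" by (auto simp: B_def)
    define k where "k = (\<lambda>C. central_coeff n \<nu> (SOME g. g \<in> C))"
    have "f = (\<lambda>g. \<Sum>C\<in>classes n. k C * ind C g)"
    proof
      fix g
      show "f g = (\<Sum>C\<in>classes n. k C * ind C g)"
      proof (cases "g \<in> Sn n")
        case True
        have uniq: "C = conj_class n g" if "C \<in> classes n" "g \<in> C" for C
          using that conj_class_mem(2) unfolding classes_def by blast
        have "(\<Sum>C\<in>classes n. k C * ind C g) = (\<Sum>C\<in>{conj_class n g}. k C * ind C g)"
          using uniq True by (intro sum.mono_neutral_right) (auto simp: ind_def classes_def)
        also have "\<dots> = k (conj_class n g)" using conj_class_self[OF True] by (simp add: ind_def)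
        also have "\<dots> = f g"
        proof -
          have "(SOME h. h \<in> conj_class n g) \<in> conj_class n g"
            by (rule someI[of "\<lambda>h. h \<in> conj_class n g", OF conj_class_self[OF True]])
          then obtain l where "l \<in> Sn n" "(SOME h. h \<in> conj_class n g) = l \<circ> g \<circ> inv l"
            unfolding conj_class_def by blast
          thus ?thesis by (simp add: k_def f central_coeff_conj)
        qed
        finally show ?thesis ..
      next
        case False
        hence "g \<notin> C" if "C \<in> classes n" for C using conj_class_mem(1) that unfolding classes_def by blast
        hence "(\<Sum>C\<in>classes n. k C * ind C g) = 0" by (intro sum.neutral) (simp add: ind_def)
        thus ?thesis using central_coeff_eq_0[OF False] f by simp
      qed
    qed
    also have "\<dots> = (\<Sum>C\<in>classes n. (\<lambda>g. k C * ind C g))" by (simp add: fun_eq_iff sum_fun_apply)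
    also have "\<dots> \<in> cfun.span T"
      by (intro cfun.span_sum cfun.span_scale cfun.span_base) (simp add: T_def)
    finally show "f \<in> cfun.span T" .
  qed
  have "ket id = ind (conj_class n id)"
  proof -
    have "conj_class n id = {id}"
    proof
      show "conj_class n id \<subseteq> {id}"
      proof
        fix g assume "g \<in> conj_class n id"
        then obtain k where "k \<in> Sn n" "g = k \<circ> id \<circ> inv k" unfolding conj_class_def by blast
        thus "g \<in> {id}" by simp
      qed
    qed (simp add: conj_class_self)
    thus ?thesis unfolding ket_def ind_def by simp
  qed
  hence kT: "ket id \<in> T" by (auto simp: T_def classes_def)
  \<comment> \<open>If it were not in the span, adding it would give too many independent class functions.\<close>
  have "ket id \<in> cfun.span B"
  proof (rule ccontr)
    assume n: "ket id \<notin> cfun.span B"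
    hence "cfun.independent (insert (ket id) B)" using indep by (rule cfun.independent_insertI)
    moreover have "insert (ket id) B \<subseteq> cfun.span T" using BT kT cfun.span_base by blast
    ultimately have "card (insert (ket id) B) \<le> card T"
      using cfun.independent_span_bound[OF finT(1)] by blast
    moreover have "ket id \<notin> B" using n cfun.span_base by blast
    ultimately show False using finT finB by simp
  qed
  then obtain u where u: "ket id = (\<Sum>v\<in>B. (\<lambda>x. u v * v x))"
    unfolding cfun.span_finite[OF finB] by blast
  have "\<forall>g. ket id g = (\<Sum>\<nu>\<in>Parts n. u (central_coeff n \<nu>) * central_coeff n \<nu> g)"
    by (subst u) (simp add: sum_fun_apply B_def sum.reindex[OF inj])
  thus ?thesis by (intro exI[of _ "\<lambda>\<nu>. u (central_coeff n \<nu>)"])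
qed

text \<open>Completeness, with coefficients that do not depend on the representation: every vector is recovered from
the images of its translates under the Young symmetrizers.\<close>

theorem young_resolution:
  "\<exists>a. \<forall>\<alpha> f. is_action \<alpha> \<longrightarrow>
     f = (\<lambda>x::'x. \<Sum>\<nu>\<in>Parts n. a \<nu> * (\<Sum>h\<in>Sn n. act \<alpha> h (young_std n \<alpha> \<nu> (act \<alpha> (inv h) f)) x))"
proof -
  obtain a where a: "\<And>g. ket id g = (\<Sum>\<nu>\<in>Parts n. a \<nu> * central_coeff n \<nu> g)"
    using identity_decomposition by blast
  have "f x = (\<Sum>\<nu>\<in>Parts n. a \<nu> * (\<Sum>h\<in>Sn n. act \<alpha> h (young_std n \<alpha> \<nu> (act \<alpha> (inv h) f)) x))"
    if \<alpha>: "is_action \<alpha>" for \<alpha> :: "(nat \<Rightarrow> nat) \<Rightarrow> 'x \<Rightarrow> 'x" and f x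
  proof -
    have "(\<Sum>\<nu>\<in>Parts n. a \<nu> * (\<Sum>h\<in>Sn n. act \<alpha> h (young_std n \<alpha> \<nu> (act \<alpha> (inv h) f)) x))
       = (\<Sum>\<nu>\<in>Parts n. \<Sum>g\<in>Sn n. a \<nu> * central_coeff n \<nu> g * act \<alpha> g f x)"
      by (simp only: central_coeff_operator[OF \<alpha>, symmetric] sum_distrib_left mult.assoc)
    also have "\<dots> = (\<Sum>g\<in>Sn n. \<Sum>\<nu>\<in>Parts n. a \<nu> * central_coeff n \<nu> g * act \<alpha> g f x)" by (rule sum.swap)
    also have "\<dots> = (\<Sum>g\<in>Sn n. ket id g * act \<alpha> g f x)" by (simp only: a sum_distrib_right)
    also have "\<dots> = (\<Sum>g\<in>Sn n. if g = id then f x else 0)"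
      using act_id[OF \<alpha>, of f] by (intro sum.cong) (auto simp: ket_def)
    also have "\<dots> = f x" by simp
    finally show ?thesis ..
  qed
  thus ?thesis by blast
qed

text \<open>This is the form in which completeness is used: a subspace is generated by what the Young symmetrizers
make of it. With \<open>I = 0\<close> it also detects that an invariant subspace vanishes.\<close>

lemma invariant_generated:
  assumes \<alpha>: "is_action \<alpha>" and W: "invariant n \<alpha> W" and I: "invariant n \<alpha> I"
    and Y: "\<And>f \<nu>. f \<in> W \<Longrightarrow> \<nu> \<in> Parts n \<Longrightarrow> young_std n \<alpha> \<nu> f \<in> I"
  shows "W \<subseteq> I"
proof
  fix f :: "'a \<Rightarrow> complex" assume f: "f \<in> W"
  obtain a where "\<forall>\<alpha> f. is_action \<alpha> \<longrightarrow>
     f = (\<lambda>x::'a. \<Sum>\<nu>\<in>Parts n. a \<nu> * (\<Sum>h\<in>Sn n. act \<alpha> h (young_std n \<alpha> \<nu> (act \<alpha> (inv h) f)) x))"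
    using young_resolution[of n] by (elim exE)
  from this[rule_format, OF \<alpha>, of f]
  have a: "f = (\<lambda>x. \<Sum>\<nu>\<in>Parts n. a \<nu> * (\<Sum>h\<in>Sn n. act \<alpha> h (young_std n \<alpha> \<nu> (act \<alpha> (inv h) f)) x))" .
  have sI: "cfun.subspace I" using I unfolding invariant_def by blast
  have "(\<lambda>x. \<Sum>\<nu>\<in>Parts n. a \<nu> * (\<Sum>h\<in>Sn n. act \<alpha> h (young_std n \<alpha> \<nu> (act \<alpha> (inv h) f)) x)) \<in> I"
  proof (rule csub_sum[OF sI], rule csub_scale[OF sI], rule csub_sum[OF sI])
    fix \<nu> h assume nu: "\<nu> \<in> Parts n" and h: "h \<in> Sn n"
    have "act \<alpha> (inv h) f \<in> W" using W f inv_Sn[OF h] unfolding invariant_def by blast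
    hence "young_std n \<alpha> \<nu> (act \<alpha> (inv h) f) \<in> I" using Y nu by blast
    thus "act \<alpha> h (young_std n \<alpha> \<nu> (act \<alpha> (inv h) f)) \<in> I" using I h unfolding invariant_def by blast
  qed
  thus "f \<in> I" by (subst a)
qed

section \<open>Direct sums of Specht modules\<close>

lemma is_action_sum_act [simp]: "is_action sum_act"
  by (auto simp: is_action_def sum_act_def comp_assoc)

lemma is_action_tensor_act [simp]: "is_action tensor_act"
  by (auto simp: is_action_def tensor_act_def comp_assoc)

lemma PartsD: "\<nu> \<in> Parts n \<Longrightarrow> is_partition \<nu>" "\<nu> \<in> Parts n \<Longrightarrow> psize \<nu> = n"
  by (auto simp: Parts_def)

lemma specht_sum_iff:
  "h \<in> specht_sum n m \<longleftrightarrow> (\<forall>\<nu> i. if \<nu> \<in> Parts n \<and> i < m \<nu> then (\<lambda>w. h (\<nu>, i, w)) \<in> specht \<nu>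
     else (\<lambda>w. h (\<nu>, i, w)) = (\<lambda>w. 0))"
  by (auto simp: specht_sum_def Parts_def split: if_splits)

lemma subspace_specht: "cfun.subspace (specht lam)"
  by (simp add: specht_def)

lemma slot_act: "(\<lambda>w. act sum_act \<sigma> h (\<nu>, i, w)) = act wact \<sigma> (\<lambda>w. h (\<nu>, i, w))"
  by (simp add: act_def sum_act_def)

lemma slot_young: "(\<lambda>w. young n sum_act r c h (\<nu>, i, w)) = young n wact r c (\<lambda>w. h (\<nu>, i, w))"
  by (simp add: young_def group_sum_def sum_act_def)

lemma invariant_specht_sum: "invariant n sum_act (specht_sum n m)"
  unfolding invariant_def
proof (intro conjI ballI)
  show "cfun.subspace (specht_sum n m)"
  proof (rule cfun.subspaceI)
    show "0 \<in> specht_sum n m" using csub_0[OF subspace_specht] by (auto simp: specht_sum_iff)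
    show "f + g \<in> specht_sum n m" if "f \<in> specht_sum n m" "g \<in> specht_sum n m" for f g
      unfolding specht_sum_iff
    proof (intro allI)
      fix \<nu> i
      show "if \<nu> \<in> Parts n \<and> i < m \<nu> then (\<lambda>w. (f + g) (\<nu>, i, w)) \<in> specht \<nu>
         else (\<lambda>w. (f + g) (\<nu>, i, w)) = (\<lambda>w. 0)"
        using that[unfolded specht_sum_iff, rule_format, of \<nu> i] csub_add[OF subspace_specht]
        by (auto simp: fun_eq_iff split: if_splits)
    qed
    show "(\<lambda>x. k * f x) \<in> specht_sum n m" if "f \<in> specht_sum n m" for k f
      unfolding specht_sum_iff
    proof (intro allI)
      fix \<nu> i
      show "if \<nu> \<in> Parts n \<and> i < m \<nu> then (\<lambda>w. k * f (\<nu>, i, w)) \<in> specht \<nu>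
         else (\<lambda>w. k * f (\<nu>, i, w)) = (\<lambda>w. 0)"
        using that[unfolded specht_sum_iff, rule_format, of \<nu> i] csub_scale[OF subspace_specht]
        by (auto simp: fun_eq_iff split: if_splits)
    qed
  qed
  fix \<sigma> h assume s: "\<sigma> \<in> Sn n" and h: "h \<in> specht_sum n m"
  show "act sum_act \<sigma> h \<in> specht_sum n m" unfolding specht_sum_iff slot_act
  proof (intro allI)
    fix \<nu> i
    show "if \<nu> \<in> Parts n \<and> i < m \<nu> then act wact \<sigma> (\<lambda>w. h (\<nu>, i, w)) \<in> specht \<nu>
         else act wact \<sigma> (\<lambda>w. h (\<nu>, i, w)) = (\<lambda>w. 0)"
      using h[unfolded specht_sum_iff, rule_format, of \<nu> i] invariant_specht[of \<nu>] s PartsD(2)[of \<nu> n]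
      by (auto simp: invariant_def act_def fun_eq_iff split: if_splits)
  qed
qed

definition slot :: "'p \<Rightarrow> nat \<Rightarrow> ('w \<Rightarrow> complex) \<Rightarrow> 'p \<times> nat \<times> 'w \<Rightarrow> complex" where
  "slot \<nu> i f = (\<lambda>(\<rho>, j, w). if \<rho> = \<nu> \<and> j = i then f w else 0)"

lemma slot_specht_sum:
  "\<nu> \<in> Parts n \<Longrightarrow> i < m \<nu> \<Longrightarrow> f \<in> specht \<nu> \<Longrightarrow> slot \<nu> i f \<in> specht_sum n m"
  unfolding specht_sum_iff
proof (intro allI)
  fix \<rho> j assume a: "\<nu> \<in> Parts n" "i < m \<nu>" "f \<in> specht \<nu>"
  have "(\<lambda>w. slot \<nu> i f (\<rho>, j, w)) = (if \<rho> = \<nu> \<and> j = i then f else (\<lambda>w. 0))"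
    by (auto simp: slot_def)
  thus "if \<rho> \<in> Parts n \<and> j < m \<rho> then (\<lambda>w. slot \<nu> i f (\<rho>, j, w)) \<in> specht \<rho>
     else (\<lambda>w. slot \<nu> i f (\<rho>, j, w)) = (\<lambda>w. 0)"
    using a csub_0[OF subspace_specht, of \<rho>] by auto
qed

abbreviation "std_polytab n \<nu> \<equiv> polytab n (std_row \<nu>) (std_col \<nu>)"

lemma std_polytab_specht: "\<nu> \<in> Parts n \<Longrightarrow> std_polytab n \<nu> \<in> specht \<nu>"
  using polytab_specht[OF placement_pick[OF PartsD(1)]] PartsD(2) by blast

lemma std_polytab_diag: "\<nu> \<in> Parts n \<Longrightarrow> std_polytab n \<nu> (std_row \<nu>) = 1"
  using polytab_diag[OF placement_pick[OF PartsD(1)]] PartsD(2) by blast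

lemma young_std_std_polytab:
  assumes "\<nu> \<in> Parts n"
  obtains \<gamma> where "\<gamma> \<noteq> 0" "young_std n wact \<nu> (std_polytab n \<nu>) = (\<lambda>x. \<gamma> * std_polytab n \<nu> x)"
proof -
  note P = placement_pick[OF PartsD(1)[OF assms]]
  show ?thesis
    using that[OF _ young_specht_self[OF PartsD(1)[OF assms] P, unfolded PartsD(2)[OF assms], OF std_polytab_specht[OF assms]]]
      young_polytab_nonzero[OF P] PartsD(2)[OF assms] by blast
qed

text \<open>Every copy of \<open>specht \<nu>\<close> contributes a multiple of its polytabloid and the other summands
contribute nothing.\<close>

lemma young_std_specht_sum:
  assumes h: "h \<in> specht_sum n m" and nu: "\<nu> \<in> Parts n"
  shows "\<exists>k. young_std n sum_act \<nu> h = (\<lambda>p. \<Sum>j<m \<nu>. k j * slot \<nu> j (std_polytab n \<nu>) p)"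
proof -
  define k where "k = (\<lambda>j. young_std n wact \<nu> (\<lambda>w. h (\<nu>, j, w)) (std_row \<nu>))"
  note P = placement_pick[OF PartsD(1)[OF nu]]
  have "young_std n sum_act \<nu> h (\<rho>, i, w) = (\<Sum>j<m \<nu>. k j * slot \<nu> j (std_polytab n \<nu>) (\<rho>, i, w))" for \<rho> i w
  proof -
    have sl: "young_std n sum_act \<nu> h (\<rho>, i, w) = young_std n wact \<nu> (\<lambda>w. h (\<rho>, i, w)) w"
      using slot_young[of n "std_row \<nu>" "std_col \<nu>" h \<rho> i] by (rule fun_cong)
    note hi = h[unfolded specht_sum_iff, rule_format, of \<rho> i]
    consider "\<rho> = \<nu>" "i < m \<nu>" | "\<rho> \<noteq> \<nu>" "\<rho> \<in> Parts n" "i < m \<rho>" | "\<not> (\<rho> \<in> Parts n \<and> i < m \<rho>)"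
      using nu by blast
    thus ?thesis
    proof cases
      case 1
      have hs: "(\<lambda>w. h (\<nu>, i, w)) \<in> specht \<nu>" using hi 1 nu by simp
      have "(\<Sum>j<m \<nu>. k j * slot \<nu> j (std_polytab n \<nu>) (\<rho>, i, w)) = (\<Sum>j<m \<nu>. if j = i then k i * std_polytab n \<nu> w else 0)"
        using 1 by (intro sum.cong) (auto simp: slot_def)
      also have "\<dots> = k i * std_polytab n \<nu> w" using 1 by simp
      also have "\<dots> = young_std n wact \<nu> (\<lambda>w. h (\<nu>, i, w)) w"
        using fun_cong[OF young_specht_self[OF PartsD(1)[OF nu] P hs], of w] PartsD(2)[OF nu] 
        by (simp add: k_def)
      finally show ?thesis using sl 1 by simp
    next
      case 2
      hence "young_std n wact \<nu> (\<lambda>w. h (\<rho>, i, w)) = (\<lambda>_. 0)"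
        using hi young_specht_other[OF PartsD(1)[OF nu] PartsD(1)[OF 2(2)] PartsD(2)[OF nu]
            PartsD(2)[OF 2(2)] _ P, of "\<lambda>w. h (\<rho>, i, w)"] by auto
      moreover have "(\<Sum>j<m \<nu>. k j * slot \<nu> j (std_polytab n \<nu>) (\<rho>, i, w)) = 0"
        using 2 by (simp add: slot_def)
      ultimately show ?thesis using sl by simp
    next
      case 3
      have "(\<lambda>w. h (\<rho>, i, w)) = (\<lambda>w. 0)" using hi 3 by (auto split: if_splits)
      hence "young_std n sum_act \<nu> h (\<rho>, i, w) = 0" using sl by simp
      moreover have "(\<Sum>j<m \<nu>. k j * slot \<nu> j (std_polytab n \<nu>) (\<rho>, i, w)) = 0"
        using 3 nu by (intro sum.neutral) (auto simp: slot_def)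
      ultimately show ?thesis by simp
    qed
  qed
  hence "young_std n sum_act \<nu> h = (\<lambda>p. \<Sum>j<m \<nu>. k j * slot \<nu> j (std_polytab n \<nu>) p)" by auto
  thus ?thesis by blast
qed

text \<open>Bases indexed by an initial segment, matching the indexing of the copies in \<open>specht_sum\<close>.\<close>

definition basis_family :: "nat \<Rightarrow> (nat \<Rightarrow> 'x \<Rightarrow> complex) \<Rightarrow> ('x \<Rightarrow> complex) set \<Rightarrow> bool" where
  "basis_family d b U \<longleftrightarrow> (\<forall>i<d. b i \<in> U) \<and> (\<forall>u\<in>U. \<exists>a. u = (\<lambda>x. \<Sum>i<d. a i * b i x)) \<and>
     (\<forall>a. (\<lambda>x. \<Sum>i<d. a i * b i x) = (\<lambda>x. 0) \<longrightarrow> (\<forall>i<d. a i = 0))"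

lemma sum_fun_eq: "(\<Sum>i\<in>I. (\<lambda>x. F i x)) = (\<lambda>x. \<Sum>i\<in>I. F i x :: complex)"
  by (rule ext) (rule sum_fun_apply)

lemma basis_family_dim:
  assumes "basis_family d b U"
  shows "cfun.dim U = d"
proof -
  have bU: "\<And>i. i < d \<Longrightarrow> b i \<in> U" and sp: "\<And>u. u \<in> U \<Longrightarrow> \<exists>a. u = (\<lambda>x. \<Sum>i<d. a i * b i x)"
    and ind: "\<And>a i. (\<lambda>x. \<Sum>i<d. a i * b i x) = (\<lambda>x. 0) \<Longrightarrow> i < d \<Longrightarrow> a i = 0"
    using assms unfolding basis_family_def by blast+
  have inj: "inj_on b {..<d}"
  proof (rule inj_onI, rule ccontr)
    fix i j assume ij: "i \<in> {..<d}" "j \<in> {..<d}" "b i = b j" "i \<noteq> j"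
    define a where "a = (\<lambda>k. if k = i then 1 else if k = j then -1 else 0 :: complex)"
    have "(\<Sum>k<d. a k * b k x) = 0" for x
    proof -
      have "(\<Sum>k<d. a k * b k x) = (\<Sum>k\<in>{i, j}. a k * b k x)"
        using ij by (intro sum.mono_neutral_right) (auto simp: a_def)
      thus ?thesis using ij by (simp add: a_def)
    qed
    hence "a i = 0" using ij by (intro ind) auto
    thus False by (simp add: a_def)
  qed
  show ?thesis
  proof (rule cfun.dim_unique)
    show "b ` {..<d} \<subseteq> U" using bU by auto
    show "U \<subseteq> cfun.span (b ` {..<d})"
    proof
      fix u assume "u \<in> U"
      then obtain a where "u = (\<lambda>x. \<Sum>i<d. a i * b i x)" using sp by blast
      also have "\<dots> = (\<Sum>i<d. (\<lambda>x. a i * b i x))" by (simp add: sum_fun_eq)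
      also have "\<dots> \<in> cfun.span (b ` {..<d})" by (intro cfun.span_sum cfun.span_scale cfun.span_base) auto
      finally show "u \<in> cfun.span (b ` {..<d})" .
    qed
    show "cfun.independent (b ` {..<d})"
    proof (rule cfun.independent_if_scalars_zero)
      fix f v assume s: "(\<Sum>v\<in>b ` {..<d}. (\<lambda>x. f v * v x)) = 0" and "v \<in> b ` {..<d}"
      then obtain i where i: "i < d" "v = b i" by auto
      have "(\<lambda>x. \<Sum>i<d. f (b i) * b i x) = (\<lambda>x. 0)"
        using s by (simp add: sum.reindex[OF inj] sum_fun_eq zero_fun_def)
      from ind[OF this i(1)] show "f v = 0" using i by simp
    qed simp
    show "card (b ` {..<d}) = d" by (simp add: card_image[OF inj])
  qed
qed

lemma basis_family_exists:
  assumes U: "cfun.subspace U" and fin: "finite \<Omega>" and supp: "\<And>f x. f \<in> U \<Longrightarrow> x \<notin> \<Omega> \<Longrightarrow> f x = 0"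
  shows "\<exists>b. basis_family (cfun.dim U) b U"
proof -
  obtain B where B: "B \<subseteq> U" "cfun.independent B" "U \<subseteq> cfun.span B" "card B = cfun.dim U"
    using cfun.basis_exists[of U] by blast
  have "B \<subseteq> cfun.span (ket ` \<Omega>)"
  proof
    fix f assume "f \<in> B"
    hence f: "x \<notin> \<Omega> \<Longrightarrow> f x = 0" for x using supp B(1) by blast
    have "f = (\<lambda>x. \<Sum>y\<in>\<Omega>. f y * ket y x)"
    proof
      fix x
      have "(\<Sum>y\<in>\<Omega>. f y * ket y x) = (\<Sum>y\<in>\<Omega>. if y = x then f x else 0)"
        by (intro sum.cong) (auto simp: ket_def)
      thus "f x = (\<Sum>y\<in>\<Omega>. f y * ket y x)" using fin f[of x] by simp
    qed
    also have "\<dots> = (\<Sum>y\<in>\<Omega>. (\<lambda>x. f y * ket y x))" by (simp add: sum_fun_eq)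
    also have "\<dots> \<in> cfun.span (ket ` \<Omega>)" by (intro cfun.span_sum cfun.span_scale cfun.span_base) auto
    finally show "f \<in> cfun.span (ket ` \<Omega>)" .
  qed
  hence finB: "finite B" using cfun.independent_span_bound[OF _ B(2), of "ket ` \<Omega>"] fin by auto
  then obtain b where b: "bij_betw b {..<card B} B" using ex_bij_betw_nat_finite[OF finB] by (auto simp: atLeast0LessThan)
  have re: "(\<Sum>v\<in>B. (\<lambda>x. f v * v x)) = (\<lambda>x. \<Sum>i<card B. f (b i) * b i x)" for f
    using sum.reindex_bij_betw[OF b, of "\<lambda>v x. f v * v x"] by (simp add: sum_fun_eq)
  have "basis_family (card B) b U" unfolding basis_family_def
  proof (intro conjI allI impI ballI)
    show "b i \<in> U" if "i < card B" for i using b B(1) that by (auto simp: bij_betw_def)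
    show "\<exists>a. u = (\<lambda>x. \<Sum>i<card B. a i * b i x)" if "u \<in> U" for u
    proof -
      have "u \<in> cfun.span B" using that B(3) by blast
      then obtain f where "u = (\<Sum>v\<in>B. (\<lambda>x. f v * v x))" unfolding cfun.span_finite[OF finB] by blast
      hence "u = (\<lambda>x. \<Sum>i<card B. f (b i) * b i x)" by (simp only: re)
      thus ?thesis by (rule exI[of _ "\<lambda>i. f (b i)"])
    qed
    show "a i = 0" if a: "(\<lambda>x. \<Sum>i<card B. a i * b i x) = (\<lambda>x. 0)" and i: "i < card B" for a i
    proof -
      define f where "f = (\<lambda>v. a (inv_into {..<card B} b v))"
      have fb: "f (b i) = a i" if "i < card B" for i
        using b that by (simp add: f_def bij_betw_def)
      have "(\<Sum>v\<in>B. (\<lambda>x. f v * v x)) = (\<lambda>x. \<Sum>i<card B. a i * b i x)"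
        unfolding re by (intro ext sum.cong) (auto simp: fb)
      hence "(\<Sum>v\<in>B. (\<lambda>x. f v * v x)) = 0" using a by (simp add: zero_fun_def)
      moreover have "b i \<in> B" using b i by (auto simp: bij_betw_def)
      ultimately have "f (b i) = 0"
        using B(2)[unfolded cfun.independent_explicit_finite_subsets] finB by blast
      thus ?thesis using fb i by simp
    qed
  qed
  thus ?thesis using B(4) by auto
qed

section \<open>Multiplicities\<close>

definition lin_on :: "('x \<Rightarrow> complex) set \<Rightarrow> (('x \<Rightarrow> complex) \<Rightarrow> 'y \<Rightarrow> complex) \<Rightarrow> bool" where
  "lin_on V \<phi> \<longleftrightarrow> cfun.subspace V \<and> (\<forall>f\<in>V. \<forall>g\<in>V. \<phi> (\<lambda>x. f x + g x) = (\<lambda>y. \<phi> f y + \<phi> g y)) \<and>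
     (\<forall>c. \<forall>f\<in>V. \<phi> (\<lambda>x. c * f x) = (\<lambda>y. c * \<phi> f y))"

lemma lin_on_sub: "lin_on V \<phi> \<Longrightarrow> cfun.subspace V"
  by (simp add: lin_on_def)

lemma lin_on_add: "lin_on V \<phi> \<Longrightarrow> f \<in> V \<Longrightarrow> g \<in> V \<Longrightarrow> \<phi> (\<lambda>x. f x + g x) = (\<lambda>y. \<phi> f y + \<phi> g y)"
  by (simp add: lin_on_def)

lemma lin_on_scale: "lin_on V \<phi> \<Longrightarrow> f \<in> V \<Longrightarrow> \<phi> (\<lambda>x. c * f x) = (\<lambda>y. c * \<phi> f y)"
  by (simp add: lin_on_def)

lemma lin_on_zero:
  assumes "lin_on V \<phi>"
  shows "\<phi> (\<lambda>x. 0) = (\<lambda>y. 0)"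
  using lin_on_scale[OF assms csub_0[OF lin_on_sub[OF assms]], of 0] by simp

lemma lin_on_sum:
  assumes l: "lin_on V \<phi>" and F: "\<And>i. i \<in> I \<Longrightarrow> F i \<in> V"
  shows "\<phi> (\<lambda>x. \<Sum>i\<in>I. k i * F i x) = (\<lambda>y. \<Sum>i\<in>I. k i * \<phi> (F i) y)"
  using F
proof (induction I rule: infinite_finite_induct)
  case (insert i I)
  have 1: "(\<lambda>x. k i * F i x) \<in> V" and 2: "(\<lambda>x. \<Sum>i\<in>I. k i * F i x) \<in> V"
    using insert.prems lin_on_sub[OF l] by (auto intro!: csub_scale csub_sum)
  have "\<phi> (\<lambda>x. \<Sum>i\<in>insert i I. k i * F i x) = \<phi> (\<lambda>x. k i * F i x + (\<Sum>i\<in>I. k i * F i x))"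
    using insert.hyps by simp
  also have "\<dots> = (\<lambda>y. \<phi> (\<lambda>x. k i * F i x) y + \<phi> (\<lambda>x. \<Sum>i\<in>I. k i * F i x) y)"
    by (rule lin_on_add[OF l 1 2])
  also have "\<phi> (\<lambda>x. k i * F i x) = (\<lambda>y. k i * \<phi> (F i) y)"
    using insert.prems by (intro lin_on_scale[OF l]) simp
  also have "\<phi> (\<lambda>x. \<Sum>i\<in>I. k i * F i x) = (\<lambda>y. \<Sum>i\<in>I. k i * \<phi> (F i) y)"
    using insert.prems by (intro insert.IH) simp
  finally show ?case using insert.hyps by simp
qed (simp_all add: lin_on_zero[OF l])

definition equivariant :: "nat \<Rightarrow> ((nat \<Rightarrow> nat) \<Rightarrow> 'x \<Rightarrow> 'x) \<Rightarrow> ((nat \<Rightarrow> nat) \<Rightarrow> 'y \<Rightarrow> 'y) \<Rightarrow>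
    ('x \<Rightarrow> complex) set \<Rightarrow> (('x \<Rightarrow> complex) \<Rightarrow> 'y \<Rightarrow> complex) \<Rightarrow> bool" where
  "equivariant n \<alpha> \<beta> V \<phi> \<longleftrightarrow> invariant n \<alpha> V \<and> lin_on V \<phi> \<and>
     (\<forall>\<sigma>\<in>Sn n. \<forall>f\<in>V. \<phi> (act \<alpha> \<sigma> f) = act \<beta> \<sigma> (\<phi> f))"

lemma rep_isomorphic_iff:
  assumes "invariant n \<alpha> V"
  shows "rep_isomorphic n \<alpha> V \<beta> W \<longleftrightarrow> (\<exists>\<phi>. bij_betw \<phi> V W \<and> equivariant n \<alpha> \<beta> V \<phi>)"
  using assms
  by (auto simp: rep_isomorphic_def equivariant_def lin_on_def invariant_def act_def Sn_def)

lemma equivariant_group_sum: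
  assumes e: "equivariant n \<alpha> \<beta> V \<phi>" and A: "A \<subseteq> Sn n" and f: "f \<in> V"
  shows "\<phi> (group_sum \<alpha> A \<eta> f) = group_sum \<beta> A \<eta> (\<phi> f)"
proof -
  have l: "lin_on V \<phi>" using e by (simp add: equivariant_def)
  have a: "act \<alpha> \<sigma> f \<in> V" "\<phi> (act \<alpha> \<sigma> f) = act \<beta> \<sigma> (\<phi> f)" if "\<sigma> \<in> A" for \<sigma>
    using e A f that by (auto simp: equivariant_def invariant_def)
  have "\<phi> (group_sum \<alpha> A \<eta> f) = (\<lambda>y. \<Sum>\<sigma>\<in>A. \<eta> \<sigma> * \<phi> (act \<alpha> \<sigma> f) y)"
    unfolding group_sum_act_alt using a(1) by (rule lin_on_sum[OF l])
  also have "\<dots> = group_sum \<beta> A \<eta> (\<phi> f)" unfolding group_sum_act_alt using a(2) by simp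
  finally show ?thesis .
qed

lemma equivariant_young:
  assumes e: "equivariant n \<alpha> \<beta> V \<phi>" and f: "f \<in> V"
  shows "\<phi> (young n \<alpha> r c f) = young n \<beta> r c (\<phi> f)"
proof -
  have "invariant n \<alpha> V" using e by (simp add: equivariant_def)
  hence "symm n \<alpha> r f \<in> V" using stab_subset_Sn f by (rule invariant_group_sum)
  thus ?thesis unfolding young_def using equivariant_group_sum[OF e stab_subset_Sn] f by metis
qed

lemma equivariant_inverse:
  assumes e: "equivariant n \<alpha> \<beta> V \<phi>" and b: "bij_betw \<phi> V W" and W: "invariant n \<beta> W"
  shows "equivariant n \<beta> \<alpha> W (inv_into V \<phi>)"
proof -
  let ?\<psi> = "inv_into V \<phi>"
  have iV: "invariant n \<alpha> V" and l: "lin_on V \<phi>" using e by (auto simp: equivariant_def)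
  have sV: "cfun.subspace V" using l by (rule lin_on_sub)
  have sW: "cfun.subspace W" using W by (simp add: invariant_def)
  have \<psi>: "?\<psi> g \<in> V" "\<phi> (?\<psi> g) = g" if "g \<in> W" for g
    using b that by (auto simp: bij_betw_def inv_into_into f_inv_into_f)
  have uq: "?\<psi> g = f" if "f \<in> V" "\<phi> f = g" for f g
    using b that by (auto simp: bij_betw_def)
  show ?thesis unfolding equivariant_def lin_on_def
  proof (intro conjI ballI allI W sW)
    fix f g assume fg: "f \<in> W" "g \<in> W"
    show "?\<psi> (\<lambda>x. f x + g x) = (\<lambda>y. ?\<psi> f y + ?\<psi> g y)"
      by (intro uq csub_add[OF sV]) (simp_all add: \<psi> fg lin_on_add[OF l])
  next
    fix c f assume f: "f \<in> W"
    show "?\<psi> (\<lambda>x. c * f x) = (\<lambda>y. c * ?\<psi> f y)"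
      by (intro uq csub_scale[OF sV]) (simp_all add: \<psi> f lin_on_scale[OF l])
  next
    fix \<sigma> f assume s: "\<sigma> \<in> Sn n" and f: "f \<in> W"
    show "?\<psi> (act \<beta> \<sigma> f) = act \<alpha> \<sigma> (?\<psi> f)"
    proof (rule uq)
      show "act \<alpha> \<sigma> (?\<psi> f) \<in> V" using iV s \<psi>(1)[OF f] by (simp add: invariant_def)
      have "\<phi> (act \<alpha> \<sigma> (?\<psi> f)) = act \<beta> \<sigma> (\<phi> (?\<psi> f))"
        using e s \<psi>(1)[OF f] by (simp add: equivariant_def)
      thus "\<phi> (act \<alpha> \<sigma> (?\<psi> f)) = act \<beta> \<sigma> f" using \<psi>(2)[OF f] by simp
    qed
  qed
qed

definition specht_mult :: "nat \<Rightarrow> ((nat \<Rightarrow> nat) \<Rightarrow> 'x \<Rightarrow> 'x) \<Rightarrow> ('x \<Rightarrow> complex) set \<Rightarrow> (nat \<Rightarrow> nat) \<Rightarrow> nat" where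
  "specht_mult n \<alpha> W \<nu> = (if \<nu> \<in> Parts n then cfun.dim (young_std n \<alpha> \<nu> ` W) else 0)"

lemma subspace_young_std:
  assumes "invariant n \<alpha> W"
  shows "cfun.subspace (young n \<alpha> r c ` W)"
proof -
  have s: "cfun.subspace W" using assms by (simp add: invariant_def)
  show ?thesis
  proof (rule cfun.subspaceI)
    show "0 \<in> young n \<alpha> r c ` W"
      using csub_0[OF s] by (intro image_eqI[of _ _ "\<lambda>x. 0"]) (auto simp: zero_fun_def)
    show "u + v \<in> young n \<alpha> r c ` W" if uv: "u \<in> young n \<alpha> r c ` W" "v \<in> young n \<alpha> r c ` W" for u v
    proof -
      obtain f g where "f \<in> W" "g \<in> W" "u = young n \<alpha> r c f" "v = young n \<alpha> r c g" using uv by blast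
      thus ?thesis using csub_add[OF s, of f g]
        by (intro image_eqI[of _ _ "\<lambda>x. f x + g x"]) (auto simp: young_add plus_fun_def)
    qed
    show "(\<lambda>x. k * u x) \<in> young n \<alpha> r c ` W" if u: "u \<in> young n \<alpha> r c ` W" for k u
    proof -
      obtain f where "f \<in> W" "u = young n \<alpha> r c f" using u by blast
      thus ?thesis using csub_scale[OF s, of f k]
        by (intro image_eqI[of _ _ "\<lambda>x. k * f x"]) (auto simp: young_scale)
    qed
  qed
qed

lemma slot_young_std_polytab:
  assumes nu: "\<nu> \<in> Parts n" and \<gamma>: "young_std n wact \<nu> (std_polytab n \<nu>) = (\<lambda>x. \<gamma> * std_polytab n \<nu> x)"
  shows "young_std n sum_act \<nu> (slot \<nu> i (std_polytab n \<nu>)) = (\<lambda>p. \<gamma> * slot \<nu> i (std_polytab n \<nu>) p)"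
proof
  fix p :: "(nat \<Rightarrow> nat) \<times> nat \<times> (nat \<Rightarrow> nat)"
  obtain \<rho> j w where p: "p = (\<rho>, j, w)" by (cases p)
  have "young_std n sum_act \<nu> (slot \<nu> i (std_polytab n \<nu>)) (\<rho>, j, w)
      = young_std n wact \<nu> (\<lambda>w. slot \<nu> i (std_polytab n \<nu>) (\<rho>, j, w)) w"
    using slot_young[of n "std_row \<nu>" "std_col \<nu>" "slot \<nu> i (std_polytab n \<nu>)" \<rho> j] by (rule fun_cong)
  also have "(\<lambda>w. slot \<nu> i (std_polytab n \<nu>) (\<rho>, j, w)) = (if \<rho> = \<nu> \<and> j = i then std_polytab n \<nu> else (\<lambda>_. 0))"
    by (auto simp: slot_def)
  finally have e: "young_std n sum_act \<nu> (slot \<nu> i (std_polytab n \<nu>)) (\<rho>, j, w)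
      = young_std n wact \<nu> (if \<rho> = \<nu> \<and> j = i then std_polytab n \<nu> else (\<lambda>_. 0)) w" .
  show "young_std n sum_act \<nu> (slot \<nu> i (std_polytab n \<nu>)) p = \<gamma> * slot \<nu> i (std_polytab n \<nu>) p"
  proof (cases "\<rho> = \<nu> \<and> j = i")
    case True
    thus ?thesis unfolding p e if_P[OF True] \<gamma> by (simp add: slot_def)
  next
    case False
    thus ?thesis unfolding p e if_not_P[OF False] young_zero by (auto simp: slot_def)
  qed
qed

text \<open>An isomorphism commutes with the Young symmetrizers, whose rank on the direct sum is the number of copies:
the preimages of the polytabloids in the copies of \<open>specht \<nu>\<close> form a basis of the image.\<close>

theorem multiplicity_unique:
  assumes W: "invariant n \<alpha> W" and iso: "rep_isomorphic n \<alpha> W sum_act (specht_sum n m)"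
    and off: "\<And>\<rho>. \<rho> \<notin> Parts n \<Longrightarrow> m \<rho> = 0"
  shows "m = specht_mult n \<alpha> W"
proof
  fix \<nu>
  show "m \<nu> = specht_mult n \<alpha> W \<nu>"
  proof (cases "\<nu> \<in> Parts n")
    case False
    thus ?thesis using off by (simp add: specht_mult_def)
  next
    case nu: True
    obtain \<phi> where b: "bij_betw \<phi> W (specht_sum n m)" and e: "equivariant n \<alpha> sum_act W \<phi>"
      using iso unfolding rep_isomorphic_iff[OF W] by blast
    have l: "lin_on W \<phi>" and sW: "cfun.subspace W" using e W by (auto simp: equivariant_def invariant_def)
    obtain \<gamma> where \<gamma>: "\<gamma> \<noteq> 0" "young_std n wact \<nu> (std_polytab n \<nu>) = (\<lambda>x. \<gamma> * std_polytab n \<nu> x)"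
      using young_std_std_polytab[OF nu] .
    define h where "h = (\<lambda>i. slot \<nu> i (std_polytab n \<nu>))"
    have hin: "h i \<in> specht_sum n m" if "i < m \<nu>" for i
      unfolding h_def by (rule slot_specht_sum[where m = m and i = i, OF nu that std_polytab_specht[OF nu]])
    have hY: "young_std n sum_act \<nu> (h i) = (\<lambda>p. \<gamma> * h i p)" for i
      unfolding h_def by (rule slot_young_std_polytab[OF nu \<gamma>(2)])
    define bb where "bb = (\<lambda>i. inv_into W \<phi> (h i))"
    have bb: "bb i \<in> W" "\<phi> (bb i) = h i" if "i < m \<nu>" for i
      using b hin[OF that] by (auto simp: bij_betw_def bb_def inv_into_into f_inv_into_f)
    have inj: "f = g" if "f \<in> W" "g \<in> W" "\<phi> f = \<phi> g" for f g
      using b that by (auto simp: bij_betw_def inj_on_def)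
    have "basis_family (m \<nu>) bb (young_std n \<alpha> \<nu> ` W)" unfolding basis_family_def
    proof (intro conjI allI impI ballI)
      fix i assume i: "i < m \<nu>"
      \<comment> \<open>The preimage is an eigenvector with a nonzero eigenvalue, hence in the image.\<close>
      have Yi: "young_std n \<alpha> \<nu> (bb i) = (\<lambda>x. \<gamma> * bb i x)"
      proof (rule inj)
        show "young_std n \<alpha> \<nu> (bb i) \<in> W" by (rule invariant_young[OF W bb(1)[OF i]])
        show "(\<lambda>x. \<gamma> * bb i x) \<in> W" by (rule csub_scale[OF sW bb(1)[OF i]])
        show "\<phi> (young_std n \<alpha> \<nu> (bb i)) = \<phi> (\<lambda>x. \<gamma> * bb i x)"
          by (simp add: equivariant_young[OF e bb(1)[OF i]] lin_on_scale[OF l bb(1)[OF i]] bb(2)[OF i] hY)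
      qed
      have "bb i = young_std n \<alpha> \<nu> (\<lambda>x. inverse \<gamma> * bb i x)"
        using \<gamma>(1) by (simp add: young_scale Yi)
      thus "bb i \<in> young_std n \<alpha> \<nu> ` W" using csub_scale[OF sW bb(1)[OF i]] by blast
    next
      fix u assume "u \<in> young_std n \<alpha> \<nu> ` W"
      then obtain w where w: "w \<in> W" "u = young_std n \<alpha> \<nu> w" by blast
      have "\<phi> w \<in> specht_sum n m" using b w by (auto simp: bij_betw_def)
      then obtain k where k: "young_std n sum_act \<nu> (\<phi> w) = (\<lambda>p. \<Sum>j<m \<nu>. k j * slot \<nu> j (std_polytab n \<nu>) p)"
        using young_std_specht_sum[OF _ nu] by blast
      have "u = (\<lambda>x. \<Sum>j<m \<nu>. k j * bb j x)"
      proof (rule inj)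
        show "u \<in> W" using w invariant_young[OF W] by simp
        show "(\<lambda>x. \<Sum>j<m \<nu>. k j * bb j x) \<in> W" using bb(1) by (auto intro!: csub_sum csub_scale sW)
        have "\<phi> (\<lambda>x. \<Sum>j<m \<nu>. k j * bb j x) = (\<lambda>p. \<Sum>j<m \<nu>. k j * \<phi> (bb j) p)"
          using bb(1) by (intro lin_on_sum[OF l]) auto
        also have "\<dots> = (\<lambda>p. \<Sum>j<m \<nu>. k j * h j p)" using bb(2) by simp
        finally show "\<phi> u = \<phi> (\<lambda>x. \<Sum>j<m \<nu>. k j * bb j x)"
          using k equivariant_young[OF e w(1)] w(2) by (simp add: h_def)
      qed
      thus "\<exists>a. u = (\<lambda>x. \<Sum>j<m \<nu>. a j * bb j x)" by blast
    next
      fix a i assume a: "(\<lambda>x. \<Sum>j<m \<nu>. a j * bb j x) = (\<lambda>x. 0)" and i: "i < m \<nu>"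
      have "\<phi> (\<lambda>x. \<Sum>j<m \<nu>. a j * bb j x) = (\<lambda>p. \<Sum>j<m \<nu>. a j * \<phi> (bb j) p)"
        using bb(1) by (intro lin_on_sum[OF l]) auto
      also have "\<dots> = (\<lambda>p. \<Sum>j<m \<nu>. a j * h j p)" using bb(2) by simp
      finally have "(\<Sum>j<m \<nu>. a j * h j p) = 0" for p
        using a lin_on_zero[OF l] by (metis (no_types, lifting))
      from this[of "(\<nu>, i, std_row \<nu>)"] have "(\<Sum>j<m \<nu>. if j = i then a i else 0) = 0"
        by (simp add: h_def slot_def std_polytab_diag[OF nu] if_distrib cong: if_cong)
      thus "a i = 0" using i by simp
    qed
    thus ?thesis using basis_family_dim nu by (metis specht_mult_def)
  qed
qed

text \<open>Each basis vector of the image of the Young symmetrizer of shape \<open>\<nu>\<close> has the form \<open>c\<^sub>\<nu> w\<close> and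
receives a homomorphism from \<open>specht \<nu>\<close> sending the polytabloid to it. Together these homomorphisms are
injective, because a Young symmetrizer maps their kernel to combinations of polytabloids that go to the same
combinations of basis vectors; they are surjective, because their image contains the images of all Young
symmetrizers.\<close>

theorem specht_decomposition:
  assumes \<alpha>: "is_action \<alpha>" and W: "invariant n \<alpha> W" and fin: "finite \<Omega>"
    and supp: "\<And>f x. f \<in> W \<Longrightarrow> x \<notin> \<Omega> \<Longrightarrow> f x = 0"
  shows "rep_isomorphic n \<alpha> W sum_act (specht_sum n (specht_mult n \<alpha> W))"
proof -
  define m where "m = specht_mult n \<alpha> W"
  have sW: "cfun.subspace W" using W by (simp add: invariant_def)
  have "\<exists>b. basis_family (m \<nu>) b (young_std n \<alpha> \<nu> ` W)" if "\<nu> \<in> Parts n" for \<nu>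
  proof -
    have "\<exists>b. basis_family (cfun.dim (young_std n \<alpha> \<nu> ` W)) b (young_std n \<alpha> \<nu> ` W)"
    proof (rule basis_family_exists[OF subspace_young_std[OF W] fin])
      fix f x assume "f \<in> young_std n \<alpha> \<nu> ` W" "x \<notin> \<Omega>"
      thus "f x = 0" using supp invariant_young[OF W] by blast
    qed
    thus ?thesis using that by (simp add: m_def specht_mult_def)
  qed
  then obtain b where b: "\<And>\<nu>. \<nu> \<in> Parts n \<Longrightarrow> basis_family (m \<nu>) (b \<nu>) (young_std n \<alpha> \<nu> ` W)" by metis
  define w where "w = (\<lambda>\<nu> i. SOME f. f \<in> W \<and> b \<nu> i = young_std n \<alpha> \<nu> f)"
  have w: "w \<nu> i \<in> W" "young_std n \<alpha> \<nu> (w \<nu> i) = b \<nu> i" if "\<nu> \<in> Parts n" "i < m \<nu>" for \<nu> i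
  proof -
    have "b \<nu> i \<in> young_std n \<alpha> \<nu> ` W" using b[OF that(1)] that(2) unfolding basis_family_def by blast
    hence "\<exists>f. f \<in> W \<and> b \<nu> i = young_std n \<alpha> \<nu> f" by blast
    from someI_ex[OF this] show "w \<nu> i \<in> W" "young_std n \<alpha> \<nu> (w \<nu> i) = b \<nu> i" by (simp_all add: w_def)
  qed
  let ?V = "specht_sum n m"
  have V: "invariant n sum_act ?V" by (rule invariant_specht_sum)
  define \<Psi> where "\<Psi> = (\<lambda>h x. \<Sum>\<nu>\<in>Parts n. \<Sum>i<m \<nu>. orbit_hom n \<alpha> (std_row \<nu>) (w \<nu> i) (\<lambda>u. h (\<nu>, i, u)) x)"
  have lin: "lin_on ?V \<Psi>" unfolding lin_on_def
    using V by (auto simp: invariant_def \<Psi>_def orbit_hom_add orbit_hom_scale sum.distrib sum_distrib_left)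
  have eq: "equivariant n sum_act \<alpha> ?V \<Psi>"
    unfolding equivariant_def
  proof (intro conjI V lin ballI)
    fix \<sigma> h assume s: "\<sigma> \<in> Sn n"
    have "orbit_hom n \<alpha> r w (\<lambda>u. act sum_act \<sigma> h (\<nu>, i, u)) = act \<alpha> \<sigma> (orbit_hom n \<alpha> r w (\<lambda>u. h (\<nu>, i, u)))" for r w \<nu> i
      using orbit_hom_act[OF \<alpha> s, of r w "\<lambda>u. h (\<nu>, i, u)"] by (simp add: act_def sum_act_def)
    thus "\<Psi> (act sum_act \<sigma> h) = act \<alpha> \<sigma> (\<Psi> h)" by (simp add: \<Psi>_def act_def)
  qed
  have into: "\<Psi> h \<in> W" for h
    unfolding \<Psi>_def using w(1) by (auto intro!: csub_sum sW orbit_hom_in[OF W])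
  have pv: "\<Psi> (slot \<nu> i (std_polytab n \<nu>)) = b \<nu> i" if nu: "\<nu> \<in> Parts n" and i: "i < m \<nu>" for \<nu> i
  proof
    fix x
    have sl: "(\<lambda>u. slot \<nu> i (std_polytab n \<nu>) (\<rho>, j, u)) = (if \<rho> = \<nu> \<and> j = i then std_polytab n \<nu> else (\<lambda>u. 0))" for \<rho> j
      by (auto simp: slot_def)
    have "\<Psi> (slot \<nu> i (std_polytab n \<nu>)) x = (\<Sum>\<rho>\<in>Parts n. if \<rho> = \<nu> then \<Sum>j<m \<nu>. if j = i then b \<nu> i x else 0 else 0)"
      unfolding \<Psi>_def
    proof (rule sum.cong[OF refl])
      fix \<rho>
      show "(\<Sum>j<m \<rho>. orbit_hom n \<alpha> (std_row \<rho>) (w \<rho> j) (\<lambda>u. slot \<nu> i (std_polytab n \<nu>) (\<rho>, j, u)) x)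
         = (if \<rho> = \<nu> then \<Sum>j<m \<nu>. if j = i then b \<nu> i x else 0 else 0)"
      proof (cases "\<rho> = \<nu>")
        case True
        have "orbit_hom n \<alpha> (std_row \<nu>) (w \<nu> j) (\<lambda>u. slot \<nu> i (std_polytab n \<nu>) (\<nu>, j, u)) x = (if j = i then b \<nu> i x else 0)" for j
          unfolding sl using orbit_hom_polytab[OF \<alpha>, of n "std_row \<nu>" "w \<nu> i" "std_col \<nu>"] w(2)[OF nu i] by simp
        thus ?thesis using True by simp
      next
        case False
        thus ?thesis unfolding sl by simp
      qed
    qed
    also have "\<dots> = b \<nu> i x" using nu i by simp
    finally show "\<Psi> (slot \<nu> i (std_polytab n \<nu>)) x = b \<nu> i x" .
  qed
  have pin: "slot \<nu> i (std_polytab n \<nu>) \<in> ?V" if "\<nu> \<in> Parts n" "i < m \<nu>" for \<nu> i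
    using slot_specht_sum[of \<nu> n i m, OF that std_polytab_specht[OF that(1)]] .
  have Psi_sum: "\<Psi> (\<lambda>p. \<Sum>j<m \<nu>. k j * slot \<nu> j (std_polytab n \<nu>) p) = (\<lambda>x. \<Sum>j<m \<nu>. k j * b \<nu> j x)"
    if nu: "\<nu> \<in> Parts n" for \<nu> k
  proof -
    have "\<Psi> (\<lambda>p. \<Sum>j<m \<nu>. k j * slot \<nu> j (std_polytab n \<nu>) p) = (\<lambda>x. \<Sum>j<m \<nu>. k j * \<Psi> (slot \<nu> j (std_polytab n \<nu>)) x)"
      using pin[OF nu] by (intro lin_on_sum[OF lin]) auto
    thus ?thesis using pv[OF nu] by simp
  qed
  have "bij_betw \<Psi> ?V W"
    unfolding bij_betw_def
  proof
    \<comment> \<open>The kernel.\<close>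
    define K where "K = {h \<in> ?V. \<Psi> h = (\<lambda>x. 0)}"
    have sV: "cfun.subspace ?V" using V by (simp add: invariant_def)
    have K: "invariant n sum_act K" unfolding invariant_def
    proof (intro conjI ballI)
      show "cfun.subspace K"
      proof (rule cfun.subspaceI)
        show "0 \<in> K" using csub_0[OF sV] lin_on_zero[OF lin] by (simp add: K_def zero_fun_def)
        show "f + g \<in> K" if "f \<in> K" "g \<in> K" for f g
          using that csub_add[OF sV, of f g] lin_on_add[OF lin, of f g] by (simp add: K_def plus_fun_def)
        show "(\<lambda>x. k * f x) \<in> K" if "f \<in> K" for k f
          using that csub_scale[OF sV, of f k] lin_on_scale[OF lin, of f k] by (simp add: K_def)
      qed
      show "act sum_act \<sigma> f \<in> K" if s: "\<sigma> \<in> Sn n" and f: "f \<in> K" for \<sigma> f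
      proof -
        have "act sum_act \<sigma> f \<in> ?V" using V s f by (simp add: invariant_def K_def)
        moreover have "\<Psi> (act sum_act \<sigma> f) = act \<alpha> \<sigma> (\<Psi> f)" using eq s f by (simp add: equivariant_def K_def)
        ultimately show ?thesis using f by (simp add: K_def act_def)
      qed
    qed
    have "K \<subseteq> {\<lambda>p. 0}"
    proof (rule invariant_generated[OF is_action_sum_act K])
      show "invariant n sum_act {\<lambda>p. 0}"
        by (auto simp: invariant_def act_def intro!: cfun.subspaceI simp: zero_fun_def)
      fix h \<nu> assume h: "h \<in> K" and nu: "\<nu> \<in> Parts n"
      have hV: "h \<in> ?V" using h by (simp add: K_def)
      obtain k where k: "young_std n sum_act \<nu> h = (\<lambda>p. \<Sum>j<m \<nu>. k j * slot \<nu> j (std_polytab n \<nu>) p)"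
        using young_std_specht_sum[OF hV nu] by blast
      have "young_std n sum_act \<nu> h \<in> K" by (rule invariant_young[OF K h])
      hence "\<Psi> (young_std n sum_act \<nu> h) = (\<lambda>x. 0)" by (simp add: K_def)
      hence "(\<lambda>x. \<Sum>j<m \<nu>. k j * b \<nu> j x) = (\<lambda>x. 0)" unfolding k Psi_sum[OF nu] .
      hence "\<forall>j<m \<nu>. k j = 0" using b[OF nu] unfolding basis_family_def by blast
      thus "young_std n sum_act \<nu> h \<in> {\<lambda>p. 0}" unfolding k by simp
    qed
    thus "inj_on \<Psi> ?V"
    proof (intro inj_onI)
      fix f g assume K0: "K \<subseteq> {\<lambda>p. 0}" and fg: "f \<in> ?V" "g \<in> ?V" "\<Psi> f = \<Psi> g"
      have g': "(\<lambda>p. (-1) * g p) \<in> ?V" using fg by (intro csub_scale[OF sV])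
      have "\<Psi> (\<lambda>p. f p + (-1) * g p) = (\<lambda>x. \<Psi> f x + \<Psi> (\<lambda>p. (-1) * g p) x)"
        by (rule lin_on_add[OF lin fg(1) g'])
      also have "\<dots> = (\<lambda>x. 0)" unfolding lin_on_scale[OF lin fg(2)] using fg(3) by simp
      finally have "(\<lambda>p. f p + (-1) * g p) \<in> K" using csub_add[OF sV fg(1) g'] by (simp add: K_def)
      hence "(\<lambda>p. f p + (-1) * g p) = (\<lambda>p. 0)" using K0 by blast
      thus "f = g" by (simp add: fun_eq_iff)
    qed
    have "W \<subseteq> \<Psi> ` ?V"
    proof (rule invariant_generated[OF \<alpha> W])
      show "invariant n \<alpha> (\<Psi> ` ?V)" unfolding invariant_def
      proof (intro conjI ballI)
        show "cfun.subspace (\<Psi> ` ?V)"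
        proof (rule cfun.subspaceI)
          show "0 \<in> \<Psi> ` ?V"
            using csub_0[OF sV] lin_on_zero[OF lin] by (intro image_eqI[of _ _ "\<lambda>x. 0"]) (auto simp: zero_fun_def)
          show "u + v \<in> \<Psi> ` ?V" if uv: "u \<in> \<Psi> ` ?V" "v \<in> \<Psi> ` ?V" for u v
          proof -
            obtain f g where fg: "f \<in> ?V" "g \<in> ?V" "u = \<Psi> f" "v = \<Psi> g" using uv by blast
            hence "u + v = \<Psi> (\<lambda>x. f x + g x)" using lin_on_add[OF lin, of f g] by (simp add: plus_fun_def)
            thus ?thesis using csub_add[OF sV fg(1,2)] by blast
          qed
          show "(\<lambda>x. k * u x) \<in> \<Psi> ` ?V" if u: "u \<in> \<Psi> ` ?V" for k u
          proof -
            obtain f where f: "f \<in> ?V" "u = \<Psi> f" using u by blast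
            hence "(\<lambda>x. k * u x) = \<Psi> (\<lambda>x. k * f x)" using lin_on_scale[OF lin, of f k] by simp
            thus ?thesis using csub_scale[OF sV f(1)] by blast
          qed
        qed
        show "act \<alpha> \<sigma> u \<in> \<Psi> ` ?V" if s: "\<sigma> \<in> Sn n" and u: "u \<in> \<Psi> ` ?V" for \<sigma> u
        proof -
          obtain f where f: "f \<in> ?V" "u = \<Psi> f" using u by blast
          hence "act \<alpha> \<sigma> u = \<Psi> (act sum_act \<sigma> f)" using eq s by (simp add: equivariant_def)
          moreover have "act sum_act \<sigma> f \<in> ?V" using V s f by (simp add: invariant_def)
          ultimately show ?thesis by blast
        qed
      qed
      fix f \<nu> assume f: "f \<in> W" and nu: "\<nu> \<in> Parts n"
      then obtain k where k: "young_std n \<alpha> \<nu> f = (\<lambda>x. \<Sum>j<m \<nu>. k j * b \<nu> j x)"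
        using b[OF nu] unfolding basis_family_def by blast
      have "(\<lambda>p. \<Sum>j<m \<nu>. k j * slot \<nu> j (std_polytab n \<nu>) p) \<in> ?V"
        using pin[OF nu] by (auto intro!: csub_sum csub_scale sV)
      thus "young_std n \<alpha> \<nu> f \<in> \<Psi> ` ?V" unfolding k Psi_sum[OF nu, symmetric] by blast
    qed
    thus "\<Psi> ` ?V = W" using into by blast
  qed
  hence "bij_betw (inv_into ?V \<Psi>) W ?V" "equivariant n \<alpha> sum_act W (inv_into ?V \<Psi>)"
    using equivariant_inverse[OF eq _ W] by (auto simp: bij_betw_inv_into)
  thus ?thesis unfolding rep_isomorphic_iff[OF W] m_def by blast
qed

section \<open>Kronecker coefficients as ranks\<close>

definition tensor :: "((nat \<Rightarrow> nat) \<Rightarrow> complex) \<Rightarrow> ((nat \<Rightarrow> nat) \<Rightarrow> complex) \<Rightarrow> (nat \<Rightarrow> nat) \<times> (nat \<Rightarrow> nat) \<Rightarrow> complex" where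
  "tensor f g = (\<lambda>(u, v). f u * g v)"

lemma specht_tensor_eq: "specht_tensor lam \<mu> = cfun.span {tensor f g | f g. f \<in> specht lam \<and> g \<in> specht \<mu>}"
  by (simp add: specht_tensor_def tensor_def)

lemma tensor_in: "f \<in> specht lam \<Longrightarrow> g \<in> specht \<mu> \<Longrightarrow> tensor f g \<in> specht_tensor lam \<mu>"
  unfolding specht_tensor_eq by (intro cfun.span_base) blast

lemma specht_tensor_induct:
  assumes "cfun.subspace Z" "\<And>f g. f \<in> specht lam \<Longrightarrow> g \<in> specht \<mu> \<Longrightarrow> tensor f g \<in> Z" "h \<in> specht_tensor lam \<mu>"
  shows "h \<in> Z"
  using cfun.span_minimal[of "{tensor f g | f g. f \<in> specht lam \<and> g \<in> specht \<mu>}" Z] assms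
  unfolding specht_tensor_eq by blast

lemma act_tensor: "act tensor_act \<sigma> (tensor f g) = tensor (act wact \<sigma> f) (act wact \<sigma> g)"
  by (auto simp: act_def tensor_act_def tensor_def)

lemma subspace_specht_tensor: "cfun.subspace (specht_tensor lam \<mu>)"
  by (simp add: specht_tensor_def)

lemma invariant_specht_tensor:
  assumes "psize lam = n" "psize \<mu> = n"
  shows "invariant n tensor_act (specht_tensor lam \<mu>)"
  unfolding invariant_def
proof (intro conjI ballI subspace_specht_tensor)
  fix \<sigma> h assume s: "\<sigma> \<in> Sn n" and h: "h \<in> specht_tensor lam \<mu>"
  note sT = subspace_specht_tensor[of lam \<mu>]
  have "h \<in> {h. act tensor_act \<sigma> h \<in> specht_tensor lam \<mu>}"
  proof (rule specht_tensor_induct[OF _ _ h])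
    show "cfun.subspace {h. act tensor_act \<sigma> h \<in> specht_tensor lam \<mu>}"
    proof (rule cfun.subspaceI)
      show "0 \<in> {h. act tensor_act \<sigma> h \<in> specht_tensor lam \<mu>}"
        using csub_0[OF sT] by (simp add: act_def)
      show "f + g \<in> {h. act tensor_act \<sigma> h \<in> specht_tensor lam \<mu>}"
        if "f \<in> {h. act tensor_act \<sigma> h \<in> specht_tensor lam \<mu>}" "g \<in> {h. act tensor_act \<sigma> h \<in> specht_tensor lam \<mu>}" for f g
        using that csub_add[OF sT, of "act tensor_act \<sigma> f" "act tensor_act \<sigma> g"] by (simp add: act_def)
      show "(\<lambda>x. k * f x) \<in> {h. act tensor_act \<sigma> h \<in> specht_tensor lam \<mu>}"
        if "f \<in> {h. act tensor_act \<sigma> h \<in> specht_tensor lam \<mu>}" for k f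
        using that csub_scale[OF sT, of "act tensor_act \<sigma> f" k] by (simp add: act_def)
    qed
    show "tensor f g \<in> {h. act tensor_act \<sigma> h \<in> specht_tensor lam \<mu>}"
      if "f \<in> specht lam" "g \<in> specht \<mu>" for f g
      using that s assms invariant_specht[of lam] invariant_specht[of \<mu>]
      by (auto simp: act_tensor invariant_def intro!: tensor_in)
  qed
  thus "act tensor_act \<sigma> h \<in> specht_tensor lam \<mu>" by simp
qed

lemma specht_tensor_slice:
  assumes "h \<in> specht_tensor lam \<mu>"
  shows "(\<lambda>u. h (u, v)) \<in> specht lam"
proof -
  have "h \<in> {h. (\<lambda>u. h (u, v)) \<in> specht lam}"
  proof (rule specht_tensor_induct[OF _ _ assms])
    show "cfun.subspace {h. (\<lambda>u. h (u, v)) \<in> specht lam}"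
      using csub_0[OF subspace_specht] csub_add[OF subspace_specht] csub_scale[OF subspace_specht]
      by (intro cfun.subspaceI) auto
    show "tensor f g \<in> {h. (\<lambda>u. h (u, v)) \<in> specht lam}" if "f \<in> specht lam" "g \<in> specht \<mu>" for f g
      using csub_scale[OF subspace_specht that(1), of "g v"] by (simp add: tensor_def mult.commute)
  qed
  thus ?thesis by simp
qed

lemma specht_tensor_supported:
  assumes "h \<in> specht_tensor lam \<mu>" "v \<notin> tabloids \<mu>"
  shows "h (u, v) = 0"
proof -
  have "h \<in> {h. h (u, v) = 0}"
  proof (rule specht_tensor_induct[OF _ _ assms(1)])
    show "cfun.subspace {h. h (u, v) = (0::complex)}" by (intro cfun.subspaceI) auto
    show "tensor f g \<in> {h. h (u, v) = 0}" if "f \<in> specht lam" "g \<in> specht \<mu>" for f g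
      using specht_supported[OF that(2) assms(2)] by (simp add: tensor_def)
  qed
  thus ?thesis by simp
qed

theorem kronecker_eq_specht_mult:
  assumes P: "is_partition lam" "is_partition \<mu>" "is_partition \<nu>"
    and n: "psize lam = n" "psize \<mu> = n" "psize \<nu> = n"
  shows "kronecker lam \<mu> \<nu> = specht_mult n tensor_act (specht_tensor lam \<mu>) \<nu>"
proof -
  let ?W = "specht_tensor lam \<mu>"
  have W: "invariant n tensor_act ?W" by (rule invariant_specht_tensor[OF n(1,2)])
  have iso: "rep_isomorphic n tensor_act ?W sum_act (specht_sum n (specht_mult n tensor_act ?W))"
  proof (rule specht_decomposition[OF is_action_tensor_act W])
    show "finite (tabloids lam \<times> tabloids \<mu>)" by simp
    fix f and x :: "(nat \<Rightarrow> nat) \<times> (nat \<Rightarrow> nat)" assume f: "f \<in> ?W" and x: "x \<notin> tabloids lam \<times> tabloids \<mu>"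
    obtain u v where x': "x = (u, v)" by (cases x)
    show "f x = 0"
    proof (cases "v \<in> tabloids \<mu>")
      case True
      thus ?thesis using x x' specht_supported[OF specht_tensor_slice[OF f], of u v] by simp
    next
      case False
      thus ?thesis using specht_tensor_supported[OF f] x' by simp
    qed
  qed
  have "(THE m. (\<forall>\<rho>. \<not> (is_partition \<rho> \<and> psize \<rho> = n) \<longrightarrow> m \<rho> = 0) \<and>
     rep_isomorphic n tensor_act ?W sum_act (specht_sum n m)) = specht_mult n tensor_act ?W"
  proof (rule the_equality)
    show "(\<forall>\<rho>. \<not> (is_partition \<rho> \<and> psize \<rho> = n) \<longrightarrow> specht_mult n tensor_act ?W \<rho> = 0) \<and>
       rep_isomorphic n tensor_act ?W sum_act (specht_sum n (specht_mult n tensor_act ?W))"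
      using iso by (auto simp: specht_mult_def Parts_def)
    fix m assume m: "(\<forall>\<rho>. \<not> (is_partition \<rho> \<and> psize \<rho> = n) \<longrightarrow> m \<rho> = 0) \<and>
       rep_isomorphic n tensor_act ?W sum_act (specht_sum n m)"
    show "m = specht_mult n tensor_act ?W"
      by (rule multiplicity_unique[OF W]) (use m in \<open>auto simp: Parts_def\<close>)
  qed
  thus ?thesis using n by (simp add: kronecker_def)
qed

lemma kronecker_size:
  "kronecker lam \<mu> \<nu> \<noteq> 0 \<Longrightarrow> psize \<mu> = psize lam \<and> psize \<nu> = psize lam"
  by (auto simp: kronecker_def split: if_splits)

text \<open>The coefficient is the dimension of the image of the Young symmetrizer.\<close>

lemma kronecker_nonzero_iff:
  assumes P: "is_partition lam" "is_partition \<mu>" "is_partition \<nu>"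
    and n: "psize lam = n" "psize \<mu> = n" "psize \<nu> = n"
  shows "kronecker lam \<mu> \<nu> \<noteq> 0 \<longleftrightarrow> (\<exists>f\<in>specht_tensor lam \<mu>. young_std n tensor_act \<nu> f \<noteq> (\<lambda>_. 0))"
proof -
  let ?W = "specht_tensor lam \<mu>"
  have W: "invariant n tensor_act ?W" by (rule invariant_specht_tensor[OF n(1,2)])
  have k: "kronecker lam \<mu> \<nu> = cfun.dim (young_std n tensor_act \<nu> ` ?W)"
    using kronecker_eq_specht_mult[OF P n] P n by (simp add: specht_mult_def Parts_def)
  have s: "cfun.subspace (young_std n tensor_act \<nu> ` ?W)" by (rule subspace_young_std[OF W])
  have "\<exists>b. basis_family (cfun.dim (young_std n tensor_act \<nu> ` ?W)) b (young_std n tensor_act \<nu> ` ?W)"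
  proof (rule basis_family_exists[OF s])
    show "finite (tabloids lam \<times> tabloids \<mu>)" by simp
    fix f and x :: "(nat \<Rightarrow> nat) \<times> (nat \<Rightarrow> nat)" assume f: "f \<in> young_std n tensor_act \<nu> ` ?W" and x: "x \<notin> tabloids lam \<times> tabloids \<mu>"
    hence fW: "f \<in> ?W" using invariant_young[OF W] by blast
    obtain u v where x': "x = (u, v)" by (cases x)
    show "f x = 0"
      using x x' specht_supported[OF specht_tensor_slice[OF fW], of u v] specht_tensor_supported[OF fW, of v u]
      by auto
  qed
  then obtain b where b: "basis_family (kronecker lam \<mu> \<nu>) b (young_std n tensor_act \<nu> ` ?W)" using k by auto
  show ?thesis
  proof
    assume ne: "kronecker lam \<mu> \<nu> \<noteq> 0"
    show "\<exists>f\<in>?W. young_std n tensor_act \<nu> f \<noteq> (\<lambda>_. 0)"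
    proof (rule ccontr)
      assume "\<not> (\<exists>f\<in>?W. young_std n tensor_act \<nu> f \<noteq> (\<lambda>_. 0))"
      hence "basis_family 0 b (young_std n tensor_act \<nu> ` ?W)" unfolding basis_family_def by auto
      thus False using basis_family_dim k ne by metis
    qed
  next
    assume "\<exists>f\<in>?W. young_std n tensor_act \<nu> f \<noteq> (\<lambda>_. 0)"
    then obtain f where f: "f \<in> ?W" "young_std n tensor_act \<nu> f \<noteq> (\<lambda>_. 0)" by blast
    show "kronecker lam \<mu> \<nu> \<noteq> 0"
    proof
      assume "kronecker lam \<mu> \<nu> = 0"
      hence "\<forall>u\<in>young_std n tensor_act \<nu> ` ?W. u = (\<lambda>x. 0)" using b unfolding basis_family_def by auto
      thus False using f by blast
    qed
  qed
qed

section \<open>Kronecker coefficients of a row and of a column\<close>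

text \<open>If the group acts on the first factor through a character, group sums act on the second factor with
that character multiplied in.\<close>

lemma group_sum_tensor:
  assumes "\<And>\<sigma>. \<sigma> \<in> A \<Longrightarrow> act wact \<sigma> F = (\<lambda>u. \<eta> \<sigma> * F u)"
  shows "group_sum tensor_act A \<zeta> (tensor F g) = tensor F (group_sum wact A (\<lambda>\<sigma>. \<zeta> \<sigma> * \<eta> \<sigma>) g)"
proof
  fix x :: "(nat \<Rightarrow> nat) \<times> (nat \<Rightarrow> nat)"
  obtain u v where x: "x = (u, v)" by (cases x)
  have "F (u \<circ> \<sigma>) = \<eta> \<sigma> * F u" if "\<sigma> \<in> A" for \<sigma>
    using fun_cong[OF assms[OF that], of u] by (simp add: act_def)
  hence "(\<Sum>\<sigma>\<in>A. \<zeta> \<sigma> * (F (u \<circ> \<sigma>) * g (v \<circ> \<sigma>))) = (\<Sum>\<sigma>\<in>A. F u * (\<zeta> \<sigma> * \<eta> \<sigma> * g (v \<circ> \<sigma>)))"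
    by (intro sum.cong refl) (simp only: mult_ac)
  thus "group_sum tensor_act A \<zeta> (tensor F g) x = tensor F (group_sum wact A (\<lambda>\<sigma>. \<zeta> \<sigma> * \<eta> \<sigma>) g) x"
    unfolding x group_sum_def tensor_def tensor_act_def by (simp only: prod.case sum_distrib_left)
qed

definition one_row :: "nat \<Rightarrow> nat \<Rightarrow> nat" where "one_row n = (\<lambda>i. if i = 0 then n else 0)"
definition one_col :: "nat \<Rightarrow> nat \<Rightarrow> nat" where "one_col n = (\<lambda>i. if i < n then 1 else 0)"

lemma one_row_partition: "is_partition (one_row n)" "psize (one_row n) = n"
proof -
  have "{i. one_row n i \<noteq> 0} \<subseteq> {0}" by (auto simp: one_row_def)
  thus "is_partition (one_row n)"
    by (auto simp: is_partition_def antimono_def one_row_def intro: finite_subset)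
  have "{i. one_row n i \<noteq> 0} = (if n = 0 then {} else {0})" by (auto simp: one_row_def)
  thus "psize (one_row n) = n" by (simp add: psize_def one_row_def)
qed

lemma one_col_partition: "is_partition (one_col n)" "psize (one_col n) = n"
proof -
  have e: "{i. one_col n i \<noteq> 0} = {..<n}" by (auto simp: one_col_def)
  show "is_partition (one_col n)" by (auto simp: is_partition_def antimono_def e) (auto simp: one_col_def)
  show "psize (one_col n) = n" by (simp add: psize_def e) (simp add: one_col_def)
qed

lemma placement_one_row: "placement (one_row n) (\<lambda>_. 0) (\<lambda>x. if x < n then x else 0)"
proof -
  have "diagram (one_row n) = Pair 0 ` {..<n}" by (auto simp: diagram_def one_row_def split: if_splits)
  thus ?thesis unfolding placement_def one_row_partition
    by (auto simp: bij_betw_def inj_on_def)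
qed

lemma placement_one_col: "placement (one_col n) (\<lambda>x. if x < n then x else 0) (\<lambda>_. 0)"
proof -
  have "diagram (one_col n) = (\<lambda>i. (i, 0)) ` {..<n}" by (auto simp: diagram_def one_col_def split: if_splits)
  thus ?thesis unfolding placement_def one_col_partition
    by (auto simp: bij_betw_def inj_on_def)
qed

text \<open>The Specht module of a row is spanned by an invariant vector, so tensoring with it changes nothing.\<close>

lemma kronecker_one_row:
  assumes nu: "\<nu> \<in> Parts n"
  shows "kronecker (one_row n) \<nu> \<nu> \<noteq> 0"
proof -
  let ?\<alpha> = wact
  let ?c = "\<lambda>x::nat. if x < n then x else 0"
  define F where "F = polytab n (\<lambda>_. 0) ?c"
  note P = placement_pick[OF PartsD(1)[OF nu]]
  have F: "F \<in> specht (one_row n)"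
    using polytab_specht[OF placement_one_row[of n]] by (simp add: F_def one_row_partition)
  have F1: "F (\<lambda>_. 0) = 1"
    using polytab_diag[OF placement_one_row[of n]] by (simp add: F_def one_row_partition)
  have "\<sigma> = id" if s: "\<sigma> \<in> stab n ?c" for \<sigma>
  proof -
    have "\<sigma> \<in> stab n (\<lambda>_. 0 :: nat)" using s by (auto simp: stab_def)
    thus ?thesis using stab_row_col[OF placement_one_row[of n]] s by (simp add: one_row_partition)
  qed
  hence "stab n ?c = {id}" using id_stab by blast
  hence Fk: "F = ket (\<lambda>_. 0)" by (simp add: F_def polytab_def group_sum_def)
  have "act ?\<alpha> \<sigma> F = (\<lambda>u. 1 * F u)" if "\<sigma> \<in> Sn n" for \<sigma>
    unfolding Fk act_ket[OF that] by (simp add: o_def)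
  hence t: "group_sum tensor_act (stab n w) \<zeta> (tensor F g) = tensor F (group_sum ?\<alpha> (stab n w) \<zeta> g)" for w \<zeta> g
    using group_sum_tensor[of "stab n w" F "\<lambda>_. 1" \<zeta> g] by (simp add: stab_Sn)
  have y: "young_std n tensor_act \<nu> (tensor F (std_polytab n \<nu>)) = tensor F (young_std n ?\<alpha> \<nu> (std_polytab n \<nu>))"
    by (simp only: young_def t)
  have "young_std n tensor_act \<nu> (tensor F (std_polytab n \<nu>)) ((\<lambda>_. 0), std_row \<nu>) \<noteq> 0"
    using young_polytab_nonzero[OF P] PartsD(2)[OF nu] unfolding y by (simp add: tensor_def F1)
  hence "young_std n tensor_act \<nu> (tensor F (std_polytab n \<nu>)) \<noteq> (\<lambda>_. 0)" by auto
  moreover have "tensor F (std_polytab n \<nu>) \<in> specht_tensor (one_row n) \<nu>"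
    by (rule tensor_in[OF F std_polytab_specht[OF nu]])
  ultimately show ?thesis
    using kronecker_nonzero_iff[OF one_row_partition(1) PartsD(1)[OF nu] PartsD(1)[OF nu]
        one_row_partition(2) PartsD(2)[OF nu] PartsD(2)[OF nu]] by blast
qed

lemma placement_swap:
  assumes d: "diagram \<mu> = prod.swap ` diagram \<nu>" and s: "psize \<mu> = psize \<nu>" and p: "placement \<nu> r c"
  shows "placement \<mu> c r"
proof -
  have b: "bij_betw (\<lambda>x. (r x, c x)) {..<psize \<nu>} (diagram \<nu>)" using p by (simp add: placement_def)
  have "bij_betw prod.swap (diagram \<nu>) (diagram \<mu>)" using d by (auto simp: bij_betw_def inj_on_def)
  from bij_betw_trans[OF b this] have "bij_betw (\<lambda>x. (c x, r x)) {..<psize \<mu>} (diagram \<mu>)"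
    using s by (simp add: o_def)
  thus ?thesis using p s by (simp add: placement_def)
qed

text \<open>The Specht module of a column is spanned by a vector that transforms by the sign. Tensoring with it
exchanges symmetrization and antisymmetrization, so that the Young symmetrizer of \<open>\<nu>\<close> acts on the second
factor as the one of the transposed numbering with the two sums in the other order, and this one is visibly
nonzero at the tabloid of a polytabloid.\<close>

lemma kronecker_one_col:
  assumes mu: "\<mu> \<in> Parts n" and nu: "\<nu> \<in> Parts n" and d: "diagram \<mu> = prod.swap ` diagram \<nu>"
  shows "kronecker (one_col n) \<mu> \<nu> \<noteq> 0"
proof -
  let ?\<alpha> = wact
  let ?r = "\<lambda>x::nat. if x < n then x else 0"
  note P = placement_pick[OF PartsD(1)[OF nu]]
  have Q: "placement \<mu> (std_col \<nu>) (std_row \<nu>)"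
    using placement_swap[OF d _ P] PartsD(2)[OF mu] PartsD(2)[OF nu] by simp
  define F where "F = polytab n ?r (\<lambda>_. 0)"
  define g where "g = polytab n (std_col \<nu>) (std_row \<nu>)"
  have F: "F \<in> specht (one_col n)"
    using polytab_specht[OF placement_one_col[of n]] by (simp add: F_def one_col_partition)
  have F1: "F ?r = 1"
    using polytab_diag[OF placement_one_col[of n]] by (simp add: F_def one_col_partition)
  have g: "g \<in> specht \<mu>" using polytab_specht[OF Q] PartsD(2)[OF mu] by (simp add: g_def)
  have g1: "g (std_col \<nu>) = 1" using polytab_diag[OF Q] PartsD(2)[OF mu] by (simp add: g_def)
  have "act ?\<alpha> \<sigma> F = (\<lambda>u. csgn \<sigma> * F u)" if "\<sigma> \<in> Sn n" for \<sigma>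
    unfolding F_def polytab_def
    by (rule act_group_sum[OF is_action_wact linear_char_csgn]) (use that in \<open>simp add: Sn_eq_stab\<close>)
  hence t: "group_sum tensor_act (stab n w) \<zeta> (tensor F g) = tensor F (group_sum ?\<alpha> (stab n w) (\<lambda>\<sigma>. \<zeta> \<sigma> * csgn \<sigma>) g)" for w \<zeta> g
    using group_sum_tensor[of "stab n w" F csgn \<zeta> g] by (simp add: stab_Sn)
  have "antisymm n ?\<alpha> (std_row \<nu>) g = (\<lambda>v. of_nat (card (stab n (std_row \<nu>))) * g v)"
  proof
    fix v
    have "g (v \<circ> \<sigma>) = csgn \<sigma> * g v" if "\<sigma> \<in> stab n (std_row \<nu>)" for \<sigma>
      using fun_cong[OF act_group_sum[OF is_action_wact linear_char_csgn that, of "ket (std_col \<nu>)"], of v]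
      by (simp add: g_def polytab_def act_def)
    thus "antisymm n ?\<alpha> (std_row \<nu>) g v = of_nat (card (stab n (std_row \<nu>))) * g v"
      by (simp add: group_sum_def)
  qed
  hence y: "young_std n tensor_act \<nu> (tensor F g)
      = tensor F (\<lambda>v. of_nat (card (stab n (std_row \<nu>))) * symm n ?\<alpha> (std_col \<nu>) g v)"
    by (simp add: young_def t group_sum_scale)
  have "symm n ?\<alpha> (std_col \<nu>) g (std_col \<nu>) = (\<Sum>\<sigma>\<in>stab n (std_col \<nu>). g (std_col \<nu>))"
    unfolding group_sum_def by (intro sum.cong) (auto simp: stab_def)
  hence "young_std n tensor_act \<nu> (tensor F g) (?r, std_col \<nu>) \<noteq> 0"
    unfolding y by (simp add: tensor_def F1 g1)
  hence "young_std n tensor_act \<nu> (tensor F g) \<noteq> (\<lambda>_. 0)" by auto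
  moreover have "tensor F g \<in> specht_tensor (one_col n) \<mu>" by (rule tensor_in[OF F g])
  ultimately show ?thesis
    using kronecker_nonzero_iff[OF one_col_partition(1) PartsD(1)[OF mu] PartsD(1)[OF nu]
        one_col_partition(2) PartsD(2)[OF mu] PartsD(2)[OF nu]] by blast
qed

section \<open>Column sets\<close>

text \<open>Polytabloids are real.\<close>

lemma cnj_specht:
  assumes "f \<in> specht lam"
  shows "(\<lambda>w. cnj (f w)) \<in> specht lam"
proof -
  let ?Z = "{f. (\<lambda>w. cnj (f w)) \<in> specht lam}"
  have "cfun.subspace ?Z"
    using csub_0[OF subspace_specht] csub_add[OF subspace_specht] csub_scale[OF subspace_specht]
    by (intro cfun.subspaceI) auto
  moreover have "{polytab (psize lam) r c | r c. placement lam r c} \<subseteq> ?Z"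
  proof clarify
    fix r c assume "placement lam r c"
    moreover have "(\<lambda>w. cnj (polytab (psize lam) r c w)) = polytab (psize lam) r c"
      by (auto simp: polytab_def group_sum_def ket_def csgn_def intro!: ext sum.cong)
    ultimately show "(\<lambda>w. cnj (polytab (psize lam) r c w)) \<in> specht lam"
      by (simp add: polytab_specht)
  qed
  ultimately have "specht lam \<subseteq> ?Z" by (subst specht_eq) (rule cfun.span_minimal)
  thus ?thesis using assms by blast
qed

text \<open>The inner product of \<open>h\<close> with a polytabloid is a value of the signed column sum of \<open>h\<close>, so \<open>h\<close>
is orthogonal to the whole Specht module, including its own complex conjugate.\<close>

lemma specht_zero_criterion:
  assumes h: "h \<in> specht lam"
    and z: "\<And>r c. placement lam r c \<Longrightarrow> antisymm (psize lam) wact c h = (\<lambda>_. 0)"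
  shows "h = (\<lambda>_. 0)"
proof -
  let ?n = "psize lam" and ?\<alpha> = wact
  define B where "B = (\<lambda>f. \<Sum>u\<in>tabloids lam. h u * f u)"
  have Z: "cfun.subspace {f. B f = 0}"
    by (intro cfun.subspaceI)
      (auto simp: B_def distrib_left sum.distrib mult.left_commute simp flip: sum_distrib_left)
  have "{polytab ?n r c | r c. placement lam r c} \<subseteq> {f. B f = 0}"
  proof clarify
    fix r c assume p: "placement lam r c"
    have "B (polytab ?n r c)
      = (\<Sum>u\<in>tabloids lam. \<Sum>\<sigma>\<in>stab ?n c. csgn \<sigma> * (if u = r \<circ> inv \<sigma> then h u else 0))"
      unfolding B_def polytab_def group_sum_def sum_distrib_left
    proof (intro sum.cong refl)
      fix u \<sigma> assume "\<sigma> \<in> stab ?n c"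
      hence s: "\<sigma> \<in> Sn ?n" by (rule stab_Sn)
      have "u \<circ> \<sigma> = r \<longleftrightarrow> u = r \<circ> inv \<sigma>" using s by (metis comp_assoc comp_id inv_comp_Sn)
      thus "h u * (csgn \<sigma> * ket r (u \<circ> \<sigma>)) = csgn \<sigma> * (if u = r \<circ> inv \<sigma> then h u else 0)"
        by (simp add: ket_def)
    qed
    also have "\<dots> = (\<Sum>\<sigma>\<in>stab ?n c. \<Sum>u\<in>tabloids lam. csgn \<sigma> * (if u = r \<circ> inv \<sigma> then h u else 0))"
      by (rule sum.swap)
    also have "\<dots> = (\<Sum>\<sigma>\<in>stab ?n c. csgn (inv \<sigma>) * h (r \<circ> inv \<sigma>))"
    proof (intro sum.cong refl)
      fix \<sigma> assume "\<sigma> \<in> stab ?n c"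
      hence s: "\<sigma> \<in> Sn ?n" by (rule stab_Sn)
      have "r \<circ> inv \<sigma> \<in> tabloids lam" using tabloids_comp_iff[OF inv_Sn[OF s]] p by (auto simp: tabloids_def)
      hence "(\<Sum>u\<in>tabloids lam. if u = r \<circ> inv \<sigma> then h u else 0) = h (r \<circ> inv \<sigma>)" by simp
      thus "(\<Sum>u\<in>tabloids lam. csgn \<sigma> * (if u = r \<circ> inv \<sigma> then h u else 0)) = csgn (inv \<sigma>) * h (r \<circ> inv \<sigma>)"
        using s by (simp flip: sum_distrib_left)
    qed
    also have "\<dots> = antisymm ?n ?\<alpha> c h r"
      unfolding group_sum_def by (rule sum_stab_inv[where F = "\<lambda>\<sigma>. csgn \<sigma> * h (r \<circ> \<sigma>)"])
    finally show "B (polytab ?n r c) = 0" using z[OF p] by simp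
  qed
  hence "specht lam \<subseteq> {f. B f = 0}" unfolding specht_eq by (rule cfun.span_minimal[OF _ Z])
  hence "(\<Sum>u\<in>tabloids lam. h u * cnj (h u)) = 0" using cnj_specht[OF h] by (auto simp: B_def)
  hence "of_real (\<Sum>u\<in>tabloids lam. (cmod (h u))\<^sup>2) = (0::complex)"
    by (simp only: of_real_sum complex_norm_square)
  hence "(\<Sum>u\<in>tabloids lam. (cmod (h u))\<^sup>2) = 0" unfolding of_real_eq_0_iff .
  hence "h u = 0" if "u \<in> tabloids lam" for u
    using that by (subst (asm) sum_nonneg_eq_0_iff) auto
  thus ?thesis using specht_supported[OF h] by blast
qed

text \<open>The row symmetrization in the Young symmetrizer yields a nonzero tensor invariant under the row group of
\<open>\<nu>\<close>. A slice of it at a \<open>\<mu>\<close>-tabloid \<open>v\<close> is a nonzero vector of \<open>specht lam\<close> fixed by all permutations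
that preserve both \<open>v\<close> and the \<open>\<nu>\<close>-tabloid \<open>w\<close>. Some signed column sum does not annihilate it, and for
that numbering no transposition within a column may preserve both \<open>v\<close> and \<open>w\<close>.\<close>

lemma kronecker_nonzero_columns:
  assumes P: "is_partition lam" "is_partition \<mu>" "is_partition \<nu>" and k: "kronecker lam \<mu> \<nu> \<noteq> 0"
  obtains r c v w where "placement lam r c" "v \<in> tabloids \<mu>" "w \<in> tabloids \<nu>"
    "\<And>x y. x < psize lam \<Longrightarrow> y < psize lam \<Longrightarrow> x \<noteq> y \<Longrightarrow> c x = c y \<Longrightarrow> (v x, w x) \<noteq> (v y, w y)"
proof -
  define n where "n = psize lam"
  have n: "psize lam = n" "psize \<mu> = n" "psize \<nu> = n" using kronecker_size[OF k] by (auto simp: n_def)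
  let ?W = "specht_tensor lam \<mu>" and ?\<alpha> = wact
  have W: "invariant n tensor_act ?W" by (rule invariant_specht_tensor[OF n(1,2)])
  define w where "w = std_row \<nu>"
  have w: "w \<in> tabloids \<nu>" using placement_pick[OF P(3)] by (auto simp: tabloids_def w_def)
  obtain f where f: "f \<in> ?W" "young_std n tensor_act \<nu> f \<noteq> (\<lambda>_. 0)"
    using kronecker_nonzero_iff[OF P n] k by blast
  define H where "H = symm n tensor_act w f"
  have HW: "H \<in> ?W" unfolding H_def by (rule invariant_group_sum[OF W stab_subset_Sn f(1)])
  have "H \<noteq> (\<lambda>_. 0)"
  proof
    assume "H = (\<lambda>_. 0)"
    thus False using f(2) by (simp add: young_def w_def H_def)
  qed
  then obtain u v where uv: "H (u, v) \<noteq> 0" by (metis surj_pair ext)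
  define h where "h = (\<lambda>u. H (u, v))"
  have h: "h \<in> specht lam" unfolding h_def by (rule specht_tensor_slice[OF HW])
  have v: "v \<in> tabloids \<mu>" using specht_tensor_supported[OF HW] uv by blast
  have hinv: "act ?\<alpha> \<sigma> h = h" if s: "\<sigma> \<in> stab n w" and sv: "v \<circ> \<sigma> = v" for \<sigma>
  proof
    fix u
    have "H (u \<circ> \<sigma>, v \<circ> \<sigma>) = H (u, v)"
      using fun_cong[OF act_group_sum[OF is_action_tensor_act linear_char_1 s, of f], of "(u, v)"]
      by (simp add: H_def act_def tensor_act_def)
    thus "act ?\<alpha> \<sigma> h u = h u" by (simp add: act_def h_def sv)
  qed
  have "\<exists>r c. placement lam r c \<and> \<not> (\<exists>a b. a < n \<and> b < n \<and> a \<noteq> b \<and> c a = c b \<and> v a = v b \<and> w a = w b)"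
  proof (rule ccontr)
    assume no: "\<nexists>r c. placement lam r c \<and> \<not> (\<exists>a b. a < n \<and> b < n \<and> a \<noteq> b \<and> c a = c b \<and> v a = v b \<and> w a = w b)"
    have "antisymm (psize lam) ?\<alpha> c h = (\<lambda>_. 0)" if p: "placement lam r c" for r c
    proof -
      obtain a b where ab: "a < n" "b < n" "a \<noteq> b" "c a = c b" "v a = v b" "w a = w b" using no p by blast
      let ?t = "Transposition.transpose a b"
      have t: "?t \<in> stab n w" "?t \<in> stab n v" "?t \<in> stab n c" using transpose_stab ab by auto
      have "act ?\<alpha> ?t h = h" using hinv t by (simp add: stab_def)
      hence "antisymm n ?\<alpha> c h = (\<lambda>x. csgn ?t * antisymm n ?\<alpha> c h x)"
        using group_sum_act[OF is_action_wact linear_char_csgn t(3), of h] by simp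
      moreover have "csgn ?t = -1" using ab by (simp add: csgn_def sign_swap_id)
      ultimately have "antisymm n ?\<alpha> c h x = - antisymm n ?\<alpha> c h x" for x by (metis mult_minus1)
      thus ?thesis using n by (auto simp: eq_neg_iff_add_eq_0)
    qed
    hence "h = (\<lambda>_. 0)" by (rule specht_zero_criterion[OF h])
    hence "h u = 0" by simp
    thus False using uv by (simp add: h_def)
  qed
  then obtain r c where p: "placement lam r c"
    and rc: "\<not> (\<exists>a b. a < n \<and> b < n \<and> a \<noteq> b \<and> c a = c b \<and> v a = v b \<and> w a = w b)" by blast
  show ?thesis by (rule that[OF p v w]) (use rc n in blast)
qed

lemma card_tabloid_fibre:
  assumes "v \<in> tabloids \<mu>"
  shows "card {x. x < psize \<mu> \<and> v x = i} = \<mu> i"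
proof -
  obtain c where p: "placement \<mu> v c" using assms by (auto simp: tabloids_def)
  let ?p = "\<lambda>x. (v x, c x)"
  have b: "bij_betw ?p {..<psize \<mu>} (diagram \<mu>)" using p by (simp add: placement_def)
  have "?p ` {x. x < psize \<mu> \<and> v x = i} = Pair i ` {..<\<mu> i}"
  proof
    show "?p ` {x. x < psize \<mu> \<and> v x = i} \<subseteq> Pair i ` {..<\<mu> i}"
      using b by (auto simp: bij_betw_def diagram_def)
    show "Pair i ` {..<\<mu> i} \<subseteq> ?p ` {x. x < psize \<mu> \<and> v x = i}"
    proof clarify
      fix j assume "j < \<mu> i"
      hence "(i, j) \<in> ?p ` {..<psize \<mu>}" using b by (simp add: bij_betw_def diagram_def)
      thus "(i, j) \<in> ?p ` {x. x < psize \<mu> \<and> v x = i}" by auto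
    qed
  qed
  moreover have "inj_on ?p {x. x < psize \<mu> \<and> v x = i}"
    using b by (auto simp: bij_betw_def intro: inj_on_subset)
  ultimately have "card {x. x < psize \<mu> \<and> v x = i} = card (Pair i ` {..<\<mu> i})" by (metis card_image)
  thus ?thesis by (simp add: card_image inj_on_def)
qed

text \<open>The entries in the \<open>j\<close>-th column of \<open>lam\<close> carry distinct pairs, the row of \<open>\<mu>\<close> and the row of
\<open>\<nu>\<close> that contain them; these pairs form the set \<open>A j\<close>.\<close>

theorem kronecker_column_sets:
  assumes P: "is_partition lam" "is_partition \<mu>" "is_partition \<nu>" and k: "kronecker lam \<mu> \<nu> \<noteq> 0"
  obtains A :: "nat \<Rightarrow> (nat \<times> nat) set" where
    "\<And>j. finite (A j)" "\<And>j. card (A j) = card {i. j < lam i}"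
    "\<And>i. \<mu> i = (\<Sum>j<lam 0. card {p \<in> A j. fst p = i})"
    "\<And>i. \<nu> i = (\<Sum>j<lam 0. card {p \<in> A j. snd p = i})"
proof -
  obtain r c v w where p: "placement lam r c" and v: "v \<in> tabloids \<mu>" and w: "w \<in> tabloids \<nu>" and
    inj: "\<And>x y. x < psize lam \<Longrightarrow> y < psize lam \<Longrightarrow> x \<noteq> y \<Longrightarrow> c x = c y \<Longrightarrow> (v x, w x) \<noteq> (v y, w y)"
    using kronecker_nonzero_columns[OF P k] by metis
  have n: "psize \<mu> = psize lam" "psize \<nu> = psize lam" using kronecker_size[OF k] by auto
  define X where "X = (\<lambda>j. {x. x < psize lam \<and> c x = j})"
  define A where "A = (\<lambda>j. (\<lambda>x. (v x, w x)) ` X j)"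
  have i: "inj_on (\<lambda>x. (v x, w x)) (X j)" for j
    by (rule inj_onI) (metis (mono_tags, lifting) X_def inj mem_Collect_eq)
  have cx: "c x < lam 0" if "x < psize lam" for x
  proof -
    have "(r x, c x) \<in> diagram lam" using p that by (auto simp: placement_def bij_betw_def)
    hence "c x < lam (r x)" by (simp add: diagram_def)
    also have "lam (r x) \<le> lam 0" using P(1) by (simp add: is_partition_def antimono_def)
    finally show ?thesis .
  qed
  have fib: "card {x. x < psize lam \<and> g (v x, w x) = i} = (\<Sum>j<lam 0. card {p \<in> A j. g p = i})"
    for g :: "nat \<times> nat \<Rightarrow> nat" and i
  proof -
    have "{x. x < psize lam \<and> g (v x, w x) = i} = (\<Union>j\<in>{..<lam 0}. {x \<in> X j. g (v x, w x) = i})"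
      using cx by (auto simp: X_def)
    also have "card \<dots> = (\<Sum>j<lam 0. card {x \<in> X j. g (v x, w x) = i})"
      by (rule card_UN_disjoint) (auto simp: X_def)
    also have "\<dots> = (\<Sum>j<lam 0. card {p \<in> A j. g p = i})"
    proof (rule sum.cong[OF refl])
      fix j
      have "{p \<in> A j. g p = i} = (\<lambda>x. (v x, w x)) ` {x \<in> X j. g (v x, w x) = i}" by (auto simp: A_def)
      moreover have "inj_on (\<lambda>x. (v x, w x)) {x \<in> X j. g (v x, w x) = i}"
        using i by (rule inj_on_subset) auto
      ultimately show "card {x \<in> X j. g (v x, w x) = i} = card {p \<in> A j. g p = i}"
        by (simp add: card_image)
    qed
    finally show ?thesis .
  qed
  show ?thesis
  proof
    show "finite (A j)" for j by (simp add: A_def X_def)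
    show "card (A j) = card {i. j < lam i}" for j
      unfolding A_def card_image[OF i] using column_rows[OF P(1) p, of j] card_image[of r "X j"]
      by (simp add: X_def)
    show "\<mu> i = (\<Sum>j<lam 0. card {p \<in> A j. fst p = i})" for i
      using fib[of fst i] card_tabloid_fibre[OF v, of i] n by simp
    show "\<nu> i = (\<Sum>j<lam 0. card {p \<in> A j. snd p = i})" for i
      using fib[of snd i] card_tabloid_fibre[OF w, of i] n by simp
  qed
qed

section \<open>Weights determined by their ties\<close>

text \<open>For weights that increase in each index, two different boxes of equal weight are always placed like this, up to
swapping them.\<close>

definition index_ties :: "nat \<Rightarrow> nat \<Rightarrow> (nat \<Rightarrow> nat) \<Rightarrow> (nat \<Rightarrow> nat) \<Rightarrow> ((nat \<times> nat) \<times> (nat \<times> nat)) set" where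
  "index_ties p q x y = {((i, j), (k, l)) | i j k l. i < k \<and> k < p \<and> l < j \<and> j < q \<and> x i + y j = x k + y l}"

text \<open>The last condition says that the ties determine the weights up to translations and a common factor; the one
before it, that no three boxes have the same weight.\<close>

definition tight :: "nat \<Rightarrow> nat \<Rightarrow> (nat \<Rightarrow> nat) \<Rightarrow> (nat \<Rightarrow> nat) \<Rightarrow> bool" where
  "tight p q x y \<longleftrightarrow> 2 \<le> p \<and> 2 \<le> q \<and> x 0 = 0 \<and> y 0 = 0 \<and>
     strict_mono_on {..<p} x \<and> strict_mono_on {..<q} y \<and>
     card (index_ties p q x y) = p + q - 3 \<and>
     inj_on (\<lambda>(u, v). x (fst u) + y (snd u)) (index_ties p q x y) \<and>
     (\<forall>P Q :: nat \<Rightarrow> real. (\<forall>(u, v)\<in>index_ties p q x y. P (fst u) + Q (snd u) = P (fst v) + Q (snd v)) \<longrightarrow>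
        (\<exists>\<alpha>. (\<forall>i<p. P i = P 0 + \<alpha> * real (x i)) \<and> (\<forall>j<q. Q j = Q 0 + \<alpha> * real (y j))))"

lemma finite_index_ties [simp]: "finite (index_ties p q x y)"
  by (rule finite_subset[of _ "({..<p} \<times> {..<q}) \<times> ({..<p} \<times> {..<q})"]) (auto simp: index_ties_def)

lemma index_ties_swap: "index_ties q p y x = (\<lambda>((i, j), (k, l)). ((l, k), (j, i))) ` index_ties p q x y"
proof
  show "index_ties q p y x \<subseteq> (\<lambda>((i, j), (k, l)). ((l, k), (j, i))) ` index_ties p q x y"
  proof
    fix t assume "t \<in> index_ties q p y x"
    then obtain i j k l where t: "t = ((i, j), (k, l))" "i < k" "k < q" "l < j" "j < p" "y i + x j = y k + x l"
      by (auto simp: index_ties_def)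
    hence "((l, k), (j, i)) \<in> index_ties p q x y" by (auto simp: index_ties_def)
    thus "t \<in> (\<lambda>((i, j), (k, l)). ((l, k), (j, i))) ` index_ties p q x y"
      by (rule rev_image_eqI) (simp add: t)
  qed
qed (auto simp: index_ties_def)

lemma tight_swap:
  assumes "tight p q x y"
  shows "tight q p y x"
proof -
  let ?f = "\<lambda>((i, j), (k, l)). ((l, k), (j, i)) :: (nat \<times> nat) \<times> (nat \<times> nat)"
  have inj: "inj_on ?f A" for A by (auto simp: inj_on_def)
  have val: "(\<lambda>(u, v). y (fst u) + x (snd u)) (?f t) = (\<lambda>(u, v). x (fst u) + y (snd u)) t"
    if "t \<in> index_ties p q x y" for t using that by (auto simp: index_ties_def)
  have i: "inj_on (\<lambda>(u, v). y (fst u) + x (snd u)) (index_ties q p y x)"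
  proof -
    have "inj_on ((\<lambda>(u, v). y (fst u) + x (snd u)) \<circ> ?f) (index_ties p q x y)"
      using assms val unfolding tight_def by (subst inj_on_cong) auto
    thus ?thesis unfolding index_ties_swap[where p = p and q = q and x = x and y = y] by (rule inj_on_imageI)
  qed
  have d: "\<exists>\<alpha>. (\<forall>i<q. P i = P 0 + \<alpha> * real (y i)) \<and> (\<forall>j<p. Q j = Q 0 + \<alpha> * real (x j))"
    if "\<forall>(u, v)\<in>index_ties q p y x. P (fst u) + Q (snd u) = P (fst v) + Q (snd v)" for P Q :: "nat \<Rightarrow> real"
  proof -
    have "\<forall>(u, v)\<in>index_ties p q x y. Q (fst u) + P (snd u) = Q (fst v) + P (snd v)"
      using that unfolding index_ties_swap[where p = p and q = q and x = x and y = y] by force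
    hence "\<exists>\<alpha>. (\<forall>i<p. Q i = Q 0 + \<alpha> * real (x i)) \<and> (\<forall>j<q. P j = P 0 + \<alpha> * real (y j))"
      using assms unfolding tight_def by blast
    thus ?thesis by blast
  qed
  have c: "card (index_ties q p y x) = q + p - 3"
    using assms card_image[OF inj, of "index_ties p q x y"] unfolding index_ties_swap[where p = p and q = q and x = x and y = y] tight_def by simp
  show ?thesis using assms i c d unfolding tight_def by blast
qed

lemma tight_base: "tight 2 2 (\<lambda>i. i) (\<lambda>j. j)"
proof -
  have t: "index_ties 2 2 (\<lambda>i. i) (\<lambda>j. j) = {((0, 1), (1, 0))}"
    by (auto simp: index_ties_def less_2_cases_iff)
  have "\<exists>\<alpha>. (\<forall>i<2. P i = P 0 + \<alpha> * real i) \<and> (\<forall>j<2. Q j = Q 0 + \<alpha> * real j)"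
    if "P 0 + Q 1 = P 1 + Q 0" for P Q :: "nat \<Rightarrow> real"
    using that by (intro exI[of _ "P 1 - P 0"]) (auto simp: less_2_cases_iff)
  thus ?thesis unfolding tight_def t by (auto simp: strict_mono_on_def)
qed

text \<open>Put \<open>X = x (p - 1)\<close> and \<open>Y = y (q - 1)\<close>. The new entry \<open>X + Y\<close> makes the smallest new box as heavy as
the heaviest old one, and every other new box heavier than all old ones. So exactly one tie is added, at a
weight at which there was none, and it expresses the new entry through the old ones.\<close>

lemma tight_step:
  assumes t: "tight p q x y"
  defines "x' \<equiv> x(p := x (p - 1) + y (q - 1))"
  shows "tight (Suc p) q x' y"
proof -
  have p: "2 \<le> p" "2 \<le> q" and z: "x 0 = 0" "y 0 = 0"
    and mx: "\<And>i k. i < k \<Longrightarrow> k < p \<Longrightarrow> x i < x k" and my: "\<And>i k. i < k \<Longrightarrow> k < q \<Longrightarrow> y i < y k"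
    using t by (auto simp: tight_def strict_mono_on_def)
  have ex: "x' i = x i" if "i < p" for i using that by (simp add: x'_def)
  have ep: "x' p = x (p - 1) + y (q - 1)" by (simp add: x'_def)
  have lx: "x i \<le> x (p - 1)" "i \<noteq> p - 1 \<Longrightarrow> x i < x (p - 1)" if "i < p" for i
    using mx[of i "p - 1"] p that by (cases "i = p - 1"; force)+
  have ly: "y i \<le> y (q - 1)" "i \<noteq> q - 1 \<Longrightarrow> y i < y (q - 1)" if "i < q" for i
    using my[of i "q - 1"] p that by (cases "i = q - 1"; force)+
  have yq: "0 < y (q - 1)" using my[of 0 "q - 1"] p z by simp
  let ?new = "((p - 1, q - 1), (p, 0 :: nat))"
  have tie: "index_ties (Suc p) q x' y = insert ?new (index_ties p q x y)"
  proof
    show "index_ties (Suc p) q x' y \<subseteq> insert ?new (index_ties p q x y)"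
    proof
      fix t assume "t \<in> index_ties (Suc p) q x' y"
      then obtain i j k l where t: "t = ((i, j), (k, l))" "i < k" "k < Suc p" "l < j" "j < q"
        "x' i + y j = x' k + y l" by (auto simp: index_ties_def)
      show "t \<in> insert ?new (index_ties p q x y)"
      proof (cases "k = p")
        case True
        hence i: "i < p" using t by simp
        have e: "x i + y j = x (p - 1) + y (q - 1) + y l" using t(6) True ep ex[OF i] by simp
        have "i = p - 1" using e lx[OF i] ly[OF t(5)] by fastforce
        moreover have "j = q - 1" using e lx[OF i] ly[OF t(5)] by fastforce
        moreover have "l = 0"
        proof (rule ccontr)
          assume "l \<noteq> 0"
          hence "0 < y l" using my[of 0 l] t z by simp
          thus False using e lx(1)[OF i] ly(1)[OF t(5)] by simp
        qed
        ultimately show ?thesis using t True by simp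
      next
        case False
        hence "k < p" "i < p" using t by auto
        hence "t \<in> index_ties p q x y" using t ex[of i] ex[of k] by (auto simp: index_ties_def)
        thus ?thesis by simp
      qed
    qed
    have "?new \<in> index_ties (Suc p) q x' y"
      using p z ex[of "p - 1"] ep by (auto simp: index_ties_def)
    moreover have "index_ties p q x y \<subseteq> index_ties (Suc p) q x' y"
      using ex by (auto simp: index_ties_def)
    ultimately show "insert ?new (index_ties p q x y) \<subseteq> index_ties (Suc p) q x' y" by blast
  qed
  have nin: "?new \<notin> index_ties p q x y" by (auto simp: index_ties_def)
  have val: "x' (fst u) + y (snd u) = x (fst u) + y (snd u)" if "(u, v) \<in> index_ties p q x y" for u v
    using that ex by (auto simp: index_ties_def)
  have lt: "x (fst u) + y (snd u) < x (p - 1) + y (q - 1)" if uv: "(u, v) \<in> index_ties p q x y" for u v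
  proof -
    obtain i j k l where u: "u = (i, j)" "v = (k, l)" "i < k" "k < p" "l < j" "j < q" using uv by (auto simp: index_ties_def)
    have "x i < x (p - 1)" using u by (intro lx(2)) auto
    thus ?thesis using ly(1)[of j] u by simp
  qed
  have inj: "inj_on (\<lambda>(u, v). x' (fst u) + y (snd u)) (index_ties (Suc p) q x' y)"
    unfolding tie inj_on_insert
  proof
    have "inj_on (\<lambda>(u, v). x (fst u) + y (snd u)) (index_ties p q x y)" using t by (simp add: tight_def)
    thus "inj_on (\<lambda>(u, v). x' (fst u) + y (snd u)) (index_ties p q x y)"
      using val by (subst inj_on_cong[where g = "\<lambda>(u, v). x (fst u) + y (snd u)"]) auto
    have "(\<lambda>(u, v). x' (fst u) + y (snd u)) ?new = x (p - 1) + y (q - 1)" using p ex[of "p - 1"] by simp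
    moreover have "(\<lambda>(u, v). x' (fst u) + y (snd u)) t < x (p - 1) + y (q - 1)" if "t \<in> index_ties p q x y" for t
      using val lt that by (cases t) auto
    ultimately show "(\<lambda>(u, v). x' (fst u) + y (snd u)) ?new
      \<notin> (\<lambda>(u, v). x' (fst u) + y (snd u)) ` (index_ties p q x y - {?new})" by force
  qed
  have card: "card (index_ties (Suc p) q x' y) = Suc p + q - 3"
    using t p nin by (simp add: tie tight_def)
  have det: "\<exists>\<alpha>. (\<forall>i<Suc p. P i = P 0 + \<alpha> * real (x' i)) \<and> (\<forall>j<q. Q j = Q 0 + \<alpha> * real (y j))"
    if h: "\<forall>(u, v)\<in>index_ties (Suc p) q x' y. P (fst u) + Q (snd u) = P (fst v) + Q (snd v)" for P Q :: "nat \<Rightarrow> real"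
  proof -
    have "\<forall>(u, v)\<in>index_ties p q x y. P (fst u) + Q (snd u) = P (fst v) + Q (snd v)" using h tie by blast
    then obtain \<alpha> where a: "\<forall>i<p. P i = P 0 + \<alpha> * real (x i)" "\<forall>j<q. Q j = Q 0 + \<alpha> * real (y j)"
      using t unfolding tight_def by blast
    have "P (p - 1) + Q (q - 1) = P p + Q 0" using h tie by auto
    moreover have "P (p - 1) = P 0 + \<alpha> * real (x (p - 1))" "Q (q - 1) = Q 0 + \<alpha> * real (y (q - 1))"
      using a(1)[rule_format, of "p - 1"] a(2)[rule_format, of "q - 1"] p by simp_all
    ultimately
    have Pp: "P p = P 0 + \<alpha> * real (x' p)" by (simp add: ep algebra_simps)
    show ?thesis
    proof (intro exI[of _ \<alpha>] conjI allI impI a(2)[rule_format])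
      fix i assume "i < Suc p"
      thus "P i = P 0 + \<alpha> * real (x' i)"
        using Pp a(1)[rule_format, of i] ex[of i] by (cases "i = p") simp_all
    qed
  qed
  have "strict_mono_on {..<Suc p} x'"
  proof (rule strict_mono_onI)
    fix i k assume "i \<in> {..<Suc p}" "k \<in> {..<Suc p}" "i < k"
    thus "x' i < x' k"
      using ex[of i] ex[of k] ep lx(1)[of i] yq mx[of i k] by (cases "k = p") auto
  qed
  moreover have "x' 0 = 0" using ex[of 0] p z by simp
  ultimately show ?thesis using inj card det p z t unfolding tight_def by auto
qed

text \<open>The set \<open>B\<close> contains the times at which \<open>y\<close> is extended. The state consists of the numbers of entries of
\<open>x\<close> and of \<open>y\<close>, followed by the entries.\<close>

fun grow_weights :: "nat set \<Rightarrow> nat \<Rightarrow> nat \<times> nat \<times> (nat \<Rightarrow> nat) \<times> (nat \<Rightarrow> nat)" where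
  "grow_weights B 0 = (2, 2, \<lambda>i. i, \<lambda>j. j)"
| "grow_weights B (Suc k) = (case grow_weights B k of (p, q, x, y) \<Rightarrow>
     if k \<in> B then (p, Suc q, x, y(q := x (p - 1) + y (q - 1)))
     else (Suc p, q, x(p := x (p - 1) + y (q - 1)), y))"

lemma tight_grow: "grow_weights B n = (p, q, x, y) \<Longrightarrow> tight p q x y"
proof (induction n arbitrary: p q x y)
  case 0
  thus ?case using tight_base by auto
next
  case (Suc n)
  obtain p0 q0 x0 y0 where g: "grow_weights B n = (p0, q0, x0, y0)" by (metis prod_cases4)
  have t: "tight p0 q0 x0 y0" using Suc.IH[OF g] .
  show ?case
  proof (cases "n \<in> B")
    case True
    have "tight p0 (Suc q0) x0 (y0(q0 := x0 (p0 - 1) + y0 (q0 - 1)))"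
      using tight_swap[OF tight_step[OF tight_swap[OF t]]] by (simp add: add.commute)
    thus ?thesis using Suc.prems True g by auto
  next
    case False
    thus ?thesis using Suc.prems g tight_step[OF t] by auto
  qed
qed

lemma grow_weights_size:
  assumes "grow_weights B n = (p, q, x, y)"
  shows "p = 2 + card ({..<n} - B)" "q = 2 + card ({..<n} \<inter> B)"
  using assms
proof (induction n arbitrary: p q x y)
  case (Suc n)
  obtain p0 q0 x0 y0 where g: "grow_weights B n = (p0, q0, x0, y0)" by (metis prod_cases4)
  {
    case 1
    show ?case using 1 Suc.IH(1)[OF g] g by (cases "n \<in> B") (auto simp: lessThan_Suc insert_Diff_if)
  next
    case 2
    show ?case using 2 Suc.IH(2)[OF g] g by (cases "n \<in> B") (auto simp: lessThan_Suc)
  }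
qed auto

definition top_weights :: "nat \<times> nat \<times> (nat \<Rightarrow> nat) \<times> (nat \<Rightarrow> nat) \<Rightarrow> nat \<times> nat" where
  "top_weights = (\<lambda>(p, q, x, y). (x (p - 1), y (q - 1)))"

lemma top_weights_rec: 
  "top_weights (grow_weights B 0) = (1, 1)"
  "top_weights (grow_weights B (Suc k)) = (case top_weights (grow_weights B k) of (X, Y) \<Rightarrow> if k \<in> B then (X, X + Y) else (X + Y, Y))"
  by (auto simp: top_weights_def split: prod.splits)

lemma top_weights_pos: "0 < fst (top_weights (grow_weights B n)) \<and> 0 < snd (top_weights (grow_weights B n))"
  by (induction n) (auto simp: top_weights_rec split: prod.splits simp del: grow_weights.simps)

text \<open>Extending \<open>x\<close> makes its largest entry exceed that of \<open>y\<close>, and conversely. So the ratio of the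
largest entries reveals the last step, and undoing that step gives the previous ratio.\<close>

lemma top_weights_inj:
  assumes "fst (top_weights (grow_weights B n)) * snd (top_weights (grow_weights B' n)) = fst (top_weights (grow_weights B' n)) * snd (top_weights (grow_weights B n))"
    and "k < n"
  shows "k \<in> B \<longleftrightarrow> k \<in> B'"
  using assms
proof (induction n)
  case (Suc n)
  obtain X Y where XY: "top_weights (grow_weights B n) = (X, Y)" by (metis surj_pair)
  obtain X' Y' where XY': "top_weights (grow_weights B' n) = (X', Y')" by (metis surj_pair)
  have pos: "0 < X" "0 < Y" "0 < X'" "0 < Y'"
    using top_weights_pos[of B n] top_weights_pos[of B' n] XY XY' by auto
  note h = Suc.prems(1)[unfolded top_weights_rec XY XY']
  have n: "n \<in> B \<longleftrightarrow> n \<in> B'"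
  proof (rule ccontr)
    assume "(n \<in> B) \<noteq> (n \<in> B')"
    then consider "n \<in> B" "n \<notin> B'" | "n \<notin> B" "n \<in> B'" by blast
    thus False
    proof cases
      case 1
      hence "X * Y' = (X' + Y') * (X + Y)" using h by simp
      thus False using pos by (simp add: algebra_simps)
    next
      case 2
      hence "(X + Y) * (X' + Y') = X' * Y" using h by simp
      thus False using pos by (simp add: algebra_simps)
    qed
  qed
  have "X * Y' = X' * Y"
    using h n by (cases "n \<in> B") (auto simp: algebra_simps)
  thus ?case using Suc n XY XY' by (cases "k = n") auto
qed simp

section \<open>The Kronecker cone and sets of boxes\<close>

definition pos :: "'i::{finite,linorder} \<Rightarrow> nat" where "pos i = card {j. j < i}"

lemma pos_less_iff [simp]: "pos i < pos j \<longleftrightarrow> i < (j :: 'i::{finite,linorder})"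
proof -
  have "pos i < pos j" if "i < j" for i j :: 'i
    unfolding pos_def using that by (intro psubset_card_mono) auto
  thus ?thesis by (metis less_asym not_less_iff_gr_or_eq)
qed

lemma pos_le_iff [simp]: "pos i \<le> pos j \<longleftrightarrow> i \<le> (j :: 'i::{finite,linorder})"
  by (meson leD leI pos_less_iff)

lemma pos_eq_iff [simp]: "pos i = pos j \<longleftrightarrow> i = (j :: 'i::{finite,linorder})"
  by (metis less_irrefl neq_iff pos_less_iff)

lemma bij_pos: "bij_betw (pos :: 'i::{finite,linorder} \<Rightarrow> nat) UNIV {..<CARD('i)}"
proof -
  have i: "inj (pos :: 'i \<Rightarrow> nat)" by (auto simp: inj_def)
  have "pos (i :: 'i) < CARD('i)" for i
    unfolding pos_def by (intro psubset_card_mono) auto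
  hence "range (pos :: 'i \<Rightarrow> nat) \<subseteq> {..<CARD('i)}" by auto
  hence "range (pos :: 'i \<Rightarrow> nat) = {..<CARD('i)}"
    by (intro card_subset_eq) (auto simp: card_image[OF i])
  thus ?thesis using i by (simp add: bij_betw_def)
qed

lemma pos_less_card [simp]: "pos (i :: 'i::{finite,linorder}) < CARD('i)"
  using bij_pos[where 'i = 'i] by (auto simp: bij_betw_def)

lemma pos_surj: "n < CARD('i::{finite,linorder}) \<Longrightarrow> \<exists>i :: 'i. pos i = n"
  using bij_pos[where 'i = 'i] by (auto simp: bij_betw_def) (metis imageE lessThan_iff)

lemma part_vec_nth: "part_vec lam $ i = real (lam (pos i))"
  by (simp add: part_vec_def pos_def)

text \<open>The vector of the partition \<open>1\<^sup>n\<close>, which adds one column of height \<open>n\<close>.\<close>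

definition omega :: "nat \<Rightarrow> (real, 'm::{finite,linorder}) vec" where
  "omega n = (\<chi> k. if pos k < n then 1 else 0)"

definition box_vec :: "'a::finite \<times> 'b::finite \<Rightarrow> (real, 'a) vec \<times> (real, 'b) vec" where
  "box_vec u = (axis (fst u) 1, axis (snd u) 1)"

text \<open>The contribution of a single column to a triple: its height, and the boxes that it selects counted by rows and
by columns.\<close>

definition column_point :: "('a::finite \<times> 'b::finite) set \<Rightarrow> (real, 'm::{finite,linorder}) vec \<times> (real, 'a) vec \<times> (real, 'b) vec" where
  "column_point A = (omega (card A), \<Sum>u\<in>A. box_vec u)"

lemma fst_box_vec_sum: "fst (\<Sum>u\<in>A. box_vec u) $ i = real (card {u \<in> A. fst u = i})"
proof -
  have "fst (\<Sum>u\<in>A. box_vec u) $ i = (\<Sum>u\<in>A. if fst u = i then 1 else 0)"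
    by (simp add: fst_sum box_vec_def axis_def sum_component if_distrib eq_commute cong: if_cong)
  also have "\<dots> = real (card {u \<in> A. fst u = i})"
    by (simp add: sum.If_cases Int_def)
  finally show ?thesis .
qed

lemma snd_box_vec_sum: "snd (\<Sum>u\<in>A. box_vec u) $ i = real (card {u \<in> A. snd u = i})"
proof -
  have "snd (\<Sum>u\<in>A. box_vec u) $ i = (\<Sum>u\<in>A. if snd u = i then 1 else 0)"
    by (simp add: snd_sum box_vec_def axis_def sum_component if_distrib eq_commute cong: if_cong)
  also have "\<dots> = real (card {u \<in> A. snd u = i})"
    by (simp add: sum.If_cases Int_def)
  finally show ?thesis .
qed

lemma convex_cone_sum:
  assumes "convex_cone S" "\<And>i. i \<in> I \<Longrightarrow> f i \<in> S"
  shows "(\<Sum>i\<in>I. f i) \<in> S"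
  using assms(2) 
  by (induction I rule: infinite_finite_induct)
     (auto simp: convex_cone_contains_0[OF assms(1)] intro: convex_cone_add[OF assms(1)])

lemma partition_support:
  assumes "is_partition \<mu>" "\<mu> i \<noteq> 0"
  shows "i < plength \<mu>"
proof -
  have "{i. \<mu> i \<noteq> 0} = {..<card {i. \<mu> i \<noteq> 0}}"
  proof (rule down_set_eq_lessThan)
    show "finite {i. \<mu> i \<noteq> 0}" using assms by (simp add: is_partition_def)
    fix i j assume "i \<in> {i. \<mu> i \<noteq> 0}" "j \<le> i"
    moreover have "\<mu> i \<le> \<mu> j" using assms(1) \<open>j \<le> i\<close> by (simp add: is_partition_def antimono_def)
    ultimately show "j \<in> {i. \<mu> i \<noteq> 0}" by auto
  qed
  moreover have "i \<in> {i. \<mu> i \<noteq> 0}" using assms by simp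
  ultimately show ?thesis unfolding plength_def by auto
qed

lemma column_height:
  assumes "is_partition lam"
  shows "r < card {i. j < lam i} \<longleftrightarrow> j < lam r"
proof -
  have "{i. j < lam i} = {..<card {i. j < lam i}}"
  proof (rule down_set_eq_lessThan)
    show "finite {i. j < lam i}"
      by (rule finite_subset[of _ "{i. lam i \<noteq> 0}"]) (use assms in \<open>auto simp: is_partition_def\<close>)
    fix i k assume "i \<in> {i. j < lam i}" "k \<le> i"
    moreover have "lam i \<le> lam k" using assms \<open>k \<le> i\<close> by (simp add: is_partition_def antimono_def)
    ultimately show "k \<in> {i. j < lam i}" by simp
  qed
  hence "r \<in> {i. j < lam i} \<longleftrightarrow> r \<in> {..<card {i. j < lam i}}" by simp
  thus ?thesis by simp
qed

text \<open>A triple with nonzero Kronecker coefficient is the sum of the points of its column sets.\<close>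

theorem PKron_subset_column_cone:
  "(PKron :: ((real, 'm::{finite,linorder}) vec \<times> (real, 'a::{finite,linorder}) vec \<times> (real, 'b::{finite,linorder}) vec) set)
     \<subseteq> convex_cone hull (range column_point)"
  unfolding PKron_def
proof (rule hull_minimal)
  let ?C = "convex_cone hull (range column_point) :: ((real, 'm) vec \<times> (real, 'a) vec \<times> (real, 'b) vec) set"
  show C: "convex_cone ?C" by (rule convex_cone_convex_cone_hull)
  show "{(part_vec lam, part_vec \<mu>, part_vec \<nu>) | lam \<mu> \<nu>.
        is_partition lam \<and> is_partition \<mu> \<and> is_partition \<nu> \<and>
        plength lam \<le> CARD('m) \<and> plength \<mu> \<le> CARD('a) \<and> plength \<nu> \<le> CARD('b) \<and>
        kronecker lam \<mu> \<nu> \<noteq> 0} \<subseteq> ?C"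
  proof
    fix z assume "z \<in> {(part_vec lam :: (real, 'm) vec, part_vec \<mu> :: (real, 'a) vec, part_vec \<nu> :: (real, 'b) vec) |
        lam \<mu> \<nu>. is_partition lam \<and> is_partition \<mu> \<and> is_partition \<nu> \<and>
        plength lam \<le> CARD('m) \<and> plength \<mu> \<le> CARD('a) \<and> plength \<nu> \<le> CARD('b) \<and>
        kronecker lam \<mu> \<nu> \<noteq> 0}"
    then obtain lam \<mu> \<nu> where z: "z = (part_vec lam, part_vec \<mu>, part_vec \<nu>)"
      and P: "is_partition lam" "is_partition \<mu>" "is_partition \<nu>"
      and len: "plength lam \<le> CARD('m)" "plength \<mu> \<le> CARD('a)" "plength \<nu> \<le> CARD('b)"
      and k: "kronecker lam \<mu> \<nu> \<noteq> 0" by blast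
    obtain A where fin: "\<And>j. finite (A j)" and cA: "\<And>j. card (A j) = card {i. j < lam i}"
      and mu: "\<And>i. \<mu> i = (\<Sum>j<lam 0. card {p \<in> A j. fst p = i})"
      and nu: "\<And>i. \<nu> i = (\<Sum>j<lam 0. card {p \<in> A j. snd p = i})"
      by (rule kronecker_column_sets[OF P k]) blast
    let ?e = "\<lambda>u::'a \<times> 'b. (pos (fst u), pos (snd u))"
    have inj: "inj_on ?e S" for S by (auto simp: inj_on_def prod_eq_iff)
    define A' where "A' = (\<lambda>j. {u. ?e u \<in> A j})"
    have im: "?e ` A' j = A j" if j: "j < lam 0" for j
    proof
      show "?e ` A' j \<subseteq> A j" by (auto simp: A'_def)
      show "A j \<subseteq> ?e ` A' j"
      proof
        fix p assume p: "p \<in> A j"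
        have "card {p' \<in> A j. fst p' = fst p} > 0" using p fin[of j] unfolding card_gt_0_iff by (intro conjI) (blast, simp)
        hence "\<mu> (fst p) \<noteq> 0" unfolding mu using j by auto
        hence "fst p < CARD('a)" using partition_support[OF P(2)] len by fastforce
        then obtain i :: 'a where i: "pos i = fst p" using pos_surj by blast
        have "card {p' \<in> A j. snd p' = snd p} > 0" using p fin[of j] unfolding card_gt_0_iff by (intro conjI) (blast, simp)
        hence "\<nu> (snd p) \<noteq> 0" unfolding nu using j by auto
        hence "snd p < CARD('b)" using partition_support[OF P(3)] len by fastforce
        then obtain i' :: 'b where i': "pos i' = snd p" using pos_surj by blast
        have "p = ?e (i, i')" using i i' by simp
        moreover have "(i, i') \<in> A' j" using i i' p by (simp add: A'_def)
        ultimately show "p \<in> ?e ` A' j" by blast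
      qed
    qed
    have card': "card (A' j) = card {i. j < lam i}" if "j < lam 0" for j
      using card_image[OF inj, of "A' j"] im[OF that] cA by simp
    have f: "card {u \<in> A' j. fst u = i} = card {p \<in> A j. fst p = pos i}" if "j < lam 0" for j i
    proof -
      have "?e ` {u \<in> A' j. fst u = i} = {p \<in> ?e ` A' j. fst p = pos i}" by auto
      hence "?e ` {u \<in> A' j. fst u = i} = {p \<in> A j. fst p = pos i}" unfolding im[OF that] .
      thus ?thesis using card_image[OF inj, of "{u \<in> A' j. fst u = i}"] by simp
    qed
    have s: "card {u \<in> A' j. snd u = i} = card {p \<in> A j. snd p = pos i}" if "j < lam 0" for j i
    proof -
      have "?e ` {u \<in> A' j. snd u = i} = {p \<in> ?e ` A' j. snd p = pos i}" by auto
      hence "?e ` {u \<in> A' j. snd u = i} = {p \<in> A j. snd p = pos i}" unfolding im[OF that] .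
      thus ?thesis using card_image[OF inj, of "{u \<in> A' j. snd u = i}"] by simp
    qed
    have 1: "part_vec lam = (\<Sum>j<lam 0. omega (card (A' j)) :: (real, 'm) vec)"
      unfolding vec_eq_iff
    proof
      fix k :: 'm
      have "(\<Sum>j<lam 0. omega (card (A' j)) :: (real, 'm) vec) $ k = (\<Sum>j<lam 0. if j < lam (pos k) then 1 else 0)"
        unfolding sum_component by (intro sum.cong) (auto simp: omega_def card' column_height[OF P(1)])
      also have "\<dots> = real (card ({..<lam 0} \<inter> {j. j < lam (pos k)}))"
        by (simp add: sum.If_cases)
      also have "{..<lam 0} \<inter> {j. j < lam (pos k)} = {..<lam (pos k)}"
      proof -
        have "lam (pos k) \<le> lam 0" using P(1) by (simp add: is_partition_def antimono_def)
        thus ?thesis by auto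
      qed
      finally show "part_vec lam $ k = (\<Sum>j<lam 0. omega (card (A' j)) :: (real, 'm) vec) $ k"
        by (simp add: part_vec_nth)
    qed
    have 2: "part_vec \<mu> = fst (\<Sum>j<lam 0. \<Sum>u\<in>A' j. box_vec u)"
      unfolding vec_eq_iff fst_sum[of _ "{..<lam 0}"] sum_component fst_box_vec_sum part_vec_nth
      by (simp add: f mu)
    have 3: "part_vec \<nu> = snd (\<Sum>j<lam 0. \<Sum>u\<in>A' j. box_vec u)"
      unfolding vec_eq_iff snd_sum[of _ "{..<lam 0}"] sum_component snd_box_vec_sum part_vec_nth
      by (simp add: s nu)
    have "(part_vec lam, part_vec \<mu>, part_vec \<nu>) = (\<Sum>j<lam 0. column_point (A' j) :: (real, 'm) vec \<times> (real, 'a) vec \<times> (real, 'b) vec)"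
      unfolding prod_eq_iff by (simp add: column_point_def fst_sum snd_sum 1 2 3)
    also have "\<dots> \<in> ?C" by (intro convex_cone_sum[OF C] hull_inc) auto
    finally show "z \<in> ?C" unfolding z .
  qed
qed

definition young_set :: "('a::linorder \<times> 'b::linorder) set \<Rightarrow> bool" where
  "young_set A \<longleftrightarrow> (\<forall>i j k l. (i, j) \<in> A \<longrightarrow> k \<le> i \<longrightarrow> l \<le> j \<longrightarrow> (k, l) \<in> A)"

lemma diagram_young_set:
  fixes D :: "(nat \<times> nat) set"
  assumes fin: "finite D" and y: "young_set D"
  defines "\<rho> \<equiv> \<lambda>i. card {j. (i, j) \<in> D}"
  shows "is_partition \<rho>" "diagram \<rho> = D" "psize \<rho> = card D"
    "(\<forall>p\<in>D. fst p < n) \<Longrightarrow> plength \<rho> \<le> n"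
proof -
  have fj: "finite {j. (i, j) \<in> D}" for i
    by (rule finite_subset[of _ "snd ` D"]) (use fin in force)+
  have row: "{j. (i, j) \<in> D} = {..<\<rho> i}" for i
    unfolding \<rho>_def by (rule down_set_eq_lessThan[OF fj]) (use y in \<open>auto simp: young_set_def\<close>)
  have iff: "j < \<rho> i \<longleftrightarrow> (i, j) \<in> D" for i j using row[of i] by auto
  have supp: "{i. \<rho> i \<noteq> 0} \<subseteq> fst ` D"
  proof
    fix i assume "i \<in> {i. \<rho> i \<noteq> 0}"
    hence "(i, 0) \<in> D" using iff[of 0 i] by simp
    thus "i \<in> fst ` D" by force
  qed
  show P: "is_partition \<rho>" unfolding is_partition_def
  proof
    show "antimono \<rho>"
    proof (rule antimonoI)
      fix i k :: nat assume "i \<le> k"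
      thus "\<rho> k \<le> \<rho> i" unfolding \<rho>_def using y by (intro card_mono fj) (auto simp: young_set_def)
    qed
    show "finite {i. \<rho> i \<noteq> 0}" using supp fin by (meson finite_imageI finite_subset)
  qed
  show d: "diagram \<rho> = D" by (auto simp: diagram_def iff)
  show "psize \<rho> = card D" using card_diagram[OF P] d by simp
  assume "\<forall>p\<in>D. fst p < n"
  hence "{i. \<rho> i \<noteq> 0} \<subseteq> {..<n}" using supp by auto
  from card_mono[OF _ this] show "plength \<rho> \<le> n" by (simp add: plength_def)
qed

lemma plength_one_col: "plength (one_col n) = n"
proof -
  have "{i. one_col n i \<noteq> 0} = {..<n}" by (auto simp: one_col_def)
  thus ?thesis by (simp add: plength_def)
qed

lemma plength_one_row: "plength (one_row n) \<le> 1"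
proof -
  have "{i. one_row n i \<noteq> 0} \<subseteq> {0}" by (auto simp: one_row_def)
  from card_mono[OF _ this] show ?thesis by (simp add: plength_def)
qed

lemma part_vec_one_col: "part_vec (one_col n) = omega n"
  by (simp add: vec_eq_iff part_vec_nth omega_def one_col_def)

lemma PKron_generator:
  assumes "is_partition lam" "is_partition \<mu>" "is_partition \<nu>"
    "plength lam \<le> CARD('m)" "plength \<mu> \<le> CARD('a)" "plength \<nu> \<le> CARD('b)" "kronecker lam \<mu> \<nu> \<noteq> 0"
  shows "(part_vec lam, part_vec \<mu>, part_vec \<nu>) \<in>
    (PKron :: ((real, 'm::{finite,linorder}) vec \<times> (real, 'a::{finite,linorder}) vec \<times> (real, 'b::{finite,linorder}) vec) set)"
  unfolding PKron_def by (rule hull_inc) (use assms in blast)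

text \<open>The row and column counts of a Young diagram are conjugate partitions.\<close>

theorem young_set_in_PKron:
  fixes A :: "('a::{finite,linorder} \<times> 'b::{finite,linorder}) set"
  assumes y: "young_set A" and m: "CARD('m::{finite,linorder}) = CARD('a) * CARD('b)"
  shows "(column_point A :: (real, 'm) vec \<times> (real, 'a) vec \<times> (real, 'b) vec) \<in> PKron"
proof -
  let ?e = "\<lambda>u::'a \<times> 'b. (pos (fst u), pos (snd u))"
  have inj: "inj_on ?e S" for S by (auto simp: inj_on_def prod_eq_iff)
  define D where "D = ?e ` A"
  have fin: "finite D" by (simp add: D_def)
  have yD: "young_set D"
    unfolding young_set_def
  proof (intro allI impI)
    fix i j k l assume "(i, j) \<in> D" and kl: "k \<le> i" "l \<le> j"
    then obtain u where u: "u \<in> A" "i = pos (fst u)" "j = pos (snd u)" by (auto simp: D_def)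
    have "k < CARD('a)" "l < CARD('b)" using kl u pos_less_card le_less_trans by metis+
    then obtain k' :: 'a and l' :: 'b where k': "pos k' = k" "pos l' = l" using pos_surj by metis
    have "k' \<le> fst u" "l' \<le> snd u" using kl u k' by (metis pos_le_iff)+
    hence "(k', l') \<in> A" using y u(1) unfolding young_set_def by (metis prod.collapse)
    thus "(k, l) \<in> D" unfolding D_def using k' by force
  qed
  define D' where "D' = prod.swap ` D"
  have fin': "finite D'" by (simp add: D'_def fin)
  have mem': "(j, i) \<in> D' \<longleftrightarrow> (i, j) \<in> D" for i j by (force simp: D'_def)
  have yD': "young_set D'" using yD unfolding young_set_def mem' by blast
  define \<mu> where "\<mu> = (\<lambda>i. card {j. (i, j) \<in> D})"
  define \<nu> where "\<nu> = (\<lambda>i. card {j. (i, j) \<in> D'})"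
  note M = diagram_young_set[OF fin yD, folded \<mu>_def]
  note N = diagram_young_set[OF fin' yD', folded \<nu>_def]
  have cD: "card D = card A" by (simp add: D_def card_image[OF inj])
  have cD': "card D' = card A" by (simp add: D'_def card_image cD)
  have dM: "diagram \<mu> = prod.swap ` diagram \<nu>" by (simp add: M N D'_def image_image)
  have k: "kronecker (one_col (card A)) \<mu> \<nu> \<noteq> 0"
    by (rule kronecker_one_col[OF _ _ dM]) (simp_all add: Parts_def M N cD cD')
  have "card A \<le> CARD('a \<times> 'b)" by (rule card_mono) auto
  hence l: "plength (one_col (card A)) \<le> CARD('m)" by (simp add: plength_one_col m)
  have lM: "plength \<mu> \<le> CARD('a)" by (rule M(4)) (auto simp: D_def)
  have lN: "plength \<nu> \<le> CARD('b)" by (rule N(4)) (auto simp: D_def D'_def)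
  have "(part_vec (one_col (card A)), part_vec \<mu>, part_vec \<nu>) \<in> (PKron :: ((real, 'm) vec \<times> (real, 'a) vec \<times> (real, 'b) vec) set)"
    by (rule PKron_generator[OF one_col_partition(1) M(1) N(1) l lM lN k])
  moreover have "part_vec \<mu> = fst (\<Sum>u\<in>A. box_vec u)"
    unfolding vec_eq_iff fst_box_vec_sum part_vec_nth
  proof
    fix i :: 'a
    have "{j. (pos i, j) \<in> D} = (\<lambda>u. pos (snd u)) ` {u \<in> A. fst u = i}"
      by (force simp: D_def)
    moreover have "inj_on (\<lambda>u. pos (snd u)) {u \<in> A. fst u = i}" by (auto simp: inj_on_def prod_eq_iff)
    ultimately show "real (\<mu> (pos i)) = real (card {u \<in> A. fst u = i})" by (simp add: \<mu>_def card_image)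
  qed
  moreover have "part_vec \<nu> = snd (\<Sum>u\<in>A. box_vec u)"
    unfolding vec_eq_iff snd_box_vec_sum part_vec_nth
  proof
    fix i :: 'b
    have "{j. (pos i, j) \<in> D'} = (\<lambda>u. pos (fst u)) ` {u \<in> A. snd u = i}"
      unfolding mem' by (force simp: D_def)
    moreover have "inj_on (\<lambda>u. pos (fst u)) {u \<in> A. snd u = i}" by (auto simp: inj_on_def prod_eq_iff)
    ultimately show "real (\<nu> (pos i)) = real (card {u \<in> A. snd u = i})" by (simp add: \<nu>_def card_image)
  qed
  ultimately show ?thesis by (simp add: column_point_def part_vec_one_col)
qed

lemma extra_point_in_PKron:
  assumes "2 \<le> CARD('a)" "2 \<le> CARD('b)"
  shows "(part_vec (one_row 2), omega 2, omega 2) \<in>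
    (PKron :: ((real, 'm::{finite,linorder}) vec \<times> (real, 'a::{finite,linorder}) vec \<times> (real, 'b::{finite,linorder}) vec) set)"
proof -
  have "0 < CARD('m)" by simp
  hence l: "plength (one_row 2) \<le> CARD('m)" using plength_one_row[of 2] by linarith
  have "one_col 2 \<in> Parts 2" by (simp add: Parts_def one_col_partition)
  hence "kronecker (one_row 2) (one_col 2) (one_col 2) \<noteq> 0" by (rule kronecker_one_row)
  from PKron_generator[OF one_row_partition(1) one_col_partition(1) one_col_partition(1) l _ _ this]
  show ?thesis using assms by (simp add: plength_one_col part_vec_one_col)
qed

section \<open>The face cut out by weights\<close>

definition boxsum :: "('a \<Rightarrow> nat) \<Rightarrow> ('b \<Rightarrow> nat) \<Rightarrow> 'a \<times> 'b \<Rightarrow> nat" where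
  "boxsum x y u = x (fst u) + y (snd u)"

definition box_ties :: "('a::linorder \<Rightarrow> nat) \<Rightarrow> ('b::linorder \<Rightarrow> nat) \<Rightarrow> (('a \<times> 'b) \<times> ('a \<times> 'b)) set" where
  "box_ties x y = {(u, v). fst u < fst v \<and> snd v < snd u \<and> boxsum x y u = boxsum x y v}"

text \<open>The position of \<open>T u\<close> is the number of elements with smaller key.\<close>

lemma order_tableau_exists:
  fixes key :: "'c::finite \<Rightarrow> nat"
  assumes inj: "inj key" and card: "CARD('m::{finite,linorder}) = CARD('c)"
  shows "\<exists>T :: 'c \<Rightarrow> 'm. bij T \<and> (\<forall>u v. T u < T v \<longleftrightarrow> key u < key v)"
proof -
  define r where "r = (\<lambda>u. card {v. key v < key u})"
  have mono: "r u < r v" if "key u < key v" for u v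
    unfolding r_def using that by (intro psubset_card_mono) auto
  have iff: "r u < r v \<longleftrightarrow> key u < key v" for u v
    using mono[of u v] mono[of v u] inj by (metis inj_eq less_asym nat_neq_iff)
  have lt: "r u < CARD('m)" for u
    unfolding r_def card by (intro psubset_card_mono) auto
  define T where "T = (\<lambda>u. SOME k :: 'm. pos k = r u)"
  have T: "pos (T u) = r u" for u
    unfolding T_def using someI_ex[OF pos_surj[OF lt[of u]]] .
  have lessT: "T u < T v \<longleftrightarrow> key u < key v" for u v
    using iff[of u v] T by (metis pos_less_iff)
  have "inj T" using inj lessT by (metis injI inj_eq less_irrefl nat_neq_iff)
  moreover have "range T = UNIV"
    by (intro card_subset_eq) (auto simp: card_image[OF \<open>inj T\<close>] card)
  ultimately show ?thesis using lessT by (auto simp: bij_def)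
qed

text \<open>Ties are broken by the column: \<open>T\<close> sorts the boxes lexicographically by weight and column, both packed into
one integer, which is again a sum of a term for the row and a term for the column. This makes \<open>T\<close> additive.\<close>

locale tie_facet =
  fixes x :: "'a::{finite,linorder} \<Rightarrow> nat" and y :: "'b::{finite,linorder} \<Rightarrow> nat"
    and T :: "'a \<times> 'b \<Rightarrow> 'm::{finite,linorder}"
  assumes card_m: "CARD('m) = CARD('a) * CARD('b)"
    and two: "2 \<le> CARD('a)" "2 \<le> CARD('b)"
    and mono_x: "strict_mono x" and mono_y: "strict_mono y"
    and card_box_ties: "card (box_ties x y) = CARD('a) + CARD('b) - 3"
    and inj_box_ties: "inj_on (\<lambda>(u, v). boxsum x y u) (box_ties x y)"
    and det: "\<And>P Q :: _ \<Rightarrow> real. (\<And>u v. (u, v) \<in> box_ties x y \<Longrightarrow> P (fst u) + Q (snd u) = P (fst v) + Q (snd v))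
        \<Longrightarrow> \<exists>\<alpha> c d. (\<forall>i. P i = c + \<alpha> * real (x i)) \<and> (\<forall>j. Q j = d + \<alpha> * real (y j))"
    and bij_T: "bij T"
    and T_less: "\<And>u v. T u < T v \<longleftrightarrow> CARD('b) * boxsum x y u + pos (snd u) < CARD('b) * boxsum x y v + pos (snd v)"
begin

abbreviation "s \<equiv> boxsum x y"
abbreviation "tied \<equiv> box_ties x y"

lemma inv_T [simp]: "inv T (T u) = u" "T (inv T k) = k"
  using bij_T by (auto simp: bij_def surj_f_inv_f)

lemma T_eq_iff [simp]: "T u = T v \<longleftrightarrow> u = v"
  using bij_T by (simp add: bij_def inj_eq)

lemma x_less: "i < k \<longleftrightarrow> x i < x k"
  using mono_x by (simp add: strict_mono_less)
lemma y_less: "i < k \<longleftrightarrow> y i < y k"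
  using mono_y by (simp add: strict_mono_less)

lemma s_less: "s u < s v \<Longrightarrow> T u < T v"
proof -
  assume "s u < s v"
  hence "CARD('b) * Suc (s u) \<le> CARD('b) * s v" by (intro mult_le_mono2) simp
  moreover have "pos (snd u) < CARD('b)" by simp
  ultimately have "CARD('b) * s u + pos (snd u) < CARD('b) * s v" unfolding mult_Suc_right by linarith
  thus ?thesis unfolding T_less by linarith
qed

lemma T_less_s: "T u \<le> T v \<Longrightarrow> s u \<le> s v"
  using s_less[of v u] by fastforce

lemma tied_iff: "(u, v) \<in> tied \<longleftrightarrow> s u = s v \<and> T v < T u"
proof
  assume "(u, v) \<in> tied"
  thus "s u = s v \<and> T v < T u" by (auto simp: box_ties_def T_less)
next
  assume a: "s u = s v \<and> T v < T u"
  hence "s u = s v" "CARD('b) * s v + pos (snd v) < CARD('b) * s u + pos (snd u)"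
    unfolding T_less by blast+
  hence "pos (snd v) < pos (snd u)" by (simp del: pos_less_iff)
  hence "snd v < snd u" by simp
  moreover from this have "y (snd v) < y (snd u)" using y_less by blast
  hence "x (fst u) < x (fst v)" using a by (simp add: boxsum_def)
  hence "fst u < fst v" using x_less by blast
  ultimately show "(u, v) \<in> tied" using a by (simp add: box_ties_def)
qed

lemma tied_of_eq: "s u = s v \<Longrightarrow> u \<noteq> v \<Longrightarrow> (u, v) \<in> tied \<or> (v, u) \<in> tied"
  unfolding tied_iff by (metis T_eq_iff neq_iff)

lemma tied_unique: "(u, v) \<in> tied \<Longrightarrow> (u', v') \<in> tied \<Longrightarrow> s u = s u' \<Longrightarrow> u = u' \<and> v = v'"
  using inj_onD[OF inj_box_ties, of "(u, v)" "(u', v')"] by simp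

lemma no_triple: "s u = s v \<Longrightarrow> s u = s w \<Longrightarrow> u \<noteq> v \<Longrightarrow> u \<noteq> w \<Longrightarrow> v = w"
  by (metis tied_of_eq tied_unique)

lemma standard_T: "standard_tableau T"
  unfolding standard_tableau_def
proof (intro conjI allI bij_T)
  fix j show "strict_mono (\<lambda>i. T (i, j))"
    by (rule strict_monoI, rule s_less) (use x_less in \<open>simp add: boxsum_def\<close>)
next
  fix i show "strict_mono (\<lambda>j. T (i, j))"
    by (rule strict_monoI, rule s_less) (use y_less in \<open>simp add: boxsum_def\<close>)
qed

lemma additive_T: "additive_tableau T"
  unfolding additive_tableau_def
proof (intro conjI standard_T exI allI)
  let ?X = "\<lambda>i. real (CARD('b) * x i)" and ?Y = "\<lambda>j. real (CARD('b) * y j + pos j)"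
  show "strict_mono ?X"
    by (rule strict_monoI) (use x_less in simp)
  show "strict_mono ?Y"
  proof (rule strict_monoI)
    fix j l :: 'b assume j: "j < l"
    hence "y j < y l" "pos j < pos l" using y_less by auto
    hence "CARD('b) * y j \<le> CARD('b) * y l" by (intro mult_le_mono2) simp
    with \<open>pos j < pos l\<close> have "CARD('b) * y j + pos j < CARD('b) * y l + pos l" by linarith
    thus "?Y j < ?Y l" by (simp only: of_nat_less_iff)
  qed
  fix i j k l
  have "?X i + ?Y j < ?X k + ?Y l \<longleftrightarrow> CARD('b) * x i + (CARD('b) * y j + pos j) < CARD('b) * x k + (CARD('b) * y l + pos l)"
    by (simp only: of_nat_add[symmetric] of_nat_less_iff)
  thus "T (i, j) < T (k, l) \<longleftrightarrow> ?X i + ?Y j < ?X k + ?Y l"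
    by (simp only: T_less boxsum_def fst_conv snd_conv distrib_left add.assoc)
qed

lemma gvec_T: "gvec T (T u) = box_vec u"
  by (simp add: gvec_def box_vec_def split: prod.splits)

text \<open>The boxes with the first \<open>n\<close> labels.\<close>

definition init :: "nat \<Rightarrow> ('a \<times> 'b) set" where "init n = {u. pos (T u) < n}"

lemma card_init: "n \<le> CARD('m) \<Longrightarrow> card (init n) = n"
proof -
  assume n: "n \<le> CARD('m)"
  have "(\<lambda>u. pos (T u)) ` init n = {..<n}"
  proof
    show "{..<n} \<subseteq> (\<lambda>u. pos (T u)) ` init n"
    proof
      fix i assume "i \<in> {..<n}"
      then obtain k :: 'm where "pos k = i" using pos_surj[where 'i = 'm, of i] n by auto
      thus "i \<in> (\<lambda>u. pos (T u)) ` init n" using \<open>i \<in> {..<n}\<close>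
        by (intro image_eqI[of _ _ "inv T k"]) (auto simp: init_def)
    qed
  qed (auto simp: init_def)
  moreover have "inj_on (\<lambda>u. pos (T u)) (init n)" by (auto simp: inj_on_def)
  ultimately show ?thesis by (metis card_image card_lessThan)
qed

lemma card_le_m: "card (A :: ('a \<times> 'b) set) \<le> CARD('m)"
proof -
  have "card A \<le> CARD('a \<times> 'b)" by (rule card_mono) auto
  thus ?thesis by (simp add: card_m)
qed

text \<open>The linear forms that vanish on the additive face of \<open>T\<close>; the first component is determined by the other
two.\<close>

definition graph_functional :: "(real, 'a) vec \<Rightarrow> (real, 'b) vec \<Rightarrow> (real, 'm) vec \<times> (real, 'a) vec \<times> (real, 'b) vec" where
  "graph_functional P Q = (- (\<chi> k. P $ fst (inv T k) + Q $ snd (inv T k)), P, Q)"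

lemma inner_box_vec: "(P, Q) \<bullet> box_vec u = P $ fst u + Q $ snd u"
  by (simp add: box_vec_def inner_axis)

lemma inner_omega: "(\<chi> k. f (inv T k)) \<bullet> omega n = (\<Sum>u\<in>init n. f u)"
proof -
  have "(\<chi> k. f (inv T k)) \<bullet> omega n = (\<Sum>k\<in>UNIV. if pos k < n then f (inv T k) else 0)"
    by (simp add: inner_vec_def omega_def if_distrib cong: if_cong)
  also have "\<dots> = (\<Sum>u\<in>UNIV. if pos (T u) < n then f u else 0)"
    using sum.reindex_bij_betw[OF bij_T, of "\<lambda>k. if pos k < n then f (inv T k) else 0"]
    unfolding inv_T by (rule sym)
  also have "\<dots> = (\<Sum>u\<in>init n. f u)"
    by (simp add: sum.If_cases init_def)
  finally show ?thesis .
qed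

lemma graph_functional_column_point:
  "graph_functional P Q \<bullet> column_point A = (\<Sum>u\<in>A. P $ fst u + Q $ snd u) - (\<Sum>u\<in>init (card A). P $ fst u + Q $ snd u)"
proof -
  have "graph_functional P Q \<bullet> column_point A = (P, Q) \<bullet> (\<Sum>u\<in>A. box_vec u)
      - (\<chi> k. P $ fst (inv T k) + Q $ snd (inv T k)) \<bullet> omega (card A)"
    by (simp add: graph_functional_def column_point_def inner_prod_def)
  thus ?thesis
    unfolding inner_omega[of "\<lambda>u. P $ fst u + Q $ snd u"] inner_sum_right inner_box_vec .
qed

definition xv :: "(real, 'a) vec" where "xv = (\<chi> i. real (x i))"
definition yv :: "(real, 'b) vec" where "yv = (\<chi> j. real (y j))"
text \<open>The form \<open>x \<bullet> \<mu> + y \<bullet> \<nu> - s \<bullet> \<lambda>\<close> that cuts out the face.\<close>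

definition normal where "normal = graph_functional xv yv"

lemma normal_column_point: "normal \<bullet> column_point A = (\<Sum>u\<in>A. real (s u)) - (\<Sum>u\<in>init (card A). real (s u))"
  by (simp add: normal_def graph_functional_column_point xv_def yv_def boxsum_def)

lemma sum_diff_exchange:
  fixes f :: "_ \<Rightarrow> 'z::ab_group_add"
  assumes "finite A" "finite B"
  shows "sum f A - sum f B = sum f (A - B) - sum f (B - A)"
  using sum.Int_Diff[OF assms(1), of f B] sum.Int_Diff[OF assms(2), of f A]
  by (simp add: Int_commute)

text \<open>The first boxes in the order of \<open>T\<close> have minimal total weight among sets of the same size. In case of
equality all exchanged boxes have the same weight, and as at most two boxes share a weight, at most one pair
has been exchanged.\<close>

lemma minimal_sum:
  fixes A :: "('a \<times> 'b) set"
  defines "I \<equiv> init (card A)"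
  shows "0 \<le> normal \<bullet> column_point A"
    and "normal \<bullet> column_point A = 0 \<Longrightarrow> A = I \<or> (\<exists>(u, v)\<in>tied. A - I = {u} \<and> I - A = {v})"
proof -
  let ?D = "A - I" and ?E = "I - A"
  have cI: "card I = card A" unfolding I_def by (rule card_init[OF card_le_m])
  have c: "card ?D = card ?E"
    using cI card_Diff_subset_Int[of A I] card_Diff_subset_Int[of I A] by (simp add: Int_commute)
  have e: "normal \<bullet> column_point A = (\<Sum>u\<in>?D. real (s u)) - (\<Sum>u\<in>?E. real (s u))"
    unfolding normal_column_point I_def[symmetric] by (rule sum_diff_exchange) auto
  have lt: "T v < T u" if "u \<in> ?D" "v \<in> ?E" for u v
  proof -
    have "pos (T v) < pos (T u)" using that by (auto simp: I_def init_def simp del: pos_less_iff)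
    thus ?thesis by simp
  qed
  have "0 \<le> normal \<bullet> column_point A \<and> (normal \<bullet> column_point A = 0 \<longrightarrow> A = I \<or> (\<exists>(u, v)\<in>tied. A - I = {u} \<and> I - A = {v}))"
  proof (cases "?D = {}")
    case True
    hence "?E = {}" using c by (metis card.empty card_0_eq finite)
    thus ?thesis using True e by auto
  next
    case False
    hence Ene: "?E \<noteq> {}" using c by (metis card.empty card_0_eq finite)
    \<comment> \<open>A threshold: weights of removed boxes are at most \<open>M\<close>, those of added boxes at least \<open>M\<close>.\<close>
    define M where "M = Max (s ` ?E)"
    have ME: "s v \<le> M" if "v \<in> ?E" for v unfolding M_def using that by (intro Max_ge) auto
    have "M \<in> s ` ?E" unfolding M_def using Ene by (intro Max_in) auto
    then obtain v0 where v0: "v0 \<in> ?E" "M = s v0" by auto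
    have MD: "M \<le> s u" if "u \<in> ?D" for u
      using lt[OF that v0(1)] T_less_s[of v0 u] v0(2) by simp
    have e2: "normal \<bullet> column_point A = (\<Sum>u\<in>?D. real (s u) - real M) + (\<Sum>u\<in>?E. real M - real (s u))"
      unfolding e sum_subtractf by (simp add: c)
    have pD: "0 \<le> (\<Sum>u\<in>?D. real (s u) - real M)" using MD by (intro sum_nonneg) simp
    have pE: "0 \<le> (\<Sum>u\<in>?E. real M - real (s u))" using ME by (intro sum_nonneg) simp
    have "\<exists>(u, v)\<in>tied. ?D = {u} \<and> ?E = {v}" if z: "normal \<bullet> column_point A = 0"
    proof -
      have "(\<Sum>u\<in>?D. real (s u) - real M) = 0" "(\<Sum>u\<in>?E. real M - real (s u)) = 0"
        using z e2 pD pE by linarith+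
      hence zD: "\<forall>u\<in>?D. real (s u) - real M = 0" and zE: "\<forall>u\<in>?E. real M - real (s u) = 0"
        using sum_nonneg_eq_0_iff[of ?D "\<lambda>u. real (s u) - real M"]
          sum_nonneg_eq_0_iff[of ?E "\<lambda>u. real M - real (s u)"] MD ME by simp_all
      have sD: "s u = M" if "u \<in> ?D" for u using zD[rule_format, OF that] by simp
      have sE': "s v = M" if "v \<in> ?E" for v using zE[rule_format, OF that] by simp
      obtain u0 where u0: "u0 \<in> ?D" using False by blast
      have ne: "u \<noteq> v" if "u \<in> ?D" "v \<in> ?E" for u v using that by blast

      have "u = u0" if u: "u \<in> ?D" for u
        by (rule no_triple[of v0 u u0]) (use sD[OF u] sD[OF u0] v0(2) ne[OF u v0(1)] ne[OF u0 v0(1)] in auto)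
      hence "?D = {u0}" using u0 by blast
      moreover have "v = v0" if v: "v \<in> ?E" for v
        by (rule no_triple[of u0 v v0]) (use sE'[OF v] sD[OF u0] v0(2) ne[OF u0 v] ne[OF u0 v0(1)] in auto)
      hence "?E = {v0}" using v0(1) by blast
      moreover have "(u0, v0) \<in> tied" unfolding tied_iff using lt[OF u0 v0(1)] sD[OF u0] v0 by simp
      ultimately show ?thesis by blast
    qed
    thus ?thesis using e2 pD pE by auto
  qed
  thus "0 \<le> normal \<bullet> column_point A"
    "normal \<bullet> column_point A = 0 \<Longrightarrow> A = I \<or> (\<exists>(u, v)\<in>tied. A - I = {u} \<and> I - A = {v})" by auto
qed

text \<open>The linear parametrization of the additive face.\<close>

definition additive_point :: "(real, 'm) vec \<Rightarrow> (real, 'm) vec \<times> (real, 'a) vec \<times> (real, 'b) vec" where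
  "additive_point lam = (lam, row_sums T lam, col_sums T lam)"

lemma linear_row_sums: "linear (row_sums T)"
  by (rule linearI) (auto simp: row_sums_def vec_eq_iff sum.distrib sum_distrib_left)
lemma linear_col_sums: "linear (col_sums T)"
  by (rule linearI) (auto simp: col_sums_def vec_eq_iff sum.distrib sum_distrib_left)

lemma linear_additive_point: "linear additive_point"
  by (rule linearI) (simp_all add: additive_point_def linear_add[OF linear_row_sums] linear_add[OF linear_col_sums]
      linear_scale[OF linear_row_sums] linear_scale[OF linear_col_sums])

lemma additive_point_omega:
  assumes "n \<le> CARD('m)"
  shows "additive_point (omega n) = column_point (init n)"
proof -
  have "row_sums T (omega n) = fst (\<Sum>u\<in>init n. box_vec u)"
    unfolding vec_eq_iff fst_box_vec_sum
  proof
    fix i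
    have "{u \<in> init n. fst u = i} = Pair i ` {j. pos (T (i, j)) < n}" by (auto simp: init_def)
    hence "card {u \<in> init n. fst u = i} = card {j. pos (T (i, j)) < n}" by (simp add: card_image inj_on_def)
    thus "row_sums T (omega n) $ i = real (card {u \<in> init n. fst u = i})"
      by (simp add: row_sums_def omega_def sum.If_cases)
  qed
  moreover have "col_sums T (omega n) = snd (\<Sum>u\<in>init n. box_vec u)"
    unfolding vec_eq_iff snd_box_vec_sum
  proof
    fix j
    have "{u \<in> init n. snd u = j} = (\<lambda>i. (i, j)) ` {i. pos (T (i, j)) < n}" by (auto simp: init_def)
    hence "card {u \<in> init n. snd u = j} = card {i. pos (T (i, j)) < n}" by (simp add: card_image inj_on_def)
    thus "col_sums T (omega n) $ j = real (card {u \<in> init n. snd u = j})"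
      by (simp add: col_sums_def omega_def sum.If_cases)
  qed
  ultimately show ?thesis by (simp add: additive_point_def column_point_def card_init[OF assms] prod_eq_iff)
qed

text \<open>The vectors \<open>deviation z\<close> with \<open>z\<close> in a face generate the corresponding face of the conormal cone.\<close>

definition deviation :: "(real, 'm) vec \<times> (real, 'a) vec \<times> (real, 'b) vec \<Rightarrow> (real, 'a) vec \<times> (real, 'b) vec" where
  "deviation z = snd z - snd (additive_point (fst z))"

lemma linear_deviation: "linear deviation"
  by (rule linearI) (simp_all add: deviation_def linear_add[OF linear_additive_point] linear_scale[OF linear_additive_point] algebra_simps)

lemma deviation_column_point: "deviation (column_point A) = (\<Sum>u\<in>A. box_vec u) - (\<Sum>u\<in>init (card A). box_vec u)"
proof -
  have "fst (column_point A :: (real, 'm) vec \<times> (real, 'a) vec \<times> (real, 'b) vec) = omega (card A)" by (simp add: column_point_def)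
  thus ?thesis unfolding deviation_def by (simp add: additive_point_omega[OF card_le_m]) (simp add: column_point_def)
qed

definition tie_vectors :: "((real, 'a) vec \<times> (real, 'b) vec) set" where
  "tie_vectors = (\<lambda>(u, v). box_vec u - box_vec v) ` tied"
definition tie_cone where "tie_cone = convex_cone hull tie_vectors"
definition tie_face :: "((real, 'm) vec \<times> (real, 'a) vec \<times> (real, 'b) vec) set" where
  "tie_face = PKron \<inter> {z. normal \<bullet> z = 0}"

lemma deviation_column_point_in_tie_cone: "normal \<bullet> column_point A = 0 \<Longrightarrow> deviation (column_point A) \<in> tie_cone"
proof -
  assume z: "normal \<bullet> column_point A = 0"
  have e: "deviation (column_point A) = (\<Sum>u\<in>A - init (card A). box_vec u) - (\<Sum>u\<in>init (card A) - A. box_vec u)"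
    unfolding deviation_column_point by (rule sum_diff_exchange) auto
  from minimal_sum(2)[OF z] show ?thesis
  proof
    assume "A = init (card A)"
    hence "deviation (column_point A) = 0" unfolding deviation_column_point by simp
    thus ?thesis by (simp add: tie_cone_def convex_cone_hull_contains_0)
  next
    assume "\<exists>(u, v)\<in>tied. A - init (card A) = {u} \<and> init (card A) - A = {v}"
    then obtain u v where uv: "(u, v) \<in> tied" "A - init (card A) = {u}" "init (card A) - A = {v}" by blast
    hence "deviation (column_point A) = box_vec u - box_vec v" unfolding e by simp
    also have "\<dots> \<in> tie_vectors" using uv by (auto simp: tie_vectors_def)
    finally show ?thesis unfolding tie_cone_def by (rule hull_inc)
  qed
qed

text \<open>Both statements hold for the generators and survive nonnegative combinations, because a sum of nonnegative
values vanishes only if all of them do.\<close>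

lemma column_cone_bounds:
  assumes "z \<in> convex_cone hull (range column_point)"
  shows "0 \<le> normal \<bullet> z" "normal \<bullet> z = 0 \<Longrightarrow> deviation z \<in> tie_cone"
proof -
  let ?Z = "{z. 0 \<le> normal \<bullet> z \<and> (normal \<bullet> z = 0 \<longrightarrow> deviation z \<in> tie_cone)}"
  have tie_cone: "convex_cone tie_cone" by (simp add: tie_cone_def convex_cone_convex_cone_hull)
  have "convex_cone hull (range column_point) \<subseteq> ?Z"
  proof (rule hull_minimal)
    show "range column_point \<subseteq> ?Z" using minimal_sum(1) deviation_column_point_in_tie_cone by auto
    show "convex_cone ?Z" unfolding convex_cone_iff
    proof (intro conjI ballI allI impI)
      show "0 \<in> ?Z" using convex_cone_contains_0[OF tie_cone] by (simp add: linear_0[OF linear_deviation])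
      show "z + w \<in> ?Z" if "z \<in> ?Z" "w \<in> ?Z" for z w
        using that convex_cone_add[OF tie_cone, of "deviation z" "deviation w"]
        by (auto simp: inner_add_right linear_add[OF linear_deviation] add_nonneg_eq_0_iff)
      show "c *\<^sub>R z \<in> ?Z" if "z \<in> ?Z" "0 \<le> c" for c z
        using that convex_cone_scaleR[OF tie_cone, of c "deviation z"] convex_cone_contains_0[OF tie_cone]
        by (auto simp: linear_scale[OF linear_deviation])
    qed
  qed
  thus "0 \<le> normal \<bullet> z" "normal \<bullet> z = 0 \<Longrightarrow> deviation z \<in> tie_cone" using assms by auto
qed

lemma PKron_nonneg: "z \<in> PKron \<Longrightarrow> 0 \<le> normal \<bullet> z"
  using column_cone_bounds(1) PKron_subset_column_cone by blast

lemma deviation_tie_face: "z \<in> tie_face \<Longrightarrow> deviation z \<in> tie_cone"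
  using column_cone_bounds(2)[of z] PKron_subset_column_cone unfolding tie_face_def by blast

lemma convex_cone_PKron: "convex_cone (PKron :: ((real, 'm) vec \<times> (real, 'a) vec \<times> (real, 'b) vec) set)"
  unfolding PKron_def by (rule convex_cone_convex_cone_hull)

lemma tie_face_is_face: "tie_face face_of PKron"
  unfolding tie_face_def
proof (rule face_of_Int_supporting_hyperplane_ge)
  show "convex (PKron :: ((real, 'm) vec \<times> (real, 'a) vec \<times> (real, 'b) vec) set)"
    using convex_cone_PKron by (simp add: convex_cone_def)
qed (rule PKron_nonneg)

lemma convex_cone_tie_face: "convex_cone tie_face"
proof -
  have "convex_cone {z. normal \<bullet> z = 0}"
    by (intro subspace_imp_convex_cone subspace_hyperplane)
  thus ?thesis using convex_cone_PKron unfolding tie_face_def convex_cone_iff by auto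
qed

lemma s_strict:
  assumes "i \<le> k" "j \<le> l" "(i, j) \<noteq> (k, l)"
  shows "s (i, j) < s (k, l)"
  using assms x_less[of i k] y_less[of j l] by (cases "i = k"; cases "j = l") (auto simp: boxsum_def)

lemma young_init: "young_set (init n)"
  unfolding young_set_def
proof (intro allI impI)
  fix i j k l assume ij: "(i, j) \<in> init n" and kl: "k \<le> i" "l \<le> j"
  have "T (k, l) \<le> T (i, j)"
    using s_less[OF s_strict[OF kl]] by (cases "(k, l) = (i, j)") auto
  hence "pos (T (k, l)) \<le> pos (T (i, j))" by simp
  thus "(k, l) \<in> init n" using ij unfolding init_def mem_Collect_eq by (rule le_less_trans)
qed

lemma column_point_init_tie_face: "n \<le> CARD('m) \<Longrightarrow> column_point (init n) \<in> tie_face"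
  using young_set_in_PKron[OF young_init card_m] by (simp add: tie_face_def normal_column_point card_init)

text \<open>The smaller box \<open>v\<close> of a tie is replaced by the larger one. All other boxes weakly above and to the left of
\<open>u\<close> have smaller weight than \<open>v\<close>, hence the result is still a Young diagram.\<close>

definition swapped :: "'a \<times> 'b \<Rightarrow> 'a \<times> 'b \<Rightarrow> ('a \<times> 'b) set" where
  "swapped u v = insert u (init (pos (T v)))"

lemma swapped:
  assumes t: "(u, v) \<in> tied"
  shows "card (swapped u v) = Suc (pos (T v))" "init (card (swapped u v)) = insert v (init (pos (T v)))"
    "u \<notin> init (pos (T v))" "v \<notin> init (pos (T v))" "column_point (swapped u v) \<in> tie_face" 
proof -
  have a: "s u = s v" "T v < T u" using t by (auto simp: tied_iff)
  show n: "u \<notin> init (pos (T v))" "v \<notin> init (pos (T v))" using a by (auto simp: init_def)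
  have "card (init (pos (T v))) = pos (T v)" by (intro card_init less_imp_le) simp
  thus c: "card (swapped u v) = Suc (pos (T v))" using n by (simp add: swapped_def)
  show i: "init (card (swapped u v)) = insert v (init (pos (T v)))"
    unfolding c by (auto simp: init_def less_Suc_eq)
  have "young_set (swapped u v)" unfolding young_set_def
  proof (intro allI impI)
    fix i j k l assume ij: "(i, j) \<in> swapped u v" and kl: "k \<le> i" "l \<le> j"
    show "(k, l) \<in> swapped u v"
    proof (cases "(i, j) = u")
      case False
      hence "(i, j) \<in> init (pos (T v))" using ij by (auto simp: swapped_def)
      hence "(k, l) \<in> init (pos (T v))" using young_init kl unfolding young_set_def by blast
      thus ?thesis by (simp add: swapped_def)
    next
      case True
      show ?thesis
      proof (cases "(k, l) = u")
        case False
        hence "s (k, l) < s (i, j)" using True by (intro s_strict kl) auto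
        hence "T (k, l) < T v" using True a by (intro s_less) simp
        thus ?thesis by (simp add: swapped_def init_def)
      qed (simp add: swapped_def)
    qed
  qed
  hence "column_point (swapped u v) \<in> (PKron :: ((real, 'm) vec \<times> (real, 'a) vec \<times> (real, 'b) vec) set)"
    by (rule young_set_in_PKron[OF _ card_m])
  moreover have "normal \<bullet> column_point (swapped u v) = 0"
    unfolding normal_column_point i using n a by (simp add: swapped_def)
  ultimately show "column_point (swapped u v) \<in> tie_face" by (simp add: tie_face_def)
qed

lemma deviation_swapped: "(u, v) \<in> tied \<Longrightarrow> deviation (column_point (swapped u v)) = box_vec u - box_vec v"
  unfolding deviation_column_point swapped(2) using swapped(3,4) by (simp add: swapped_def)

end

context tie_facet
begin

lemma deviation_image_tie_face: "convex_cone hull (deviation ` tie_face) = tie_cone"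
proof
  show "convex_cone hull (deviation ` tie_face) \<subseteq> tie_cone"
  proof (rule hull_minimal)
    show "deviation ` tie_face \<subseteq> tie_cone" using deviation_tie_face by blast
  qed (simp add: tie_cone_def convex_cone_convex_cone_hull)
  have "tie_vectors \<subseteq> deviation ` tie_face" using deviation_swapped swapped(5) by (force simp: tie_vectors_def)
  thus "tie_cone \<subseteq> convex_cone hull (deviation ` tie_face)" unfolding tie_cone_def by (rule hull_mono)
qed

lemma conormal_face_tie_face: "conormal_face T tie_face = tie_cone"
proof -
  have "{(\<mu> - row_sums T lam, \<nu> - col_sums T lam) | lam \<mu> \<nu>. (lam, \<mu>, \<nu>) \<in> tie_face} = deviation ` tie_face"
    by (force simp: deviation_def additive_point_def)
  thus ?thesis using deviation_image_tie_face by (simp add: conormal_face_def)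
qed

text \<open>Summation by parts.\<close>

lemma antimono_decomposition:
  fixes lam :: "(real, 'm) vec"
  assumes a: "antimono (\<lambda>k. lam $ k)" and p: "\<And>k. 0 \<le> lam $ k"
  obtains c :: "nat \<Rightarrow> real" where "\<And>n. 0 \<le> c n" "lam = (\<Sum>n<CARD('m). c n *\<^sub>R omega (Suc n))"
proof -
  define l where "l = (\<lambda>n. if n < CARD('m) then lam $ (SOME k. pos k = n) else 0)"
  have l: "l (pos k) = lam $ k" for k
  proof -
    have "(SOME k'. pos k' = pos k) = k" by (rule some_equality) auto
    thus ?thesis by (simp add: l_def)
  qed
  define c where "c = (\<lambda>n. l n - l (Suc n))"
  have "0 \<le> c n" for n
  proof (cases "Suc n < CARD('m)")
    case True
    then obtain k k' :: 'm where k: "pos k = n" "pos k' = Suc n"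
      using pos_surj[where 'i = 'm] Suc_lessD by metis
    hence "pos k < pos k'" by simp
    hence "k \<le> k'" by simp
    hence "lam $ k' \<le> lam $ k" using antimonoD[OF a] by simp
    thus ?thesis using l[of k] l[of k'] k by (simp add: c_def)
  next
    case False
    hence "l (Suc n) = 0" by (simp add: l_def)
    moreover have "0 \<le> l n" using p by (simp add: l_def)
    ultimately show ?thesis by (simp add: c_def)
  qed
  moreover have "lam = (\<Sum>n<CARD('m). c n *\<^sub>R omega (Suc n))"
    unfolding vec_eq_iff
  proof
    fix k :: 'm
    have "(\<Sum>n<CARD('m). c n *\<^sub>R omega (Suc n)) $ k = (\<Sum>n<CARD('m). if pos k \<le> n then c n else 0)"
      unfolding sum_component by (intro sum.cong) (auto simp: omega_def)
    also have "\<dots> = (\<Sum>n\<in>{..<CARD('m)} \<inter> {n. pos k \<le> n}. c n)" by (simp add: sum.If_cases)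
    also have "{..<CARD('m)} \<inter> {n. pos k \<le> n} = {pos k..<CARD('m)}" by auto
    also have "(\<Sum>n\<in>{pos k..<CARD('m)}. c n) = l (pos k) - l (CARD('m))"
    proof -
      have "(\<Sum>n\<in>{pos k..<CARD('m)}. l (Suc n) - l n) = l (CARD('m)) - l (pos k)"
        by (intro sum_Suc_diff' less_imp_le pos_less_card)
      thus ?thesis by (simp add: c_def sum_subtractf)
    qed
    also have "\<dots> = lam $ k" unfolding l by (simp add: l_def)
    finally show "lam $ k = (\<Sum>n<CARD('m). c n *\<^sub>R omega (Suc n)) $ k" ..
  qed
  ultimately show ?thesis using that by blast
qed

lemma additive_face_subset: "additive_face T \<subseteq> tie_face"
proof
  fix z assume "z \<in> additive_face T"
  then obtain lam where z: "z = additive_point lam" and a: "antimono (\<lambda>k. lam $ k)" and p: "\<And>k. 0 \<le> lam $ k"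
    by (auto simp: additive_face_def additive_point_def)
  obtain c :: "nat \<Rightarrow> real" where c: "\<And>n. 0 \<le> c n" "lam = (\<Sum>n<CARD('m). c n *\<^sub>R omega (Suc n))"
    using antimono_decomposition[OF a p] by blast
  have "z = (\<Sum>n<CARD('m). c n *\<^sub>R additive_point (omega (Suc n)))"
    unfolding z c(2) by (simp add: linear_sum[OF linear_additive_point] linear_scale[OF linear_additive_point])
  also have "\<dots> = (\<Sum>n<CARD('m). c n *\<^sub>R column_point (init (Suc n)))"
    by (intro sum.cong refl) (simp add: additive_point_omega)
  also have "\<dots> \<in> tie_face"
    by (intro convex_cone_sum[OF convex_cone_tie_face] convex_cone_scaleR[OF convex_cone_tie_face] c(1) column_point_init_tie_face) simp
  finally show "z \<in> tie_face" .
qed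

lemma omega_Suc: "omega (Suc (pos k)) = omega (pos k) + axis k 1"
  by (auto simp: vec_eq_iff omega_def axis_def less_Suc_eq)

text \<open>The points of the initial sets give the first component label by label, and the points of the swapped
sets give the equations at the ties.\<close>

lemma vanishing_functional:
  assumes w: "\<And>z. z \<in> tie_face \<Longrightarrow> (L, P, Q) \<bullet> z = 0"
  shows "\<exists>\<alpha> c d. (\<forall>i. P $ i = c + \<alpha> * real (x i)) \<and> (\<forall>j. Q $ j = d + \<alpha> * real (y j))"
    and "(L, P, Q) = graph_functional P Q"
proof -
  have g: "(L, P, Q) \<bullet> column_point A = L \<bullet> omega (card A) + (\<Sum>u\<in>A. P $ fst u + Q $ snd u)" for A
    by (simp add: column_point_def inner_prod_def[of "(L, P, Q)"] inner_sum_right inner_box_vec)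
  have "P $ fst u + Q $ snd u = P $ fst v + Q $ snd v" if t: "(u, v) \<in> tied" for u v
  proof -
    let ?A = "swapped u v" and ?B = "init (card (swapped u v))"
    have "card ?B = card ?A" by (rule card_init[OF card_le_m])
    hence "(\<Sum>u\<in>?A. P $ fst u + Q $ snd u) = (\<Sum>u\<in>?B. P $ fst u + Q $ snd u)"
      using w[OF swapped(5)[OF t]] w[OF column_point_init_tie_face[OF card_le_m[of ?A]]] unfolding g by simp
    thus ?thesis unfolding swapped(2)[OF t] using swapped(3,4)[OF t] by (simp add: swapped_def)
  qed
  from det[of "\<lambda>i. P $ i" "\<lambda>j. Q $ j", OF this]
  show "\<exists>\<alpha> c d. (\<forall>i. P $ i = c + \<alpha> * real (x i)) \<and> (\<forall>j. Q $ j = d + \<alpha> * real (y j))" .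
  have "L $ k = - (P $ fst (inv T k) + Q $ snd (inv T k))" for k
  proof -
    let ?n = "pos k"
    have n: "?n \<le> CARD('m)" "Suc ?n \<le> CARD('m)"       by (rule less_imp_le, rule pos_less_card) (rule Suc_leI, rule pos_less_card)
    have i: "init (Suc ?n) = insert (inv T k) (init ?n)" "inv T k \<notin> init ?n"
    proof -
      have "pos (T u) = pos k \<longleftrightarrow> u = inv T k" for u by (metis inv_T pos_eq_iff)
      thus "init (Suc ?n) = insert (inv T k) (init ?n)" unfolding init_def less_Suc_eq by blast
      show "inv T k \<notin> init ?n" by (simp add: init_def)
    qed
    have "L \<bullet> omega (Suc ?n) + (\<Sum>u\<in>init (Suc ?n). P $ fst u + Q $ snd u) = 0"
      using w[OF column_point_init_tie_face[OF n(2)]] unfolding g card_init[OF n(2)] .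
    moreover have "L \<bullet> omega ?n + (\<Sum>u\<in>init ?n. P $ fst u + Q $ snd u) = 0"
      using w[OF column_point_init_tie_face[OF n(1)]] unfolding g card_init[OF n(1)] .
    ultimately show ?thesis
      unfolding i(1) omega_Suc using i(2) by (simp add: inner_add_right inner_axis)
  qed
  thus "(L, P, Q) = graph_functional P Q" by (simp add: graph_functional_def vec_eq_iff)
qed

text \<open>The constants cancel, as both sets of boxes have the same size.\<close>

lemma affine_functional:
  assumes "\<forall>i. P $ i = c + \<alpha> * real (x i)" "\<forall>j. Q $ j = d + \<alpha> * real (y j)" "z \<in> PKron"
  shows "graph_functional P Q \<bullet> z = \<alpha> * (normal \<bullet> z)"
proof -
  let ?Z = "{z. graph_functional P Q \<bullet> z = \<alpha> * (normal \<bullet> z)}"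
  have "subspace ?Z"
    by (rule subspaceI) (auto simp: inner_add_right distrib_left)
  hence "convex_cone ?Z" by (rule subspace_imp_convex_cone)
  moreover have "range column_point \<subseteq> ?Z"
  proof (rule image_subsetI, rule CollectI)
    fix A :: "('a \<times> 'b) set"
    have h: "P $ fst u + Q $ snd u = (c + d) + \<alpha> * real (s u)" for u
      using assms(1,2) by (simp add: boxsum_def algebra_simps)
    show "graph_functional P Q \<bullet> column_point A = \<alpha> * (normal \<bullet> column_point A)"
      unfolding graph_functional_column_point normal_column_point h
      by (simp add: sum.distrib card_init[OF card_le_m] sum_distrib_left[symmetric] algebra_simps)
  qed
  ultimately have "convex_cone hull (range column_point) \<subseteq> ?Z" by (intro hull_minimal)
  thus ?thesis using assms(3) PKron_subset_column_cone by blast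
qed

section \<open>The face is a facet\<close>

text \<open>The Young diagrams alone do not suffice here: for \<open>a = b = 2\<close> the form vanishes on all of them.\<close>

definition off_point :: "(real, 'm) vec \<times> (real, 'a) vec \<times> (real, 'b) vec" where
  "off_point = (part_vec (one_row 2), omega 2, omega 2)"

lemma inner_omega2:
  fixes P :: "(real, 'i::{finite,linorder}) vec"
  assumes "2 \<le> CARD('i)"
  obtains i j where "i < j" "P \<bullet> omega 2 = P $ i + P $ j"
proof -
  obtain i j :: 'i where ij: "pos i = 0" "pos j = 1"
    using pos_surj[where 'i = 'i, of 0] pos_surj[where 'i = 'i, of 1] assms by auto
  hence "pos i < pos j" by simp
  hence lt: "i < j" by simp
  have "P \<bullet> omega 2 = (\<Sum>k\<in>UNIV. if pos k < 2 then P $ k else 0)"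
    by (simp add: inner_vec_def omega_def if_distrib cong: if_cong)
  also have "\<dots> = (\<Sum>k\<in>{k. pos k < 2}. P $ k)" by (simp add: sum.If_cases)
  also have "{k. pos k < 2} = {i, j}"
  proof -
    have "pos k = 0 \<longleftrightarrow> k = i" "pos k = 1 \<longleftrightarrow> k = j" for k by (metis ij pos_eq_iff)+
    thus ?thesis by (auto simp: less_2_cases_iff)
  qed
  finally have "P \<bullet> omega 2 = P $ i + P $ j" using lt by simp
  thus ?thesis using that lt by blast
qed

text \<open>Its value is the weight of the box \<open>(1, 1)\<close> plus the weight of the box \<open>(2, 2)\<close> minus twice the
least weight.\<close>

lemma off_point_pos: "0 < normal \<bullet> off_point"
proof -
  obtain i0 i1 where i: "i0 < i1" "xv \<bullet> omega 2 = xv $ i0 + xv $ i1" using inner_omega2[OF two(1)] .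
  obtain j0 j1 where j: "j0 < j1" "yv \<bullet> omega 2 = yv $ j0 + yv $ j1" using inner_omega2[OF two(2)] .
  obtain k0 :: 'm where k0: "pos k0 = 0" using pos_surj[where 'i = 'm, of 0] by auto
  have min: "s (inv T k0) \<le> s u" for u
  proof -
    have "pos k0 \<le> pos (T u)" using k0 by simp
    hence "T (inv T k0) \<le> T u" by simp
    thus ?thesis by (rule T_less_s)
  qed
  have "(\<chi> k. real (s (inv T k))) \<bullet> part_vec (one_row 2) = (\<Sum>k\<in>UNIV. if k = k0 then 2 * real (s (inv T k0)) else 0)"
    unfolding inner_vec_def
  proof (intro sum.cong refl)
    fix k :: 'm
    have "pos k = 0 \<longleftrightarrow> k = k0" by (metis k0 pos_eq_iff)
    thus "(\<chi> k. real (s (inv T k))) $ k \<bullet> part_vec (one_row 2) $ k = (if k = k0 then 2 * real (s (inv T k0)) else 0)"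
      by (simp add: part_vec_nth one_row_def)
  qed
  hence "(\<chi> k. real (s (inv T k))) \<bullet> part_vec (one_row 2) = 2 * real (s (inv T k0))" by simp
  hence "normal \<bullet> off_point = (xv $ i0 + xv $ i1) + (yv $ j0 + yv $ j1) - 2 * real (s (inv T k0))"
    by (simp add: normal_def graph_functional_def off_point_def i j) (simp add: xv_def yv_def boxsum_def)
  also have "\<dots> = real (s (i0, j0)) + real (s (i1, j1)) - 2 * real (s (inv T k0))"
    by (simp add: xv_def yv_def boxsum_def)
  finally have "normal \<bullet> off_point = real (s (i0, j0)) + real (s (i1, j1)) - 2 * real (s (inv T k0))" .
  moreover have "s (i0, j0) < s (i1, j1)" using i j by (intro s_strict) auto
  ultimately show ?thesis using min[of "(i0, j0)"] by simp
qed

lemma off_point_PKron: "off_point \<in> PKron"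
  unfolding off_point_def by (rule extra_point_in_PKron[OF two])

text \<open>A linear form that vanishes on the face and at one point of the cone off the face vanishes on the whole
cone. So the span of the cone exceeds that of the face by at most one dimension.\<close>

lemma tie_face_facet: "tie_face facet_of PKron"
proof -
  let ?PK = "PKron :: ((real, 'm) vec \<times> (real, 'a) vec \<times> (real, 'b) vec) set"
  have 0: "0 \<in> tie_face" by (rule convex_cone_contains_0[OF convex_cone_tie_face])
  hence zP: "0 \<in> ?PK" by (simp add: tie_face_def)
  have dimF: "aff_dim tie_face = int (dim tie_face)" by (rule aff_dim_zero) (rule hull_inc[OF 0])
  have dimP: "aff_dim ?PK = int (dim ?PK)" by (rule aff_dim_zero) (rule hull_inc[OF zP])
  have "?PK \<subseteq> span (insert off_point tie_face)"
  proof
    fix z assume z: "z \<in> ?PK"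
    obtain a b where a: "a \<in> span (insert off_point tie_face)" and b: "\<And>w. w \<in> span (insert off_point tie_face) \<Longrightarrow> orthogonal b w"
      and zab: "z = a + b"
      using orthogonal_subspace_decomp_exists[of "insert off_point tie_face" z] by blast
    obtain L P Q where lpq: "b = (L, P, Q)" by (cases b)
    have vF: "(L, P, Q) \<bullet> w = 0" if "w \<in> tie_face" for w
      using b[of w] that span_base[of w "insert off_point tie_face"] by (simp add: lpq orthogonal_def)
    obtain \<alpha> c d where acd: "\<forall>i. P $ i = c + \<alpha> * real (x i)" "\<forall>j. Q $ j = d + \<alpha> * real (y j)"
      using vanishing_functional(1)[OF vF] by blast
    have bw: "b = graph_functional P Q" using vanishing_functional(2)[OF vF] lpq by simp
    have "b \<bullet> off_point = 0" using b[of off_point] span_base[of off_point "insert off_point tie_face"] by (simp add: orthogonal_def)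
    hence "\<alpha> = 0" using affine_functional[OF acd off_point_PKron] off_point_pos by (simp add: bw)
    hence "b \<bullet> z = 0" using affine_functional[OF acd z] by (simp add: bw)
    moreover have "b \<bullet> a = 0" using b[OF a] by (simp add: orthogonal_def)
    ultimately have "b \<bullet> b = 0" unfolding zab by (simp add: inner_add_right)
    thus "z \<in> span (insert off_point tie_face)" using a zab by simp
  qed
  from dim_subset[OF this] have "dim ?PK \<le> dim (insert off_point tie_face)" unfolding dim_span .
  also have "\<dots> \<le> dim tie_face + 1" by (simp add: dim_insert)
  finally have "aff_dim ?PK \<le> aff_dim tie_face + 1" by (simp add: dimF dimP)
  moreover have "aff_dim tie_face < aff_dim ?PK"
  proof (rule face_of_aff_dim_lt[OF _ tie_face_is_face])
    show "convex ?PK" using convex_cone_PKron by (simp add: convex_cone_def)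
    have "off_point \<notin> tie_face" using off_point_pos by (simp add: tie_face_def)
    thus "tie_face \<noteq> ?PK" using off_point_PKron by blast
  qed
  ultimately show ?thesis using tie_face_is_face 0 by (auto simp: facet_of_def)
qed

section \<open>The face is strongly simplicial\<close>

definition tie_pairs :: "('m \<times> 'm) set" where "tie_pairs = (\<lambda>(u, v). (T v, T u)) ` tied"

lemma card_tie_pairs: "card tie_pairs = CARD('a) + CARD('b) - 3"
proof -
  have "inj_on (\<lambda>(u, v). (T v, T u)) tied" by (auto simp: inj_on_def)
  thus ?thesis unfolding tie_pairs_def by (simp add: card_image card_box_ties)
qed

lemma mem_tie_pairs: "(k, l) \<in> tie_pairs \<longleftrightarrow> (inv T l, inv T k) \<in> tied"
proof
  assume "(inv T l, inv T k) \<in> tied"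
  hence "(T (inv T k), T (inv T l)) \<in> tie_pairs" unfolding tie_pairs_def by force
  thus "(k, l) \<in> tie_pairs" by simp
qed (auto simp: tie_pairs_def)

lemma tie_vectors_eq: "tie_vectors = {gvec T l - gvec T k | k l. (k, l) \<in> tie_pairs}"
proof -
  have "gvec T k = box_vec (inv T k)" for k using gvec_T[of "inv T k"] by simp
  note g = this
  show ?thesis
  proof (intro equalityI subsetI)
    fix w assume "w \<in> tie_vectors"
    then obtain u v where uv: "(u, v) \<in> tied" "w = box_vec u - box_vec v" unfolding tie_vectors_def by auto
    hence "(T v, T u) \<in> tie_pairs" "w = gvec T (T u) - gvec T (T v)" by (simp_all add: mem_tie_pairs gvec_T)
    thus "w \<in> {gvec T l - gvec T k | k l. (k, l) \<in> tie_pairs}" by blast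
  next
    fix w assume "w \<in> {gvec T l - gvec T k | k l. (k, l) \<in> tie_pairs}"
    then obtain k l where kl: "(k, l) \<in> tie_pairs" "w = gvec T l - gvec T k" by blast
    hence "(inv T l, inv T k) \<in> tied" "w = (\<lambda>(u, v). box_vec u - box_vec v) (inv T l, inv T k)"
      by (simp_all add: mem_tie_pairs g)
    thus "w \<in> tie_vectors" unfolding tie_vectors_def by (rule rev_image_eqI)
  qed
qed

lemma inner_tie_vectors: "v \<in> tie_cone \<Longrightarrow> (xv, yv) \<bullet> v = 0"
proof -
  have "tie_cone \<subseteq> {v. (xv, yv) \<bullet> v = 0}" unfolding tie_cone_def
  proof (rule hull_minimal)
    show "convex_cone {v. (xv, yv) \<bullet> v = 0}" by (intro subspace_imp_convex_cone subspace_hyperplane)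
    show "tie_vectors \<subseteq> {v. (xv, yv) \<bullet> v = 0}"
      by (auto simp: tie_vectors_def inner_diff_right inner_box_vec tied_iff boxsum_def xv_def yv_def simp flip: of_nat_add)
  qed
  thus "v \<in> tie_cone \<Longrightarrow> (xv, yv) \<bullet> v = 0" by blast
qed

text \<open>A vector orthogonal to all tie vectors satisfies the equations at the ties, so it is a combination of the
weights and of the two constant vectors; the orthogonal complement has dimension at most 3.\<close>

lemma dim_tie_vectors: "dim tie_vectors = CARD('a) + CARD('b) - 3"
proof (rule antisym)
  have "dim tie_vectors \<le> card tie_vectors" by (rule dim_le_card') (simp add: tie_vectors_def)
  also have "\<dots> \<le> card tied" unfolding tie_vectors_def by (rule card_image_le) simp
  finally show "dim tie_vectors \<le> CARD('a) + CARD('b) - 3" by (simp add: card_box_ties)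
  let ?one_a = "(\<chi> i. 1) :: (real, 'a) vec" and ?one_b = "(\<chi> j. 1) :: (real, 'b) vec"
  let ?O = "{w \<in> UNIV. \<forall>v \<in> span tie_vectors. orthogonal v w}"
  let ?S = "{(xv, yv), (?one_a, 0), (0, ?one_b)}"
  have "?O \<subseteq> span ?S"
  proof
    fix w assume w: "w \<in> ?O"
    obtain P Q where pq: "w = (P, Q)" by (cases w)
    have "P $ fst u + Q $ snd u = P $ fst v + Q $ snd v" if t: "(u, v) \<in> tied" for u v
    proof -
      have "box_vec u - box_vec v \<in> span tie_vectors" by (rule span_base) (use t in \<open>force simp: tie_vectors_def\<close>)
      hence "(P, Q) \<bullet> (box_vec u - box_vec v) = 0" using w pq by (auto simp: orthogonal_def inner_commute)
      thus ?thesis by (simp add: inner_diff_right inner_box_vec)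
    qed
    from det[of "\<lambda>i. P $ i" "\<lambda>j. Q $ j", OF this]
    obtain \<alpha> c d where acd: "\<forall>i. P $ i = c + \<alpha> * real (x i)" "\<forall>j. Q $ j = d + \<alpha> * real (y j)" by blast
    have "w = \<alpha> *\<^sub>R (xv, yv) + c *\<^sub>R (?one_a, 0) + d *\<^sub>R (0, ?one_b)"
      using acd by (simp add: pq vec_eq_iff xv_def yv_def)
    also have "\<dots> \<in> span ?S" by (intro span_add span_scale span_base) auto
    finally show "w \<in> span ?S" .
  qed
  from dim_subset[OF this] have "dim ?O \<le> dim ?S" unfolding dim_span .
  also have "\<dots> \<le> card ?S" by (rule dim_le_card') simp
  also have "\<dots> \<le> 3" by (simp add: card_insert_if)
  finally have "dim ?O \<le> 3" .
  moreover have "dim ?O + dim (span tie_vectors) = dim (UNIV :: ((real, 'a) vec \<times> (real, 'b) vec) set)"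
    by (rule dim_subspace_orthogonal_to_vectors) auto
  moreover have "dim (UNIV :: ((real, 'a) vec \<times> (real, 'b) vec) set) = CARD('a) + CARD('b)"
    by (simp add: dim_UNIV)
  ultimately show "CARD('a) + CARD('b) - 3 \<le> dim tie_vectors" by simp
qed

lemma aff_dim_tie_cone: "aff_dim tie_cone = int (card tie_pairs)"
proof -
  have "aff_dim tie_cone = int (dim tie_cone)"
    unfolding tie_cone_def by (rule aff_dim_zero) (rule hull_inc[OF convex_cone_hull_contains_0])
  moreover have "dim tie_cone = dim tie_vectors"
  proof (rule antisym)
    have "tie_cone \<subseteq> span tie_vectors" unfolding tie_cone_def by (rule hull_minimal) (auto simp: span_superset convex_cone_span)
    from dim_subset[OF this] show "dim tie_cone \<le> dim tie_vectors" unfolding dim_span .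
    show "dim tie_vectors \<le> dim tie_cone" unfolding tie_cone_def by (intro dim_subset hull_subset)
  qed
  ultimately show ?thesis by (simp add: dim_tie_vectors card_tie_pairs)
qed

lemma tie_pairs_consecutive: "(k, l) \<in> tie_pairs \<Longrightarrow> consecutive k l"
proof -
  assume "(k, l) \<in> tie_pairs"
  then obtain u v where uv: "(u, v) \<in> tied" "k = T v" "l = T u" by (auto simp: tie_pairs_def)
  have e: "s u = s v" "T v < T u" using uv by (auto simp: tied_iff)
  have "\<not> (T v < r \<and> r < T u)" for r
  proof
    assume r: "T v < r \<and> r < T u"
    let ?w = "inv T r"
    have r': "T v < T ?w" "T ?w < T u" using r by auto
    hence "s v \<le> s ?w" "s ?w \<le> s u" using T_less_s by (meson less_imp_le)+
    hence "s u = s ?w" using e by simp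
    moreover have "u \<noteq> ?w" "u \<noteq> v" "v \<noteq> ?w" using r' e(2) by auto
    ultimately show False using no_triple[of u v ?w] e by simp
  qed
  thus "consecutive k l" using e uv by (auto simp: consecutive_def)
qed

lemma tie_face_strongly_simplicial: "strongly_simplicial tie_face"
  unfolding strongly_simplicial_def
proof (intro conjI tie_face_is_face exI[of _ T] exI[of _ "card tie_pairs"] exI[of _ tie_pairs] additive_T additive_face_subset refl,
    unfold conormal_face_tie_face)
  show "\<forall>(k, l)\<in>tie_pairs. consecutive k l" using tie_pairs_consecutive by blast
  show "aff_dim tie_cone = int (card tie_pairs)" by (rule aff_dim_tie_cone)
  show "tie_cone = convex_cone hull {gvec T l - gvec T k | k l. (k, l) \<in> tie_pairs}" by (simp add: tie_cone_def tie_vectors_eq)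
  show "\<forall>(k, l)\<in>tie_pairs. (CARD('b) \<noteq> 2 \<longrightarrow> \<not> horizontal (gvec T l - gvec T k)) \<and>
                     (CARD('a) \<noteq> 2 \<longrightarrow> \<not> vertical (gvec T l - gvec T k))"
  proof (rule ballI)
    fix e assume e: "e \<in> tie_pairs"
    obtain k l where kl: "e = (k, l)" by (cases e)
    obtain u v where uv: "(u, v) \<in> tied" "k = T v" "l = T u" using e kl by (auto simp: tie_pairs_def)
    hence ne: "fst u \<noteq> fst v" "snd u \<noteq> snd v" by (auto simp: box_ties_def)
    have g: "gvec T l - gvec T k = (axis (fst u) 1 - axis (fst v) 1, axis (snd u) 1 - axis (snd v) 1)"
      unfolding uv gvec_T by (simp add: box_vec_def)
    have "axis (fst u) (1::real) \<noteq> axis (fst v) 1" "axis (snd u) (1::real) \<noteq> axis (snd v) 1"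
      using ne by (auto simp: axis_eq_axis)
    hence "\<not> horizontal (gvec T l - gvec T k)" "\<not> vertical (gvec T l - gvec T k)"
      unfolding g horizontal_def vertical_def by simp_all
    thus "case e of (k, l) \<Rightarrow> (CARD('b) \<noteq> 2 \<longrightarrow> \<not> horizontal (gvec T l - gvec T k)) \<and>
          (CARD('a) \<noteq> 2 \<longrightarrow> \<not> vertical (gvec T l - gvec T k))"
      unfolding kl by simp
  qed
  show "\<forall>p q. q < p \<and> gvec T p - gvec T q \<in> tie_cone \<longrightarrow>
                (\<exists>(k, l)\<in>tie_pairs. gvec T p - gvec T q = gvec T l - gvec T k)"
  proof clarify
    fix p q assume pq: "q < p" and tie_cone: "gvec T p - gvec T q \<in> tie_cone"
    let ?u = "inv T p" and ?v = "inv T q"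
    have g: "gvec T p = box_vec ?u" "gvec T q = box_vec ?v" using gvec_T[of ?u] gvec_T[of ?v] by simp_all
    have "real (s ?u) = real (s ?v)"
      using inner_tie_vectors[OF tie_cone] by (simp add: g inner_diff_right inner_box_vec boxsum_def xv_def yv_def)
    hence "(?u, ?v) \<in> tied" using pq by (simp add: tied_iff)
    hence "(q, p) \<in> tie_pairs" by (simp add: mem_tie_pairs)
    thus "\<exists>(k, l)\<in>tie_pairs. gvec T p - gvec T q = gvec T l - gvec T k" by blast
  qed
  show "\<forall>(k, l)\<in>tie_pairs. \<forall>(k', l')\<in>tie_pairs. (k, l) \<noteq> (k', l') \<longrightarrow> {k, l} \<inter> {k', l'} = {}"
  proof -
    have "{k, l} \<inter> {k', l'} = {}"
      if kl: "(k, l) \<in> tie_pairs" "(k', l') \<in> tie_pairs" and ne: "(k, l) \<noteq> (k', l')" for k l k' l'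
    proof -
    obtain u v where uv: "(u, v) \<in> tied" "k = T v" "l = T u" using kl by (auto simp: tie_pairs_def)
    obtain u' v' where uv': "(u', v') \<in> tied" "k' = T v'" "l' = T u'" using kl by (auto simp: tie_pairs_def)
    have e: "s u = s v" "s u' = s v'" using uv uv' by (auto simp: tied_iff)
    have "s u \<noteq> s u'" using tied_unique[OF uv(1) uv'(1)] ne uv uv' by auto
    thus "{k, l} \<inter> {k', l'} = {}" using e uv uv' by auto
    qed
    thus ?thesis by blast
  qed
qed

end

text \<open>The last two clauses recover the weights from the facet, up to translations and a factor.\<close>

theorem facet_of_weights:
  fixes x :: "'a::{finite,linorder} \<Rightarrow> nat" and y :: "'b::{finite,linorder} \<Rightarrow> nat"
  assumes card_m: "CARD('m::{finite,linorder}) = CARD('a) * CARD('b)"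
    and two: "2 \<le> CARD('a)" "2 \<le> CARD('b)"
    and mono: "strict_mono x" "strict_mono y"
    and card_box_ties: "card (box_ties x y) = CARD('a) + CARD('b) - 3"
    and inj_box_ties: "inj_on (\<lambda>(u, v). boxsum x y u) (box_ties x y)"
    and det: "\<And>P Q :: _ \<Rightarrow> real. (\<And>u v. (u, v) \<in> box_ties x y \<Longrightarrow> P (fst u) + Q (snd u) = P (fst v) + Q (snd v))
        \<Longrightarrow> \<exists>\<alpha> c d. (\<forall>i. P i = c + \<alpha> * real (x i)) \<and> (\<forall>j. Q j = d + \<alpha> * real (y j))"
  shows "\<exists>F :: ((real, 'm) vec \<times> (real, 'a) vec \<times> (real, 'b) vec) set.
     F facet_of PKron \<and> strongly_simplicial F \<and>
     (\<exists>L. \<forall>z\<in>F. (L, (\<chi> i. real (x i)), (\<chi> j. real (y j))) \<bullet> z = 0) \<and>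
     (\<forall>L P Q. (\<forall>z\<in>F. (L, P, Q) \<bullet> z = 0) \<longrightarrow>
        (\<exists>\<alpha> c d. (\<forall>i. P $ i = c + \<alpha> * real (x i)) \<and> (\<forall>j. Q $ j = d + \<alpha> * real (y j))))"
proof -
  \<comment> \<open>The remainder is smaller than \<open>CARD('b)\<close>, so the key compares weights first and columns second.\<close>
  let ?key = "\<lambda>u. CARD('b) * boxsum x y u + pos (snd u)"
  have "inj ?key"
  proof (rule injI)
    fix u v assume e: "?key u = ?key v"
    have "?key w div CARD('b) = boxsum x y w" "?key w mod CARD('b) = pos (snd w)" for w by simp_all
    hence "boxsum x y u = boxsum x y v" "pos (snd u) = pos (snd v)" using e by metis+
    hence "snd u = snd v" "x (fst u) = x (fst v)" by (auto simp: boxsum_def)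
    thus "u = v" using strict_mono_eq[OF mono(1)] by (simp add: prod_eq_iff)
  qed
  then obtain T :: "'a \<times> 'b \<Rightarrow> 'm" where T: "bij T" "\<And>u v. T u < T v \<longleftrightarrow> ?key u < ?key v"
    using order_tableau_exists[where 'm = 'm, of ?key] card_m by auto
  interpret tie_facet x y T
    by unfold_locales (fact assms T)+
  have "\<forall>z\<in>tie_face. (fst normal, (\<chi> i. real (x i)), (\<chi> j. real (y j))) \<bullet> z = 0"
    by (auto simp: tie_face_def normal_def graph_functional_def xv_def yv_def)
  thus ?thesis using tie_face_facet tie_face_strongly_simplicial vanishing_functional(1) by blast
qed

section \<open>Counting the facets\<close>

lemma weights_on_types:
  assumes g: "grow_weights B (CARD('a) + CARD('b) - 4) = (CARD('a), CARD('b), xn, yn)"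
    and two: "2 \<le> CARD('a::{finite,linorder})" "2 \<le> CARD('b::{finite,linorder})"
  defines "x \<equiv> \<lambda>i :: 'a. xn (pos i)" and "y \<equiv> \<lambda>j :: 'b. yn (pos j)"
  shows "strict_mono x" "strict_mono y" "card (box_ties x y) = CARD('a) + CARD('b) - 3"
    "inj_on (\<lambda>(u, v). boxsum x y u) (box_ties x y)"
    "(\<And>u v. (u, v) \<in> box_ties x y \<Longrightarrow> P (fst u) + Q (snd u) = P (fst v) + Q (snd v))
        \<Longrightarrow> \<exists>\<alpha> c d. (\<forall>i. P i = c + \<alpha> * real (x i)) \<and> (\<forall>j. Q j = d + \<alpha> * real (y j))"
proof -
  let ?p = "CARD('a)" and ?q = "CARD('b)"
  have t: "tight ?p ?q xn yn" by (rule tight_grow[OF g])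
  show "strict_mono x" "strict_mono y"
    using t by (auto simp: tight_def strict_mono_on_def strict_mono_def x_def y_def)
  let ?e = "\<lambda>u::'a \<times> 'b. (pos (fst u), pos (snd u))"
  let ?f = "\<lambda>(u, v). (?e u, ?e v)"
  have inj: "inj_on ?f S" for S by (auto simp: inj_on_def prod_eq_iff)
  have im: "?f ` box_ties x y = index_ties ?p ?q xn yn"
  proof (intro equalityI subsetI)
    fix t assume "t \<in> ?f ` box_ties x y"
    then obtain u v where uv: "(u, v) \<in> box_ties x y" "t = (?e u, ?e v)" by auto
    thus "t \<in> index_ties ?p ?q xn yn" by (auto simp: index_ties_def box_ties_def boxsum_def x_def y_def)
  next
    fix t assume "t \<in> index_ties ?p ?q xn yn"
    then obtain i j k l where ijkl: "t = ((i, j), (k, l))" "i < k" "k < ?p" "l < j" "j < ?q" "xn i + yn j = xn k + yn l"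
      by (auto simp: index_ties_def)
    obtain i' k' :: 'a where a: "pos i' = i" "pos k' = k"
      using pos_surj[where 'i = 'a, of i] pos_surj[where 'i = 'a, of k] ijkl by auto
    obtain j' l' :: 'b where b: "pos j' = j" "pos l' = l"
      using pos_surj[where 'i = 'b, of j] pos_surj[where 'i = 'b, of l] ijkl by auto
    have "pos i' < pos k'" "pos l' < pos j'" using ijkl a b by auto
    hence "i' < k'" "l' < j'" by simp_all
    hence "((i', j'), (k', l')) \<in> box_ties x y" using ijkl a b by (simp add: box_ties_def boxsum_def x_def y_def)
    thus "t \<in> ?f ` box_ties x y" by (rule rev_image_eqI) (simp add: ijkl a b)
  qed
  show "card (box_ties x y) = ?p + ?q - 3"
    using card_image[OF inj, of "box_ties x y"] t unfolding im tight_def by simp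
  show "inj_on (\<lambda>(u, v). boxsum x y u) (box_ties x y)"
  proof -
    have "inj_on (\<lambda>(u, v). xn (fst u) + yn (snd u)) (?f ` box_ties x y)" using t unfolding im tight_def by blast
    from comp_inj_on[OF inj this]
    show ?thesis by (simp add: o_def case_prod_unfold boxsum_def x_def y_def)
  qed
  assume h: "\<And>u v. (u, v) \<in> box_ties x y \<Longrightarrow> P (fst u) + Q (snd u) = P (fst v) + Q (snd v)"
  define Pn where "Pn = (\<lambda>n. P (SOME i. pos i = n))"
  define Qn where "Qn = (\<lambda>n. Q (SOME j. pos j = n))"
  have Pn: "Pn (pos i) = P i" for i
  proof -
    have "(SOME i'. pos i' = pos i) = i" by (rule some_equality) auto
    thus ?thesis by (simp add: Pn_def)
  qed
  have Qn: "Qn (pos j) = Q j" for j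
  proof -
    have "(SOME j'. pos j' = pos j) = j" by (rule some_equality) auto
    thus ?thesis by (simp add: Qn_def)
  qed
  have "\<forall>(u, v)\<in>index_ties ?p ?q xn yn. Pn (fst u) + Qn (snd u) = Pn (fst v) + Qn (snd v)"
    unfolding im[symmetric] using h by (auto simp: Pn Qn)
  then obtain \<alpha> where "\<forall>i<?p. Pn i = Pn 0 + \<alpha> * real (xn i)" "\<forall>j<?q. Qn j = Qn 0 + \<alpha> * real (yn j)"
    using t unfolding tight_def by blast
  hence "P i = Pn 0 + \<alpha> * real (x i)" "Q j = Qn 0 + \<alpha> * real (y j)" for i j
    unfolding x_def y_def Pn[symmetric] Qn[symmetric] using pos_less_card by blast+
  thus "\<exists>\<alpha> c d. (\<forall>i. P i = c + \<alpha> * real (x i)) \<and> (\<forall>j. Q j = d + \<alpha> * real (y j))" by blast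
qed

theorem proposition4:
  assumes "CARD('a::{finite,linorder}) \<ge> 2"
    and "CARD('b::{finite,linorder}) \<ge> 2"
    and "CARD('m::{finite,linorder}) = CARD('a) * CARD('b)"
  shows "\<exists>\<F> :: ((real, 'm) vec \<times> (real, 'a) vec \<times> (real, 'b) vec) set set.
           finite \<F> \<and>
           card \<F> \<ge> (CARD('a) + CARD('b) - 4) choose (CARD('b) - 2) \<and>
           (\<forall>F\<in>\<F>. F facet_of PKron \<and> strongly_simplicial F)"
proof -
  let ?N = "CARD('a) + CARD('b) - 4"
  define \<B> where "\<B> = {B. B \<subseteq> {..<?N} \<and> card B = CARD('b) - 2}"
  define xn where "xn = (\<lambda>B. fst (snd (snd (grow_weights B ?N))))"
  define yn where "yn = (\<lambda>B. snd (snd (snd (grow_weights B ?N))))"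
  define x where "x = (\<lambda>B (i :: 'a). xn B (pos i))"
  define y where "y = (\<lambda>B (j :: 'b). yn B (pos j))"
  have g: "grow_weights B ?N = (CARD('a), CARD('b), xn B, yn B)" if B: "B \<in> \<B>" for B
  proof -
    obtain p q x' y' where e: "grow_weights B ?N = (p, q, x', y')" by (metis prod_cases4)
    have sub: "B \<subseteq> {..<?N}" and c: "card B = CARD('b) - 2" using B by (auto simp: \<B>_def)
    have "card ({..<?N} - B) = ?N - card B"
      using sub by (simp add: card_Diff_subset finite_subset)
    moreover have "{..<?N} \<inter> B = B" using sub by blast
    ultimately have "p = CARD('a)" "q = CARD('b)" using grow_weights_size[OF e] c assms(1,2) by auto
    thus ?thesis using e by (simp add: xn_def yn_def)
  qed
  have "\<exists>F :: ((real, 'm) vec \<times> (real, 'a) vec \<times> (real, 'b) vec) set.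
     F facet_of PKron \<and> strongly_simplicial F \<and>
     (\<exists>L. \<forall>z\<in>F. (L, (\<chi> i. real (x B i)), (\<chi> j. real (y B j))) \<bullet> z = 0) \<and>
     (\<forall>L P Q. (\<forall>z\<in>F. (L, P, Q) \<bullet> z = 0) \<longrightarrow>
        (\<exists>\<alpha> c d. (\<forall>i. P $ i = c + \<alpha> * real (x B i)) \<and> (\<forall>j. Q $ j = d + \<alpha> * real (y B j))))"
    if B: "B \<in> \<B>" for B
    unfolding x_def y_def
    by (rule facet_of_weights[OF assms(3,1,2) weights_on_types[OF g[OF B] assms(1,2)]])
  then obtain \<Phi> :: "nat set \<Rightarrow> ((real, 'm) vec \<times> (real, 'a) vec \<times> (real, 'b) vec) set" where
    facet: "\<And>B. B \<in> \<B> \<Longrightarrow> \<Phi> B facet_of PKron \<and> strongly_simplicial (\<Phi> B)" and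
    normal: "\<And>B. B \<in> \<B> \<Longrightarrow> \<exists>L. \<forall>z\<in>\<Phi> B. (L, (\<chi> i. real (x B i)), (\<chi> j. real (y B j))) \<bullet> z = 0" and
    unique: "\<And>B L P Q. B \<in> \<B> \<Longrightarrow> \<forall>z\<in>\<Phi> B. (L, P, Q) \<bullet> z = 0 \<Longrightarrow>
        \<exists>\<alpha> c d. (\<forall>i. P $ i = c + \<alpha> * real (x B i)) \<and> (\<forall>j. Q $ j = d + \<alpha> * real (y B j))"
    by metis
  have "inj_on \<Phi> \<B>"
  proof (rule inj_onI)
    fix B B' assume B: "B \<in> \<B>" and B': "B' \<in> \<B>" and e: "\<Phi> B = \<Phi> B'"
    obtain L where "\<forall>z\<in>\<Phi> B. (L, (\<chi> i. real (x B' i)), (\<chi> j. real (y B' j))) \<bullet> z = 0"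
      using normal[OF B'] e by auto
    from unique[OF B this] obtain \<alpha> c d where
      P: "\<And>i. real (x B' i) = c + \<alpha> * real (x B i)" and Q: "\<And>j. real (y B' j) = d + \<alpha> * real (y B j)"
      by auto
    have t: "tight CARD('a) CARD('b) (xn B) (yn B)" "tight CARD('a) CARD('b) (xn B') (yn B')"
      using tight_grow[OF g[OF B]] tight_grow[OF g[OF B']] by auto
    obtain i0 i1 :: 'a where i: "pos i0 = 0" "pos i1 = CARD('a) - 1"
      using pos_surj[where 'i = 'a, of 0] pos_surj[where 'i = 'a, of "CARD('a) - 1"] assms(1) by auto
    obtain j0 j1 :: 'b where j: "pos j0 = 0" "pos j1 = CARD('b) - 1"
      using pos_surj[where 'i = 'b, of 0] pos_surj[where 'i = 'b, of "CARD('b) - 1"] assms(2) by auto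
    have "x B i0 = 0" "x B' i0 = 0" "y B j0 = 0" "y B' j0 = 0"
      using t i j by (auto simp: x_def y_def tight_def)
    \<comment> \<open>Both systems of weights start at 0, which leaves only the common factor.\<close>
    hence "c = 0" "d = 0" using P[of i0] Q[of j0] by auto
    hence "real (x B' i1) = \<alpha> * real (x B i1)" "real (y B' j1) = \<alpha> * real (y B j1)" using P Q by auto
    hence "real (x B i1) * real (y B' j1) = real (x B' i1) * real (y B j1)" by simp
    hence "x B i1 * y B' j1 = x B' i1 * y B j1" by (simp only: of_nat_mult[symmetric] of_nat_eq_iff)
    hence "fst (top_weights (grow_weights B ?N)) * snd (top_weights (grow_weights B' ?N)) = fst (top_weights (grow_weights B' ?N)) * snd (top_weights (grow_weights B ?N))"
      unfolding g[OF B] g[OF B'] by (simp add: top_weights_def x_def y_def i j)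
    hence "k \<in> B \<longleftrightarrow> k \<in> B'" if "k < ?N" for k using top_weights_inj that by blast
    thus "B = B'" using B B' by (auto simp: \<B>_def)
  qed
  hence "card (\<Phi> ` \<B>) = card \<B>" by (rule card_image)
  also have "card \<B> = ?N choose (CARD('b) - 2)"
    using n_subsets[of "{..<?N}" "CARD('b) - 2"] by (simp add: \<B>_def)
  finally have "card (\<Phi> ` \<B>) = ?N choose (CARD('b) - 2)" .
  moreover have "finite \<B>" by (rule finite_subset[of _ "Pow {..<?N}"]) (auto simp: \<B>_def)
  ultimately show ?thesis using facet by (intro exI[of _ "\<Phi> ` \<B>"]) auto
qed

end
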